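(* For well-formed CCCP configurations $\mathcal C_1,\mathcal C_2$: if $\mathcal C_1\simeq\mathcal C_2$ then $\mathcal C_1\approx\mathcal C_2$. More precisely, the relation $\{(\mathcal C_1,\mathcal C_2)\mid \mathcal C_1,\mathcal C_2\text{ well-formed},\ \mathcal C_1\simeq\mathcal C_2\}$ is a bisimulation.
   Context: CCCP syntax. Fix a set of channels (ranged over by $c,d$) and a set of values containing data variables $x,y$ and a special error value $\mathtt{err}$; closed values $v,w$ contain no variables, and each closed value $v$ has a transmission time $\delta_v\in\mathbb{N}$ with $\delta_v\ge 1$. Expressions $e$ are built from values; closed expressions evaluate to closed values via $[\![e]\!]$. Station code (processes) is given by $P,Q ::= c!\langle e\rangle.P \mid \lfloor ?c(x).P\rfloor Q \mid \sigma.P \mid \tau.P \mid P+Q \mid [b]P,Q \mid X \mid \mathbf{0} \mid \mathrm{fix}\,X.P$, where $b$ is either $e_1=e_2$ or $\mathrm{exp}(c)$, $[b]P,Q$ is a conditional (then-branch $P$, else-branch $Q$), $\lfloor ?c(x).P\rfloor Q$ is a receiver on $c$ with timeout branch $Q$ ($x$ bound in $P$), $\sigma.P$ is a one-unit delay and $\sigma^n.P$ denotes $n$ nested delays. System terms are $W ::= P \mid \lfloor ?c(x).P\rfloor \mid W_1|W_2 \mid \nu c{:}(n,v).W$, where $\lfloor ?c(x).P\rfloor$ is an active receiver ($x$ bound in $P$) and $\nu c{:}(n,v).W$ restricts $c$ with local channel state $(n,v)$. In $\mathrm{fix}\,X.P$ every occurrence of $X$ in $P$ is guarded, i.e. lies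 within a broadcast prefix, a receiver continuation, a timeout branch, a $\sigma$-prefix, or a branch of a conditional. Terms are identified up to $\alpha$-conversion. A channel environment is a map $\Gamma$ from channels to $\mathbb{N}\times$(closed values); write $\Gamma\vdash_t c:n$ and $\Gamma\vdash_v c:w$ when $\Gamma(c)=(n,w)$; $c$ is idle in $\Gamma$ if $\Gamma\vdash_t c:0$ and exposed otherwise; $\Gamma[c\mapsto(n,v)]$ is $\Gamma$ updated at $c$; $\Gamma\le\Gamma'$ iff for every $c$, $\Gamma\vdash_t c:n$ and $\Gamma'\vdash_t c:m$ imply $n\le m$. A configuration $\Gamma\triangleright W$ is a channel environment together with a closed system term (no free data or process variables). Intensional semantics. Actions $\lambda$ are $c!v$, $c?v$, $\sigma$, $\tau$. The environment update $\lambda(\Gamma)$ is: $\sigma(\Gamma)(c)=(\max(n-1,0),w)$ whenever $\Gamma(c)=(n,w)$; $c!v(\Gamma)$ agrees with $\Gamma$ except at $c$, where it is $(\delta_v,v)$ if $c$ is idle in $\Gamma$ and $(\max(\delta_v,n),\mathtt{err})$ if $\Gamma\vdash_t c:n>0$; $c?v(\Gamma)=c!v(\Gamma)$; $\tau(\Gamma)=\Gamma$. The predicate $\mathrm{rcv}(W,c)$ on terms is: true for $\lfloor ?d(x).P\rfloor Q$ iff $d=c$; $\mathrm{rcv}(P+Q,c)=\mathrm{rcv}(P,c)\vee\mathrm{rcv}(Q,c)$; $\mathrm{rcv}(\mathrm{fix}\,X.P,c)=\mathrm{rcv}(P,c)$; $\mathrm{rcv}(W_1|W_2,c)=\mathrm{rcv}(W_1,c)\vee\mathrm{rcv}(W_2,c)$;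 $\mathrm{rcv}(\nu d{:}(n,v).W,c)=\mathrm{rcv}(W,c)$ (with $d\neq c$ by $\alpha$-conversion); false for all other forms (broadcasts, $\tau.P$, $\sigma.P$, conditionals, $X$, $\mathbf 0$, active receivers). Then $\mathrm{rcv}(\Gamma\triangleright W,c)$ holds iff $c$ is idle in $\Gamma$ and $\mathrm{rcv}(W,c)$. Transitions $\Gamma\triangleright W\xrightarrow{\lambda}W'$ are the least relation closed under: (Snd) $[\![e]\!]=v$ implies $\Gamma\triangleright c!\langle e\rangle.P\xrightarrow{c!v}\sigma^{\delta_v}.P$; (Rcv) $c$ idle in $\Gamma$ implies $\Gamma\triangleright\lfloor ?c(x).P\rfloor Q\xrightarrow{c?v}\lfloor ?c(x).P\rfloor$; (RcvIgn) $\neg\mathrm{rcv}(\Gamma\triangleright W,c)$ implies $\Gamma\triangleright W\xrightarrow{c?v}W$; (Sync) $\Gamma\triangleright W_1\xrightarrow{c!v}W_1'$ and $\Gamma\triangleright W_2\xrightarrow{c?v}W_2'$ imply $\Gamma\triangleright W_1|W_2\xrightarrow{c!v}W_1'|W_2'$, and symmetrically; (RcvPar) $\Gamma\triangleright W_i\xrightarrow{c?v}W_i'$ for $i=1,2$ imply $\Gamma\triangleright W_1|W_2\xrightarrow{c?v}W_1'|W_2'$; (TimeNil) $\Gamma\triangleright\mathbf 0\xrightarrow{\sigma}\mathbf 0$; (Sleep) $\Gamma\triangleright\sigma.P\xrightarrow{\sigma}P$; (ActRcv) $\Gamma\vdash_t c:n$, $n>1$ imply $\Gamma\triangleright\lfloor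 ?c(x).P\rfloor\xrightarrow{\sigma}\lfloor ?c(x).P\rfloor$; (EndRcv) $\Gamma\vdash_t c:1$, $\Gamma\vdash_v c:w$ imply $\Gamma\triangleright\lfloor ?c(x).P\rfloor\xrightarrow{\sigma}\{w/x\}P$; (Timeout) $c$ idle in $\Gamma$ implies $\Gamma\triangleright\lfloor ?c(x).P\rfloor Q\xrightarrow{\sigma}Q$; (RcvLate) $c$ exposed in $\Gamma$ implies $\Gamma\triangleright\lfloor ?c(x).P\rfloor Q\xrightarrow{\tau}\lfloor ?c(x).\{\mathtt{err}/x\}P\rfloor$; (Tau) $\Gamma\triangleright\tau.P\xrightarrow{\tau}P$; (Then)/(Else) $\Gamma\triangleright[b]P,Q\xrightarrow{\tau}\sigma.P$ if $[\![b]\!]_\Gamma$ is true and $\xrightarrow{\tau}\sigma.Q$ otherwise, where $[\![e_1=e_2]\!]_\Gamma$ is true iff $[\![e_1]\!]=[\![e_2]\!]$ and $[\![\mathrm{exp}(c)]\!]_\Gamma$ is true iff $c$ is exposed in $\Gamma$; (TimePar) $\Gamma\triangleright W_i\xrightarrow{\sigma}W_i'$ for $i=1,2$ imply $\Gamma\triangleright W_1|W_2\xrightarrow{\sigma}W_1'|W_2'$; (TauPar) $\Gamma\triangleright W_1\xrightarrow{\tau}W_1'$ implies $\Gamma\triangleright W_1|W_2\xrightarrow{\tau}W_1'|W_2$, and symmetrically; (Rec) $\Gamma\triangleright\{\mathrm{fix}\,X.P/X\}P\xrightarrow{\lambda}W$ implies $\Gamma\triangleright\mathrm{fix}\,X.P\xrightarrow{\lambda}W$;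 (Sum) for $\lambda\in\{\tau,c!v\}$, $\Gamma\triangleright P\xrightarrow{\lambda}W$ implies $\Gamma\triangleright P+Q\xrightarrow{\lambda}W$, and symmetrically; (SumTime) $\Gamma\triangleright P\xrightarrow{\sigma}P'$, $\Gamma\triangleright Q\xrightarrow{\sigma}Q'$ imply $\Gamma\triangleright P+Q\xrightarrow{\sigma}P'+Q'$; (SumRcv) $\Gamma\triangleright P\xrightarrow{c?v}W$ and $\mathrm{rcv}(\Gamma\triangleright P,c)$ imply $\Gamma\triangleright P+Q\xrightarrow{c?v}W$, and symmetrically; (ResI) $\Gamma[c\mapsto(n,v)]\triangleright W\xrightarrow{c!w}W'$ implies $\Gamma\triangleright\nu c{:}(n,v).W\xrightarrow{\tau}\nu c{:}(c!w(\Gamma[c\mapsto(n,v)]))(c).W'$; (ResV) $\Gamma[c\mapsto(n,v)]\triangleright W\xrightarrow{\lambda}W'$ with $c$ not occurring in $\lambda$ implies $\Gamma\triangleright\nu c{:}(n,v).W\xrightarrow{\lambda}\nu c{:}(\lambda(\Gamma[c\mapsto(n,v)]))(c).W'$. Reductions. $\Gamma\triangleright W\to\Gamma'\triangleright W'$ iff $\Gamma\triangleright W\xrightarrow{\lambda}W'$ for some $\lambda\in\{c!v,\sigma,\tau\}$ and $\Gamma'=\lambda(\Gamma)$; it is instantaneous ($\to_i$) if $\lambda\neq\sigma$ and timed ($\to_\sigma$) if $\lambda=\sigma$. Extensional semantics. Extensional actions $\alpha\in\{c?v,\sigma,\tau,\gamma(c,v),\iota(c)\}$ between configurations are given by: (Input)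 $\Gamma\triangleright W\xrightarrow{c?v}W'$ implies $\Gamma\triangleright W\overset{c?v}{\rightarrowtail}c?v(\Gamma)\triangleright W'$; (Time) $\Gamma\triangleright W\xrightarrow{\sigma}W'$ implies $\Gamma\triangleright W\overset{\sigma}{\rightarrowtail}\sigma(\Gamma)\triangleright W'$; (Shh) $\Gamma\triangleright W\xrightarrow{c!v}W'$ implies $\Gamma\triangleright W\overset{\tau}{\rightarrowtail}c!v(\Gamma)\triangleright W'$; (TauExt) $\Gamma\triangleright W\xrightarrow{\tau}W'$ implies $\Gamma\triangleright W\overset{\tau}{\rightarrowtail}\Gamma\triangleright W'$; (Deliver) $\Gamma(c)=(1,v)$ and $\Gamma\triangleright W\xrightarrow{\sigma}W'$ imply $\Gamma\triangleright W\overset{\gamma(c,v)}{\rightarrowtail}\sigma(\Gamma)\triangleright W'$; (Idle) $c$ idle in $\Gamma$ implies $\Gamma\triangleright W\overset{\iota(c)}{\rightarrowtail}\Gamma\triangleright W$. Weak actions: $\Rightarrow$ is the reflexive-transitive closure of $\overset{\tau}{\rightarrowtail}$; $\overset{\alpha}{\Rightarrow}$ is $\Rightarrow\overset{\alpha}{\rightarrowtail}\Rightarrow$; $\overset{\hat\alpha}{\Rightarrow}$ is $\Rightarrow$ if $\alpha=\tau$ and $\overset{\alpha}{\Rightarrow}$ otherwise. A relation $\mathcal R$ on configurations is a bisimulation if whenever $\mathcal C_1\mathcal R\mathcal C_2$ and $\mathcal C_1\overset{\alpha}{\rightarrowtail}\mathcal C_1'$ there is $\mathcal C_2'$ with $\mathcal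 C_2\overset{\hat\alpha}{\Rightarrow}\mathcal C_2'$ and $\mathcal C_1'\mathcal R\mathcal C_2'$, and symmetrically for moves of $\mathcal C_2$. Bisimilarity $\approx$ is the union of all bisimulations. Reduction barbed congruence. $\Gamma\triangleright W\downarrow_c$ iff $c$ is exposed in $\Gamma$; $\mathcal C\Downarrow_c$ iff $\mathcal C\to^*\mathcal C'$ for some $\mathcal C'$ with $\mathcal C'\downarrow_c$. A relation $\mathcal R$ on configurations is barb preserving if $\mathcal C_1\mathcal R\mathcal C_2$ and $\mathcal C_1\Downarrow_c$ imply $\mathcal C_2\Downarrow_c$; reduction closed if $\mathcal C_1\mathcal R\mathcal C_2$ and $\mathcal C_1\to\mathcal C_1'$ imply $\mathcal C_2\to^*\mathcal C_2'$ for some $\mathcal C_2'$ with $\mathcal C_1'\mathcal R\mathcal C_2'$; contextual if $(\Gamma_1\triangleright W_1)\mathcal R(\Gamma_2\triangleright W_2)$ implies $(\Gamma_1\triangleright W_1|W)\mathcal R(\Gamma_2\triangleright W_2|W)$ for every closed system term $W$. Reduction barbed congruence $\simeq$ is the largest symmetric relation on configurations that is barb preserving, reduction closed and contextual. Well-formedness. The set of well-formed configurations is the least set such that: $\Gamma\triangleright P$ is well-formed for every closed process $P$; $\Gamma\triangleright\lfloor ?c(x).P\rfloor$ is well-formed whenever $c$ is exposed in $\Gamma$; $\Gamma\triangleright W_1|W_2$ is well-formed whenever $\Gamma\triangleright W_1$ and $\Gamma\triangleright W_2$ are; $\Gamma\triangleright\nu c{:}(n,v).W$ is well-formed whenever $\Gamma[c\mapsto(n,v)]\triangleright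 W$ is. *)

theory Defs
  imports Main
begin

datatype 'v val = Err | V 'v

text \<open>Channel references, locally nameless: free channel names and bound
  (de Bruijn) channels, bound by the restriction operator. This realises the
  identification of terms up to alpha-conversion of restricted channels.\<close>
datatype 'c chref = CF 'c | CB nat

datatype ('v,'f) exp = EVal "'v val" | EVar nat | EOp 'f "('v,'f) exp list"

datatype ('c,'v,'f) bexp = BEq "('v,'f) exp" "('v,'f) exp" | BExp "'c chref"

datatype ('c,'v,'f) proc =
    PSnd "'c chref" "('v,'f) exp" "('c,'v,'f) proc"
  | PRcv "'c chref" nat "('c,'v,'f) proc" "('c,'v,'f) proc"
  | PSig "('c,'v,'f) proc"
  | PTau "('c,'v,'f) proc"
  | PSum "('c,'v,'f) proc" "('c,'v,'f) proc"
  | PCond "('c,'v,'f) bexp" "('c,'v,'f) proc" "('c,'v,'f) proc"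
  | PVar nat
  | PNil
  | PFix nat "('c,'v,'f) proc"

datatype ('c,'v,'f) sys =
    SProc "('c,'v,'f) proc"
  | SARcv "'c chref" nat "('c,'v,'f) proc"
  | SPar "('c,'v,'f) sys" "('c,'v,'f) sys"
  | SNu "nat \<times> 'v val" "('c,'v,'f) sys"

type_synonym ('c,'v) env = "'c \<Rightarrow> nat \<times> 'v val"
type_synonym ('c,'v,'f) config = "('c,'v) env \<times> ('c,'v,'f) sys"

datatype ('c,'v) act = AOut 'c "'v val" | AIn 'c "'v val" | ASig | ATau

datatype ('c,'v) eact = XIn 'c "'v val" | XSig | XTau | XGam 'c "'v val" | XIota 'c

fun fvE :: "('v,'f) exp \<Rightarrow> nat set" where
  "fvE (EVal v) = {}"
| "fvE (EVar x) = {x}"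
| "fvE (EOp f es) = (\<Union>e\<in>set es. fvE e)"

fun fvB :: "('c,'v,'f) bexp \<Rightarrow> nat set" where
  "fvB (BEq e1 e2) = fvE e1 \<union> fvE e2"
| "fvB (BExp c) = {}"

fun fvP :: "('c,'v,'f) proc \<Rightarrow> nat set" where
  "fvP (PSnd c e P) = fvE e \<union> fvP P"
| "fvP (PRcv c x P Q) = (fvP P - {x}) \<union> fvP Q"
| "fvP (PSig P) = fvP P"
| "fvP (PTau P) = fvP P"
| "fvP (PSum P Q) = fvP P \<union> fvP Q"
| "fvP (PCond b P Q) = fvB b \<union> fvP P \<union> fvP Q"
| "fvP (PVar X) = {}"
| "fvP PNil = {}"
| "fvP (PFix X P) = fvP P"

fun fvS :: "('c,'v,'f) sys \<Rightarrow> nat set" where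
  "fvS (SProc P) = fvP P"
| "fvS (SARcv c x P) = fvP P - {x}"
| "fvS (SPar W1 W2) = fvS W1 \<union> fvS W2"
| "fvS (SNu s W) = fvS W"

fun fpvP :: "('c,'v,'f) proc \<Rightarrow> nat set" where
  "fpvP (PSnd c e P) = fpvP P"
| "fpvP (PRcv c x P Q) = fpvP P \<union> fpvP Q"
| "fpvP (PSig P) = fpvP P"
| "fpvP (PTau P) = fpvP P"
| "fpvP (PSum P Q) = fpvP P \<union> fpvP Q"
| "fpvP (PCond b P Q) = fpvP P \<union> fpvP Q"
| "fpvP (PVar X) = {X}"
| "fpvP PNil = {}"
| "fpvP (PFix X P) = fpvP P - {X}"

fun fpvS :: "('c,'v,'f) sys \<Rightarrow> nat set" where
  "fpvS (SProc P) = fpvP P"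
| "fpvS (SARcv c x P) = fpvP P"
| "fpvS (SPar W1 W2) = fpvS W1 \<union> fpvS W2"
| "fpvS (SNu s W) = fpvS W"

fun lcC :: "nat \<Rightarrow> 'c chref \<Rightarrow> bool" where
  "lcC k (CF c) = True"
| "lcC k (CB j) = (j < k)"

fun lcB :: "nat \<Rightarrow> ('c,'v,'f) bexp \<Rightarrow> bool" where
  "lcB k (BEq e1 e2) = True"
| "lcB k (BExp c) = lcC k c"

fun lcP :: "nat \<Rightarrow> ('c,'v,'f) proc \<Rightarrow> bool" where
  "lcP k (PSnd c e P) = (lcC k c \<and> lcP k P)"
| "lcP k (PRcv c x P Q) = (lcC k c \<and> lcP k P \<and> lcP k Q)"
| "lcP k (PSig P) = lcP k P"
| "lcP k (PTau P) = lcP k P"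
| "lcP k (PSum P Q) = (lcP k P \<and> lcP k Q)"
| "lcP k (PCond b P Q) = (lcB k b \<and> lcP k P \<and> lcP k Q)"
| "lcP k (PVar X) = True"
| "lcP k PNil = True"
| "lcP k (PFix X P) = lcP k P"

fun lcS :: "nat \<Rightarrow> ('c,'v,'f) sys \<Rightarrow> bool" where
  "lcS k (SProc P) = lcP k P"
| "lcS k (SARcv c x P) = (lcC k c \<and> lcP k P)"
| "lcS k (SPar W1 W2) = (lcS k W1 \<and> lcS k W2)"
| "lcS k (SNu s W) = lcS (Suc k) W"

fun ugP :: "nat \<Rightarrow> ('c,'v,'f) proc \<Rightarrow> bool" where
  "ugP X (PSnd c e P) = False"
| "ugP X (PRcv c x P Q) = False"
| "ugP X (PSig P) = False"
| "ugP X (PTau P) = ugP X P"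
| "ugP X (PSum P Q) = (ugP X P \<or> ugP X Q)"
| "ugP X (PCond b P Q) = False"
| "ugP X (PVar Y) = (X = Y)"
| "ugP X PNil = False"
| "ugP X (PFix Y P) = (X \<noteq> Y \<and> ugP X P)"

fun wgP :: "('c,'v,'f) proc \<Rightarrow> bool" where
  "wgP (PSnd c e P) = wgP P"
| "wgP (PRcv c x P Q) = (wgP P \<and> wgP Q)"
| "wgP (PSig P) = wgP P"
| "wgP (PTau P) = wgP P"
| "wgP (PSum P Q) = (wgP P \<and> wgP Q)"
| "wgP (PCond b P Q) = (wgP P \<and> wgP Q)"
| "wgP (PVar X) = True"
| "wgP PNil = True"
| "wgP (PFix X P) = (\<not> ugP X P \<and> wgP P)"

fun wgS :: "('c,'v,'f) sys \<Rightarrow> bool" where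
  "wgS (SProc P) = wgP P"
| "wgS (SARcv c x P) = wgP P"
| "wgS (SPar W1 W2) = (wgS W1 \<and> wgS W2)"
| "wgS (SNu s W) = wgS W"

definition closedS :: "('c,'v,'f) sys \<Rightarrow> bool" where
  "closedS W \<longleftrightarrow> fvS W = {} \<and> fpvS W = {} \<and> lcS 0 W \<and> wgS W"

definition conf :: "('c,'v,'f) config \<Rightarrow> bool" where
  "conf C \<longleftrightarrow> closedS (snd C)"

fun fcC :: "'c chref \<Rightarrow> 'c set" where
  "fcC (CF c) = {c}"
| "fcC (CB k) = {}"

fun fcB :: "('c,'v,'f) bexp \<Rightarrow> 'c set" where
  "fcB (BEq e1 e2) = {}"
| "fcB (BExp c) = fcC c"

fun fcP :: "('c,'v,'f) proc \<Rightarrow> 'c set" where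
  "fcP (PSnd c e P) = fcC c \<union> fcP P"
| "fcP (PRcv c x P Q) = fcC c \<union> fcP P \<union> fcP Q"
| "fcP (PSig P) = fcP P"
| "fcP (PTau P) = fcP P"
| "fcP (PSum P Q) = fcP P \<union> fcP Q"
| "fcP (PCond b P Q) = fcB b \<union> fcP P \<union> fcP Q"
| "fcP (PVar X) = {}"
| "fcP PNil = {}"
| "fcP (PFix X P) = fcP P"

fun fcS :: "('c,'v,'f) sys \<Rightarrow> 'c set" where
  "fcS (SProc P) = fcP P"
| "fcS (SARcv c x P) = fcC c \<union> fcP P"
| "fcS (SPar W1 W2) = fcS W1 \<union> fcS W2"
| "fcS (SNu s W) = fcS W"

fun mapchB :: "('c chref \<Rightarrow> 'c chref) \<Rightarrow> ('c,'v,'f) bexp \<Rightarrow> ('c,'v,'f) bexp" where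
  "mapchB f (BEq e1 e2) = BEq e1 e2"
| "mapchB f (BExp c) = BExp (f c)"

fun mapchP :: "('c chref \<Rightarrow> 'c chref) \<Rightarrow> ('c,'v,'f) proc \<Rightarrow> ('c,'v,'f) proc" where
  "mapchP f (PSnd c e P) = PSnd (f c) e (mapchP f P)"
| "mapchP f (PRcv c x P Q) = PRcv (f c) x (mapchP f P) (mapchP f Q)"
| "mapchP f (PSig P) = PSig (mapchP f P)"
| "mapchP f (PTau P) = PTau (mapchP f P)"
| "mapchP f (PSum P Q) = PSum (mapchP f P) (mapchP f Q)"
| "mapchP f (PCond b P Q) = PCond (mapchB f b) (mapchP f P) (mapchP f Q)"
| "mapchP f (PVar X) = PVar X"
| "mapchP f PNil = PNil"
| "mapchP f (PFix X P) = PFix X (mapchP f P)"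

fun opnC :: "nat \<Rightarrow> 'c \<Rightarrow> 'c chref \<Rightarrow> 'c chref" where
  "opnC k c (CF d) = CF d"
| "opnC k c (CB j) = (if j = k then CF c else CB j)"

fun clsC :: "nat \<Rightarrow> 'c \<Rightarrow> 'c chref \<Rightarrow> 'c chref" where
  "clsC k c (CF d) = (if d = c then CB k else CF d)"
| "clsC k c (CB j) = CB j"

fun mapchS :: "(nat \<Rightarrow> 'c chref \<Rightarrow> 'c chref) \<Rightarrow> nat \<Rightarrow> ('c,'v,'f) sys \<Rightarrow> ('c,'v,'f) sys" where
  "mapchS f k (SProc P) = SProc (mapchP (f k) P)"
| "mapchS f k (SARcv c x P) = SARcv (f k c) x (mapchP (f k) P)"
| "mapchS f k (SPar W1 W2) = SPar (mapchS f k W1) (mapchS f k W2)"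
| "mapchS f k (SNu s W) = SNu s (mapchS f (Suc k) W)"

definition opnS :: "'c \<Rightarrow> ('c,'v,'f) sys \<Rightarrow> ('c,'v,'f) sys" where
  "opnS c W = mapchS (\<lambda>k. opnC k c) 0 W"

definition clsS :: "'c \<Rightarrow> ('c,'v,'f) sys \<Rightarrow> ('c,'v,'f) sys" where
  "clsS c W = mapchS (\<lambda>k. clsC k c) 0 W"

fun eval :: "('f \<Rightarrow> 'v val list \<Rightarrow> 'v val) \<Rightarrow> ('v,'f) exp \<Rightarrow> 'v val" where
  "eval I (EVal v) = v"
| "eval I (EVar x) = Err"   \<comment> \<open>never used: only closed expressions are evaluated\<close>
| "eval I (EOp f es) = I f (map (eval I) es)"

fun substE :: "nat \<Rightarrow> 'v val \<Rightarrow> ('v,'f) exp \<Rightarrow> ('v,'f) exp" where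
  "substE x w (EVal v) = EVal v"
| "substE x w (EVar y) = (if y = x then EVal w else EVar y)"
| "substE x w (EOp f es) = EOp f (map (substE x w) es)"

fun substB :: "nat \<Rightarrow> 'v val \<Rightarrow> ('c,'v,'f) bexp \<Rightarrow> ('c,'v,'f) bexp" where
  "substB x w (BEq e1 e2) = BEq (substE x w e1) (substE x w e2)"
| "substB x w (BExp c) = BExp c"

fun substP :: "nat \<Rightarrow> 'v val \<Rightarrow> ('c,'v,'f) proc \<Rightarrow> ('c,'v,'f) proc" where
  "substP x w (PSnd c e P) = PSnd c (substE x w e) (substP x w P)"
| "substP x w (PRcv c y P Q) = PRcv c y (if y = x then P else substP x w P) (substP x w Q)"
| "substP x w (PSig P) = PSig (substP x w P)"
| "substP x w (PTau P) = PTau (substP x w P)"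
| "substP x w (PSum P Q) = PSum (substP x w P) (substP x w Q)"
| "substP x w (PCond b P Q) = PCond (substB x w b) (substP x w P) (substP x w Q)"
| "substP x w (PVar X) = PVar X"
| "substP x w PNil = PNil"
| "substP x w (PFix X P) = PFix X (substP x w P)"

fun psubst :: "nat \<Rightarrow> ('c,'v,'f) proc \<Rightarrow> ('c,'v,'f) proc \<Rightarrow> ('c,'v,'f) proc" where
  "psubst X R (PSnd c e P) = PSnd c e (psubst X R P)"
| "psubst X R (PRcv c y P Q) = PRcv c y (psubst X R P) (psubst X R Q)"
| "psubst X R (PSig P) = PSig (psubst X R P)"
| "psubst X R (PTau P) = PTau (psubst X R P)"
| "psubst X R (PSum P Q) = PSum (psubst X R P) (psubst X R Q)"
| "psubst X R (PCond b P Q) = PCond b (psubst X R P) (psubst X R Q)"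
| "psubst X R (PVar Y) = (if Y = X then R else PVar Y)"
| "psubst X R PNil = PNil"
| "psubst X R (PFix Y P) = (if Y = X then PFix Y P else PFix Y (psubst X R P))"

definition idle :: "('c,'v) env \<Rightarrow> 'c \<Rightarrow> bool" where
  "idle \<Gamma> c \<longleftrightarrow> fst (\<Gamma> c) = 0"

definition exposed :: "('c,'v) env \<Rightarrow> 'c \<Rightarrow> bool" where
  "exposed \<Gamma> c \<longleftrightarrow> fst (\<Gamma> c) > 0"

fun upd :: "('v val \<Rightarrow> nat) \<Rightarrow> ('c,'v) act \<Rightarrow> ('c,'v) env \<Rightarrow> ('c,'v) env" where
  "upd \<delta> ASig \<Gamma> = (\<lambda>c. (fst (\<Gamma> c) - 1, snd (\<Gamma> c)))"
| "upd \<delta> (AOut c v) \<Gamma> = \<Gamma>(c := (if fst (\<Gamma> c) = 0 then (\<delta> v, v) else (max (\<delta> v) (fst (\<Gamma> c)), Err)))"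
| "upd \<delta> (AIn c v) \<Gamma> = \<Gamma>(c := (if fst (\<Gamma> c) = 0 then (\<delta> v, v) else (max (\<delta> v) (fst (\<Gamma> c)), Err)))"
| "upd \<delta> ATau \<Gamma> = \<Gamma>"

fun actch :: "('c,'v) act \<Rightarrow> 'c set" where
  "actch (AOut c v) = {c}"
| "actch (AIn c v) = {c}"
| "actch ASig = {}"
| "actch ATau = {}"

fun beval :: "('f \<Rightarrow> 'v val list \<Rightarrow> 'v val) \<Rightarrow> ('c,'v) env \<Rightarrow> ('c,'v,'f) bexp \<Rightarrow> bool" where
  "beval I \<Gamma> (BEq e1 e2) = (eval I e1 = eval I e2)"
| "beval I \<Gamma> (BExp (CF c)) = exposed \<Gamma> c"
| "beval I \<Gamma> (BExp (CB k)) = False"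

fun rcvP :: "('c,'v,'f) proc \<Rightarrow> 'c \<Rightarrow> bool" where
  "rcvP (PRcv d x P Q) c = (d = CF c)"
| "rcvP (PSum P Q) c = (rcvP P c \<or> rcvP Q c)"
| "rcvP (PFix X P) c = rcvP P c"
| "rcvP _ c = False"

fun rcvS :: "('c,'v,'f) sys \<Rightarrow> 'c \<Rightarrow> bool" where
  "rcvS (SProc P) c = rcvP P c"
| "rcvS (SARcv d x P) c = False"
| "rcvS (SPar W1 W2) c = (rcvS W1 c \<or> rcvS W2 c)"
| "rcvS (SNu s W) c = rcvS W c"

definition rcvC :: "('c,'v) env \<Rightarrow> ('c,'v,'f) sys \<Rightarrow> 'c \<Rightarrow> bool" where
  "rcvC \<Gamma> W c \<longleftrightarrow> idle \<Gamma> c \<and> rcvS W c"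

inductive trans :: "('v val \<Rightarrow> nat) \<Rightarrow> ('f \<Rightarrow> 'v val list \<Rightarrow> 'v val) \<Rightarrow> ('c,'v) env
    \<Rightarrow> ('c,'v,'f) sys \<Rightarrow> ('c,'v) act \<Rightarrow> ('c,'v,'f) sys \<Rightarrow> bool"
  for \<delta> I where
  Snd: "v = eval I e \<Longrightarrow> trans \<delta> I \<Gamma> (SProc (PSnd (CF c) e P)) (AOut c v) (SProc ((PSig ^^ \<delta> v) P))"
| Rcv: "idle \<Gamma> c \<Longrightarrow> trans \<delta> I \<Gamma> (SProc (PRcv (CF c) x P Q)) (AIn c v) (SARcv (CF c) x P)"
| RcvIgn: "\<not> rcvC \<Gamma> W c \<Longrightarrow> trans \<delta> I \<Gamma> W (AIn c v) W"
| SyncL: "trans \<delta> I \<Gamma> W1 (AOut c v) W1' \<Longrightarrow> trans \<delta> I \<Gamma> W2 (AIn c v) W2'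
          \<Longrightarrow> trans \<delta> I \<Gamma> (SPar W1 W2) (AOut c v) (SPar W1' W2')"
| SyncR: "trans \<delta> I \<Gamma> W1 (AIn c v) W1' \<Longrightarrow> trans \<delta> I \<Gamma> W2 (AOut c v) W2'
          \<Longrightarrow> trans \<delta> I \<Gamma> (SPar W1 W2) (AOut c v) (SPar W1' W2')"
| RcvPar: "trans \<delta> I \<Gamma> W1 (AIn c v) W1' \<Longrightarrow> trans \<delta> I \<Gamma> W2 (AIn c v) W2'
          \<Longrightarrow> trans \<delta> I \<Gamma> (SPar W1 W2) (AIn c v) (SPar W1' W2')"
| TimeNil: "trans \<delta> I \<Gamma> (SProc PNil) ASig (SProc PNil)"
| Sleep: "trans \<delta> I \<Gamma> (SProc (PSig P)) ASig (SProc P)"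
| ActRcv: "fst (\<Gamma> c) > 1 \<Longrightarrow> trans \<delta> I \<Gamma> (SARcv (CF c) x P) ASig (SARcv (CF c) x P)"
| EndRcv: "\<Gamma> c = (1, w) \<Longrightarrow> trans \<delta> I \<Gamma> (SARcv (CF c) x P) ASig (SProc (substP x w P))"
| Timeout: "idle \<Gamma> c \<Longrightarrow> trans \<delta> I \<Gamma> (SProc (PRcv (CF c) x P Q)) ASig (SProc Q)"
| RcvLate: "exposed \<Gamma> c \<Longrightarrow> trans \<delta> I \<Gamma> (SProc (PRcv (CF c) x P Q)) ATau (SARcv (CF c) x (substP x Err P))"
| Tau: "trans \<delta> I \<Gamma> (SProc (PTau P)) ATau (SProc P)"
| Then: "beval I \<Gamma> b \<Longrightarrow> trans \<delta> I \<Gamma> (SProc (PCond b P Q)) ATau (SProc (PSig P))"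
| Else: "\<not> beval I \<Gamma> b \<Longrightarrow> trans \<delta> I \<Gamma> (SProc (PCond b P Q)) ATau (SProc (PSig Q))"
| TimePar: "trans \<delta> I \<Gamma> W1 ASig W1' \<Longrightarrow> trans \<delta> I \<Gamma> W2 ASig W2'
          \<Longrightarrow> trans \<delta> I \<Gamma> (SPar W1 W2) ASig (SPar W1' W2')"
| TauParL: "trans \<delta> I \<Gamma> W1 ATau W1' \<Longrightarrow> trans \<delta> I \<Gamma> (SPar W1 W2) ATau (SPar W1' W2)"
| TauParR: "trans \<delta> I \<Gamma> W2 ATau W2' \<Longrightarrow> trans \<delta> I \<Gamma> (SPar W1 W2) ATau (SPar W1 W2')"
| Rec: "trans \<delta> I \<Gamma> (SProc (psubst X (PFix X P) P)) a W \<Longrightarrow> trans \<delta> I \<Gamma> (SProc (PFix X P)) a W"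
| SumL: "(a = ATau \<or> (\<exists>c v. a = AOut c v)) \<Longrightarrow> trans \<delta> I \<Gamma> (SProc P) a W
          \<Longrightarrow> trans \<delta> I \<Gamma> (SProc (PSum P Q)) a W"
| SumR: "(a = ATau \<or> (\<exists>c v. a = AOut c v)) \<Longrightarrow> trans \<delta> I \<Gamma> (SProc Q) a W
          \<Longrightarrow> trans \<delta> I \<Gamma> (SProc (PSum P Q)) a W"
| SumTime: "trans \<delta> I \<Gamma> (SProc P) ASig (SProc P') \<Longrightarrow> trans \<delta> I \<Gamma> (SProc Q) ASig (SProc Q')
          \<Longrightarrow> trans \<delta> I \<Gamma> (SProc (PSum P Q)) ASig (SProc (PSum P' Q'))"
| SumRcvL: "trans \<delta> I \<Gamma> (SProc P) (AIn c v) W \<Longrightarrow> rcvC \<Gamma> (SProc P) c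
          \<Longrightarrow> trans \<delta> I \<Gamma> (SProc (PSum P Q)) (AIn c v) W"
| SumRcvR: "trans \<delta> I \<Gamma> (SProc Q) (AIn c v) W \<Longrightarrow> rcvC \<Gamma> (SProc Q) c
          \<Longrightarrow> trans \<delta> I \<Gamma> (SProc (PSum P Q)) (AIn c v) W"
| ResI: "c \<notin> fcS W \<Longrightarrow> trans \<delta> I (\<Gamma>(c := s)) (opnS c W) (AOut c w) W'
          \<Longrightarrow> trans \<delta> I \<Gamma> (SNu s W) ATau (SNu (upd \<delta> (AOut c w) (\<Gamma>(c := s)) c) (clsS c W'))"
| ResV: "c \<notin> fcS W \<Longrightarrow> c \<notin> actch a \<Longrightarrow> trans \<delta> I (\<Gamma>(c := s)) (opnS c W) a W'
          \<Longrightarrow> trans \<delta> I \<Gamma> (SNu s W) a (SNu (upd \<delta> a (\<Gamma>(c := s)) c) (clsS c W'))"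

definition red :: "('v val \<Rightarrow> nat) \<Rightarrow> ('f \<Rightarrow> 'v val list \<Rightarrow> 'v val)
    \<Rightarrow> ('c,'v,'f) config \<Rightarrow> ('c,'v,'f) config \<Rightarrow> bool" where
  "red \<delta> I C C' \<longleftrightarrow> (\<exists>a. (a = ATau \<or> a = ASig \<or> (\<exists>c v. a = AOut c v))
      \<and> trans \<delta> I (fst C) (snd C) a (snd C') \<and> fst C' = upd \<delta> a (fst C))"

inductive ext :: "('v val \<Rightarrow> nat) \<Rightarrow> ('f \<Rightarrow> 'v val list \<Rightarrow> 'v val)
    \<Rightarrow> ('c,'v,'f) config \<Rightarrow> ('c,'v) eact \<Rightarrow> ('c,'v,'f) config \<Rightarrow> bool"
  for \<delta> I where
  Input: "trans \<delta> I \<Gamma> W (AIn c v) W' \<Longrightarrow> ext \<delta> I (\<Gamma>, W) (XIn c v) (upd \<delta> (AIn c v) \<Gamma>, W')"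
| Time: "trans \<delta> I \<Gamma> W ASig W' \<Longrightarrow> ext \<delta> I (\<Gamma>, W) XSig (upd \<delta> ASig \<Gamma>, W')"
| Shh: "trans \<delta> I \<Gamma> W (AOut c v) W' \<Longrightarrow> ext \<delta> I (\<Gamma>, W) XTau (upd \<delta> (AOut c v) \<Gamma>, W')"
| TauExt: "trans \<delta> I \<Gamma> W ATau W' \<Longrightarrow> ext \<delta> I (\<Gamma>, W) XTau (\<Gamma>, W')"
| Deliver: "\<Gamma> c = (1, v) \<Longrightarrow> trans \<delta> I \<Gamma> W ASig W' \<Longrightarrow> ext \<delta> I (\<Gamma>, W) (XGam c v) (upd \<delta> ASig \<Gamma>, W')"
| Idle: "idle \<Gamma> c \<Longrightarrow> ext \<delta> I (\<Gamma>, W) (XIota c) (\<Gamma>, W)"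

definition wtau :: "('v val \<Rightarrow> nat) \<Rightarrow> ('f \<Rightarrow> 'v val list \<Rightarrow> 'v val)
    \<Rightarrow> ('c,'v,'f) config \<Rightarrow> ('c,'v,'f) config \<Rightarrow> bool" where
  "wtau \<delta> I = (\<lambda>C C'. ext \<delta> I C XTau C')\<^sup>*\<^sup>*"

definition wext :: "('v val \<Rightarrow> nat) \<Rightarrow> ('f \<Rightarrow> 'v val list \<Rightarrow> 'v val)
    \<Rightarrow> ('c,'v,'f) config \<Rightarrow> ('c,'v) eact \<Rightarrow> ('c,'v,'f) config \<Rightarrow> bool" where
  "wext \<delta> I C \<alpha> C' \<longleftrightarrow> (\<exists>D D'. wtau \<delta> I C D \<and> ext \<delta> I D \<alpha> D' \<and> wtau \<delta> I D' C')"

definition wext_hat :: "('v val \<Rightarrow> nat) \<Rightarrow> ('f \<Rightarrow> 'v val list \<Rightarrow> 'v val)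
    \<Rightarrow> ('c,'v,'f) config \<Rightarrow> ('c,'v) eact \<Rightarrow> ('c,'v,'f) config \<Rightarrow> bool" where
  "wext_hat \<delta> I C \<alpha> C' \<longleftrightarrow> (if \<alpha> = XTau then wtau \<delta> I C C' else wext \<delta> I C \<alpha> C')"

definition bisimulation :: "('v val \<Rightarrow> nat) \<Rightarrow> ('f \<Rightarrow> 'v val list \<Rightarrow> 'v val)
    \<Rightarrow> (('c,'v,'f) config \<Rightarrow> ('c,'v,'f) config \<Rightarrow> bool) \<Rightarrow> bool" where
  "bisimulation \<delta> I R \<longleftrightarrow>
     (\<forall>C1 C2. R C1 C2 \<longrightarrow> conf C1 \<and> conf C2) \<and>
     (\<forall>C1 C2 \<alpha> C1'. R C1 C2 \<and> ext \<delta> I C1 \<alpha> C1' \<longrightarrow> (\<exists>C2'. wext_hat \<delta> I C2 \<alpha> C2' \<and> R C1' C2')) \<and>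
     (\<forall>C1 C2 \<alpha> C2'. R C1 C2 \<and> ext \<delta> I C2 \<alpha> C2' \<longrightarrow> (\<exists>C1'. wext_hat \<delta> I C1 \<alpha> C1' \<and> R C1' C2'))"

definition bisim :: "('v val \<Rightarrow> nat) \<Rightarrow> ('f \<Rightarrow> 'v val list \<Rightarrow> 'v val)
    \<Rightarrow> ('c,'v,'f) config \<Rightarrow> ('c,'v,'f) config \<Rightarrow> bool" where
  "bisim \<delta> I C1 C2 \<longleftrightarrow> (\<exists>R. bisimulation \<delta> I R \<and> R C1 C2)"

definition barb :: "('c,'v,'f) config \<Rightarrow> 'c \<Rightarrow> bool" where
  "barb C c \<longleftrightarrow> exposed (fst C) c"

definition wbarb :: "('v val \<Rightarrow> nat) \<Rightarrow> ('f \<Rightarrow> 'v val list \<Rightarrow> 'v val)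
    \<Rightarrow> ('c,'v,'f) config \<Rightarrow> 'c \<Rightarrow> bool" where
  "wbarb \<delta> I C c \<longleftrightarrow> (\<exists>C'. (red \<delta> I)\<^sup>*\<^sup>* C C' \<and> barb C' c)"

definition barb_preserving :: "('v val \<Rightarrow> nat) \<Rightarrow> ('f \<Rightarrow> 'v val list \<Rightarrow> 'v val)
    \<Rightarrow> (('c,'v,'f) config \<Rightarrow> ('c,'v,'f) config \<Rightarrow> bool) \<Rightarrow> bool" where
  "barb_preserving \<delta> I R \<longleftrightarrow> (\<forall>C1 C2 c. R C1 C2 \<and> wbarb \<delta> I C1 c \<longrightarrow> wbarb \<delta> I C2 c)"

definition reduction_closed :: "('v val \<Rightarrow> nat) \<Rightarrow> ('f \<Rightarrow> 'v val list \<Rightarrow> 'v val)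
    \<Rightarrow> (('c,'v,'f) config \<Rightarrow> ('c,'v,'f) config \<Rightarrow> bool) \<Rightarrow> bool" where
  "reduction_closed \<delta> I R \<longleftrightarrow>
     (\<forall>C1 C2 C1'. R C1 C2 \<and> red \<delta> I C1 C1' \<longrightarrow> (\<exists>C2'. (red \<delta> I)\<^sup>*\<^sup>* C2 C2' \<and> R C1' C2'))"

definition contextual :: "(('c,'v,'f) config \<Rightarrow> ('c,'v,'f) config \<Rightarrow> bool) \<Rightarrow> bool" where
  "contextual R \<longleftrightarrow> (\<forall>\<Gamma>1 W1 \<Gamma>2 W2 W. R (\<Gamma>1, W1) (\<Gamma>2, W2) \<and> closedS W
      \<longrightarrow> R (\<Gamma>1, SPar W1 W) (\<Gamma>2, SPar W2 W))"

definition rbc :: "('v val \<Rightarrow> nat) \<Rightarrow> ('f \<Rightarrow> 'v val list \<Rightarrow> 'v val)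
    \<Rightarrow> ('c,'v,'f) config \<Rightarrow> ('c,'v,'f) config \<Rightarrow> bool" where
  "rbc \<delta> I C1 C2 \<longleftrightarrow> (\<exists>R. (\<forall>D1 D2. R D1 D2 \<longrightarrow> conf D1 \<and> conf D2) \<and> symp R
      \<and> barb_preserving \<delta> I R \<and> reduction_closed \<delta> I R \<and> contextual R \<and> R C1 C2)"

inductive wf0 :: "('c,'v) env \<Rightarrow> ('c,'v,'f) sys \<Rightarrow> bool" where
  "wf0 \<Gamma> (SProc P)"
| "exposed \<Gamma> c \<Longrightarrow> wf0 \<Gamma> (SARcv (CF c) x P)"
| "wf0 \<Gamma> W1 \<Longrightarrow> wf0 \<Gamma> W2 \<Longrightarrow> wf0 \<Gamma> (SPar W1 W2)"
| "c \<notin> fcS W \<Longrightarrow> wf0 (\<Gamma>(c := s)) (opnS c W) \<Longrightarrow> wf0 \<Gamma> (SNu s W)"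

definition wfc :: "('c,'v,'f) config \<Rightarrow> bool" where
  "wfc C \<longleftrightarrow> conf C \<and> wf0 (fst C) (snd C)"

end

theory Submission
  imports Defs
begin

text \<open>
  Every action of one configuration is turned into reductions of that configuration next to a testing
  process, and the reductions by which the congruent configuration answers are read back as a weak action.

  Since every channel may be exposed initially, success cannot be signalled by a fresh barb. Instead,
  for a channel g unused by the configurations, one asks whether the weak barb on g can be lost for
  good, and whether it can become permanent. Next to the loud process, which broadcasts on g forever,
  the barb cannot be lost; next to an inert process it cannot become permanent; next to the process
  choice = tau.0 + tau.loud both are possible. Moreover choice blocks time until it is resolved. Losing
  the barb requires that time can pass, which holds in well-formed configurations because
  instantaneous steps terminate (guardedness) and some step is always possible.

  Delaying choice gives a clock showing that congruent well-formed configurations agree on how long an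
  unused channel stays exposed. Hence, if some unused channel is exposed, the answer to a reduction
  takes the same amount of time. If all unused channels are idle, the same conclusion follows by
  keeping choice in parallel, and choice is then removed by coinduction. With instantaneous and timed
  reductions matched, inputs, deliveries and idleness are tested by c!v.0 + tau.loud,
  by an active receiver on c that compares the received value with v, and by [exp(c)]loud,0.
\<close>

section \<open>Syntax, closedness and renaming\<close>

text \<open>Congruence answers a reduction by some sequence of reductions and does not record how
  much time it takes, whereas bisimilarity demands that an instantaneous step cost no time and a
  timed step exactly one unit. The missing duration has to be read off a counter that neither system
  can touch, or be bounded by a process that refuses time. The second method leaves a test in
  parallel, and its removal must survive every context, including contexts that use the test channel
  and ill-formed ones that stop time. This shapes three things. Test channels must be exchangeable:
  swapping two idle channels permutes only the stale values stored there, so congruence has to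
  ignore such values. A loud process must keep its barb without relying on time passing. And
  congruence must be stable under deleting the sleeping remains of a finished test.\<close>

lemma finite_fcC: "finite (fcC r)" by (cases r) auto
lemma finite_fcB: "finite (fcB b)" by (cases b) (auto simp: finite_fcC)
lemma finite_fcP: "finite (fcP P)" by (induct P) (auto simp: finite_fcC finite_fcB)
lemma finite_fcS: "finite (fcS W)" by (induct W) (auto simp: finite_fcC finite_fcP)

lemma fv_mapchB [simp]: "fvB (mapchB f b) = fvB b" by (cases b) auto

lemma mapchP_simps [simp]:
  "fvP (mapchP f P) = fvP P"
  "fpvP (mapchP f P) = fpvP P"
  "ugP X (mapchP f P) = ugP X P"
  by (induct P) auto

lemma wgP_mapchP [simp]: "wgP (mapchP f P) = wgP P"
  by (induct P) auto

lemma mapchS_simps [simp]: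
  "fvS (mapchS f k W) = fvS W"
  "fpvS (mapchS f k W) = fpvS W"
  "wgS (mapchS f k W) = wgS W"
  by (induct W arbitrary: k) auto

lemma lcB_mapchB:
  "lcB k b \<Longrightarrow> (\<And>r. lcC k r \<Longrightarrow> lcC l (f r)) \<Longrightarrow> lcB l (mapchB f b)"
  by (cases b) auto

lemma lcP_mapchP:
  "lcP k P \<Longrightarrow> (\<And>r. lcC k r \<Longrightarrow> lcC l (f r)) \<Longrightarrow> lcP l (mapchP f P)"
  by (induct P) (auto intro: lcB_mapchB)

lemma lcC_opnC: "lcC (Suc k) r \<Longrightarrow> lcC k (opnC k c r)"
  by (cases r) auto

lemma lcC_clsC: "lcC k r \<Longrightarrow> lcC (Suc k) (clsC k c r)"
  by (cases r) auto

lemma lcS_opn: "lcS (Suc k) W \<Longrightarrow> lcS k (mapchS (\<lambda>k. opnC k c) k W)"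
  by (induct W arbitrary: k) (auto intro: lcP_mapchP lcC_opnC)

lemma lcS_cls: "lcS k W \<Longrightarrow> lcS (Suc k) (mapchS (\<lambda>k. clsC k c) k W)"
  by (induct W arbitrary: k) (auto intro: lcP_mapchP lcC_clsC)

lemma closedS_opnS: "closedS (SNu s W) \<Longrightarrow> closedS (opnS c W)"
  by (simp add: closedS_def opnS_def lcS_opn)

lemma closedS_clsS: "closedS W \<Longrightarrow> closedS (SNu s (clsS c W))"
  by (simp add: closedS_def clsS_def lcS_cls)

lemma closedS_SPar [simp]: "closedS (SPar A B) \<longleftrightarrow> closedS A \<and> closedS B"
  by (auto simp: closedS_def)

lemma fcP_mapchP_opn: "fcP (mapchP (opnC k c) P) \<subseteq> insert c (fcP P)"
proof -
  have C: "fcC (opnC k c r) \<subseteq> insert c (fcC r)" for r :: "'a chref" by (cases r) auto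
  then have "fcB (mapchB (opnC k c) b) \<subseteq> insert c (fcB b)" for b :: "('a,'b,'c) bexp" by (cases b) auto
  note C [THEN subsetD, dest] this [THEN subsetD, dest]
  show ?thesis by (induct P) auto
qed

lemma fcC_opnC: "fcC (opnC k c r) \<subseteq> insert c (fcC r)" by (cases r) auto

lemma fcS_opn: "fcS (mapchS (\<lambda>k. opnC k c) k W) \<subseteq> insert c (fcS W)"
proof (induct W arbitrary: k)
  case (SARcv r x P)
  then show ?case using fcP_mapchP_opn[of k c P] fcC_opnC[of k c r] by auto
next
  case (SProc P)
  then show ?case using fcP_mapchP_opn[of k c P] by auto
next
  case (SPar W1 W2)
  from SPar[of k] show ?case by auto
next
  case (SNu s W)
  then show ?case by simp
qed

lemma fcS_opnS: "fcS (opnS c W) \<subseteq> insert c (fcS W)"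
  by (simp add: opnS_def fcS_opn)

lemma fcC_clsC: "fcC (clsC k c r) = fcC r - {c}" by (cases r) auto

lemma fcP_mapchP_cls: "fcP (mapchP (clsC k c) P) = fcP P - {c}"
proof -
  have "fcB (mapchB (clsC k c) b) = fcB b - {c}" for b :: "('a,'b,'c) bexp" by (cases b) (auto simp: fcC_clsC)
  then show ?thesis by (induct P) (auto simp: fcC_clsC)
qed

lemma fcS_clsS: "fcS (clsS c W) = fcS W - {c}"
  unfolding clsS_def
proof -
  show "fcS (mapchS (\<lambda>k. clsC k c) k W) = fcS W - {c}" for k
    by (induct W arbitrary: k) (auto simp: fcC_clsC fcP_mapchP_cls)
qed

lemma fv_substE [simp]: "fvE (substE x w e) = fvE e - {x}"
  by (induct e) auto

lemma fv_substB [simp]: "fvB (substB x w b) = fvB b - {x}"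
  by (cases b) auto

lemma fv_substP [simp]: "fvP (substP x w P) = fvP P - {x}"
  by (induct P) auto

lemma substB_simps [simp]: "lcB k (substB x w b) = lcB k b" "fcB (substB x w b) = fcB b"
  by (cases b; simp)+

lemma substP_simps [simp]:
  "fpvP (substP x w P) = fpvP P"
  "lcP k (substP x w P) = lcP k P"
  "ugP X (substP x w P) = ugP X P"
  "fcP (substP x w P) = fcP P"
  by (induct P) auto

lemma wg_substP [simp]: "wgP (substP x w P) = wgP P"
  by (induct P) auto

lemma fv_psubst: "fvP (psubst X R P) \<subseteq> fvP P \<union> fvP R"
  by (induct P) auto

lemma fpv_psubst: "fpvP (psubst X R P) \<subseteq> (fpvP P - {X}) \<union> fpvP R"
  by (induct P) auto

lemma fc_psubst: "fcP (psubst X R P) \<subseteq> fcP P \<union> fcP R"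
  by (induct P) auto

lemma lc_psubst: "lcP k P \<Longrightarrow> lcP k R \<Longrightarrow> lcP k (psubst X R P)"
  by (induct P) auto

lemma ug_fpv: "ugP X P \<Longrightarrow> X \<in> fpvP P"
  by (induct P) auto

lemma ug_psubst: "fpvP R = {} \<Longrightarrow> ugP Y (psubst X R P) \<Longrightarrow> ugP Y P"
  by (induct P) (auto split: if_splits dest: ug_fpv)

lemma wg_psubst: "fpvP R = {} \<Longrightarrow> wgP R \<Longrightarrow> wgP P \<Longrightarrow> wgP (psubst X R P)"
  by (induct P) (auto dest: ug_psubst)

lemma closedS_unfold:
  assumes "closedS (SProc (PFix X P))"
  shows "closedS (SProc (psubst X (PFix X P) P))"
  using assms fv_psubst[of X "PFix X P" P] fpv_psubst[of X "PFix X P" P]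
  by (auto simp: closedS_def intro!: lc_psubst wg_psubst)

lemma PSig_pow_simps [simp]:
  "fvP ((PSig ^^ n) P) = fvP P"
  "fpvP ((PSig ^^ n) P) = fpvP P"
  "lcP k ((PSig ^^ n) P) = lcP k P"
  "wgP ((PSig ^^ n) P) = wgP P"
  "fcP ((PSig ^^ n) P) = fcP P"
  by (induct n) auto

lemma trans_closedS: "trans \<delta> I \<Gamma> W a W' \<Longrightarrow> closedS W \<Longrightarrow> closedS W'"
proof (induct rule: trans.induct)
  case (Rec \<Gamma> X P a W)
  from Rec(2)[OF closedS_unfold[OF Rec(3)]] show ?case .
next
  case (ResI c W \<Gamma> s w W')
  from closedS_clsS[OF ResI(3)[OF closedS_opnS[OF ResI(4)]]] show ?case .
next
  case (ResV c W a \<Gamma> s W')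
  from closedS_clsS[OF ResV(4)[OF closedS_opnS[OF ResV(5)]]] show ?case .
qed (simp_all add: closedS_def)

lemma fcP_unfold: "fcP (psubst X (PFix X P) P) \<subseteq> fcP (PFix X P)"
  using fc_psubst[of X "PFix X P" P] by simp

text \<open>Freshness of a test channel or clock channel thereby persists along all
  reductions.\<close>

lemma trans_fcS: "trans \<delta> I \<Gamma> W a W' \<Longrightarrow> fcS W' \<subseteq> fcS W"
proof (induct rule: trans.induct)
  case (Rec \<Gamma> X P a W)
  from Rec(2) fcP_unfold[of X P] show ?case unfolding fcS.simps by (rule subset_trans)
next
  case (ResI c W \<Gamma> s w W')
  from ResI(3) fcS_opnS[of c W] have "fcS W' \<subseteq> insert c (fcS W)" by (rule subset_trans)
  then show ?case by (auto simp: fcS_clsS)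
next
  case (ResV c W a \<Gamma> s W')
  from ResV(4) fcS_opnS[of c W] have "fcS W' \<subseteq> insert c (fcS W)" by (rule subset_trans)
  then show ?case by (auto simp: fcS_clsS)
qed (simp_all; blast)+

lemma trans_AOut_fcS: "trans \<delta> I \<Gamma> W a W' \<Longrightarrow> a = AOut c v \<Longrightarrow> c \<in> fcS W"
proof (induct rule: trans.induct)
  case (Rec \<Gamma> X P a W)
  from Rec(2)[OF Rec(3)] fcP_unfold[of X P] show ?case unfolding fcS.simps by (rule rev_subsetD)
next
  case (ResV d W a \<Gamma> s W')
  from ResV(4)[OF ResV(5)] fcS_opnS[of d W] have "c \<in> insert d (fcS W)" by (rule rev_subsetD)
  with ResV(2,5) show ?case by simp
qed simp_all

lemma rcvP_fcP: "rcvP P c \<Longrightarrow> c \<in> fcP P"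
  by (induct P) auto

lemma rcvS_fcS: "rcvS W c \<Longrightarrow> c \<in> fcS W"
  by (induct W) (auto simp: rcvP_fcP)

section \<open>Stale values of idle channels\<close>

text \<open>The value at an idle channel is never read: a receiver reads it only at count 1, and a
  transmission on an idle channel overwrites it. Environments are therefore compared up to these
  values.\<close>

definition env_sim :: "'c set \<Rightarrow> ('c,'v) env \<Rightarrow> ('c,'v) env \<Rightarrow> bool" where
  "env_sim A \<Gamma> \<Gamma>' \<longleftrightarrow> (\<forall>c\<in>A. \<Gamma> c = \<Gamma>' c \<or> fst (\<Gamma> c) = 0 \<and> fst (\<Gamma>' c) = 0)"

lemma env_sim_mono: "env_sim A \<Gamma> \<Gamma>' \<Longrightarrow> B \<subseteq> A \<Longrightarrow> env_sim B \<Gamma> \<Gamma>'"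
  by (auto simp: env_sim_def)

lemma env_simD: "env_sim A \<Gamma> \<Gamma>' \<Longrightarrow> c \<in> A \<Longrightarrow> \<Gamma> c = \<Gamma>' c \<or> fst (\<Gamma> c) = 0 \<and> fst (\<Gamma>' c) = 0"
  by (auto simp: env_sim_def)

lemma env_sim_fst: "env_sim A \<Gamma> \<Gamma>' \<Longrightarrow> c \<in> A \<Longrightarrow> fst (\<Gamma> c) = fst (\<Gamma>' c)"
  by (drule (1) env_simD) auto

lemma env_sim_sym: "env_sim A \<Gamma> \<Gamma>' \<Longrightarrow> env_sim A \<Gamma>' \<Gamma>"
  unfolding env_sim_def by (metis (no_types))

lemma env_sim_upd:
  assumes "env_sim UNIV \<Gamma> \<Gamma>'"
  shows "env_sim UNIV (upd \<delta> a \<Gamma>) (upd \<delta> a \<Gamma>')"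
  unfolding env_sim_def
proof
  fix c
  show "upd \<delta> a \<Gamma> c = upd \<delta> a \<Gamma>' c \<or> fst (upd \<delta> a \<Gamma> c) = 0 \<and> fst (upd \<delta> a \<Gamma>' c) = 0"
    using env_simD[OF assms UNIV_I, of c] by (cases a) auto
qed

lemma env_sim_beval: "env_sim (fcB b) \<Gamma> \<Gamma>' \<Longrightarrow> beval I \<Gamma> b = beval I \<Gamma>' b"
proof (cases b)
  case (BExp r)
  then show "env_sim (fcB b) \<Gamma> \<Gamma>' \<Longrightarrow> ?thesis" by (cases r) (auto simp: exposed_def dest: env_sim_fst)
qed auto

lemma upd_at_cong: "\<Gamma> c = \<Gamma>' c \<Longrightarrow> upd \<delta> a \<Gamma> c = upd \<delta> a \<Gamma>' c"
  by (cases a) auto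

lemma trans_env_sim:
  "trans \<delta> I \<Gamma> W a W' \<Longrightarrow> env_sim (fcS W) \<Gamma> \<Gamma>' \<Longrightarrow> trans \<delta> I \<Gamma>' W a W'"
proof (induct arbitrary: \<Gamma>' rule: trans.induct)
  case (RcvIgn \<Gamma> W c v)
  then show ?case using rcvS_fcS[of W c]
    by (intro trans.RcvIgn) (auto simp: rcvC_def idle_def dest: env_sim_fst)
next
  case (Rec \<Gamma> X P a W)
  have "fcS (SProc (psubst X (PFix X P) P)) \<subseteq> fcS (SProc (PFix X P))"
    using fc_psubst[of X "PFix X P" P] by auto
  with Rec show ?case by (blast intro: trans.Rec env_sim_mono)
next
  case (ResI c W \<Gamma> s w W')
  have "env_sim (fcS (opnS c W)) (\<Gamma>(c := s)) (\<Gamma>'(c := s))"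
    using ResI(4) fcS_opnS[of c W] by (auto simp: env_sim_def)
  note trans.ResI[OF ResI(1) ResI(3)[OF this]]
  moreover have "upd \<delta> (AOut c w) (\<Gamma>'(c := s)) c = upd \<delta> (AOut c w) (\<Gamma>(c := s)) c" by (rule upd_at_cong) simp
  ultimately show ?case by (simp only:)
next
  case (ResV c W a \<Gamma> s W')
  have "env_sim (fcS (opnS c W)) (\<Gamma>(c := s)) (\<Gamma>'(c := s))"
    using ResV(5) fcS_opnS[of c W] by (auto simp: env_sim_def)
  note trans.ResV[OF ResV(1,2) ResV(4)[OF this]]
  moreover have "upd \<delta> (a) (\<Gamma>'(c := s)) c = upd \<delta> (a) (\<Gamma>(c := s)) c" by (rule upd_at_cong) simp
  ultimately show ?case by (simp only:)
next
  case (Then \<Gamma> b P Q)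
  then show ?case using env_sim_beval[of b \<Gamma> \<Gamma>' I] env_sim_mono[of _ \<Gamma> \<Gamma>' "fcB b"] by (auto intro: trans.Then)
next
  case (Else \<Gamma> b P Q)
  then show ?case using env_sim_beval[of b \<Gamma> \<Gamma>' I] env_sim_mono[of _ \<Gamma> \<Gamma>' "fcB b"] by (auto intro: trans.Else)
next
  case (SumRcvL \<Gamma> P c v W Q)
  then show ?case using rcvS_fcS[of "SProc P" c]
    by (intro trans.SumRcvL) (auto simp: rcvC_def idle_def dest: env_sim_fst intro: env_sim_mono)
next
  case (SumRcvR \<Gamma> Q c v W P)
  then show ?case using rcvS_fcS[of "SProc Q" c]
    by (intro trans.SumRcvR) (auto simp: rcvC_def idle_def dest: env_sim_fst intro: env_sim_mono)
next
  case (EndRcv \<Gamma> c w x P)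
  then show ?case by (intro trans.EndRcv) (auto dest!: env_simD[of _ _ _ c])
next
  case (ActRcv \<Gamma> c x P)
  then show ?case by (intro trans.ActRcv) (auto dest: env_sim_fst)
next
  case (SyncL \<Gamma> W1 c v W1' W2 W2')
  then show ?case by (intro trans.SyncL) (auto intro: env_sim_mono)
next
  case (SyncR \<Gamma> W1 c v W1' W2 W2')
  then show ?case by (intro trans.SyncR) (auto intro: env_sim_mono)
next
  case (RcvPar \<Gamma> W1 c v W1' W2 W2')
  then show ?case by (intro trans.RcvPar) (auto intro: env_sim_mono)
next
  case (TimePar \<Gamma> W1 W1' W2 W2')
  then show ?case by (intro trans.TimePar) (auto intro: env_sim_mono)
next
  case (TauParL \<Gamma> W1 W1' W2)
  then show ?case by (intro trans.TauParL) (auto intro: env_sim_mono)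
next
  case (TauParR \<Gamma> W2 W2' W1)
  then show ?case by (intro trans.TauParR) (auto intro: env_sim_mono)
next
  case (SumL a \<Gamma> P W Q)
  then show ?case by (intro trans.SumL) (auto intro: env_sim_mono)
next
  case (SumR a \<Gamma> Q W P)
  then show ?case by (intro trans.SumR) (auto intro: env_sim_mono)
next
  case (SumTime \<Gamma> P P' Q Q')
  then show ?case by (intro trans.SumTime) (auto intro: env_sim_mono)
next
  case (Rcv \<Gamma> c x P Q v)
  then show ?case by (intro trans.Rcv) (auto simp: idle_def dest: env_sim_fst)
next
  case (Timeout \<Gamma> c x P Q)
  then show ?case by (intro trans.Timeout) (auto simp: idle_def dest: env_sim_fst)
next
  case (RcvLate \<Gamma> c x P Q)
  then show ?case by (intro trans.RcvLate) (auto simp: exposed_def dest: env_sim_fst)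
qed (auto intro: trans.Snd trans.TimeNil trans.Sleep trans.Tau)


section \<open>Renaming of free channels\<close>

abbreviation renC :: "('c \<Rightarrow> 'c) \<Rightarrow> 'c chref \<Rightarrow> 'c chref" where
  "renC \<equiv> map_chref"

definition renS :: "('c \<Rightarrow> 'c) \<Rightarrow> ('c,'v,'f) sys \<Rightarrow> ('c,'v,'f) sys" where
  "renS \<pi> W = mapchS (\<lambda>_. renC \<pi>) 0 W"

lemma mapchS_const: "mapchS (\<lambda>_. h) k W = mapchS (\<lambda>_. h) l W"
  by (induct W arbitrary: k l) auto

lemma renS_simps [simp]:
  "renS \<pi> (SProc P) = SProc (mapchP (renC \<pi>) P)"
  "renS \<pi> (SARcv r x P) = SARcv (renC \<pi> r) x (mapchP (renC \<pi>) P)"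
  "renS \<pi> (SPar A B) = SPar (renS \<pi> A) (renS \<pi> B)"
  "renS \<pi> (SNu s W) = SNu s (renS \<pi> W)"
  unfolding renS_def by (auto intro: mapchS_const)

lemma lcC_renC [simp]: "lcC k (renC \<pi> r) = lcC k r"
  by (cases r) auto

lemma lcB_renC [simp]: "lcB k (mapchB (renC \<pi>) b) = lcB k b"
  by (cases b) auto

lemma lcP_renC [simp]: "lcP k (mapchP (renC \<pi>) P) = lcP k P"
  by (induct P) auto

lemma lcS_renS [simp]: "lcS k (renS \<pi> W) = lcS k W"
  by (induct W arbitrary: k) auto

lemma closedS_renS [simp]: "closedS (renS \<pi> W) = closedS W"
  by (simp add: closedS_def) (simp add: renS_def)

lemma fcC_renC [simp]: "fcC (renC \<pi> r) = \<pi> ` fcC r"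
  by (cases r) auto

lemma fcB_renC [simp]: "fcB (mapchB (renC \<pi>) b) = \<pi> ` fcB b"
  by (cases b) auto

lemma fcP_renC [simp]: "fcP (mapchP (renC \<pi>) P) = \<pi> ` fcP P"
  by (induct P) auto

lemma fcS_renS [simp]: "fcS (renS \<pi> W) = \<pi> ` fcS W"
  by (induct W) auto

lemma renC_cong_id: "(\<And>c. c \<in> fcC r \<Longrightarrow> \<pi> c = c) \<Longrightarrow> renC \<pi> r = r"
  by (cases r) auto

lemma mapchB_id: "(\<And>c. c \<in> fcB b \<Longrightarrow> \<pi> c = c) \<Longrightarrow> mapchB (renC \<pi>) b = b"
  by (cases b) (auto intro: renC_cong_id)

lemma mapchP_id: "(\<And>c. c \<in> fcP P \<Longrightarrow> \<pi> c = c) \<Longrightarrow> mapchP (renC \<pi>) P = P"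
  by (induct P) (auto intro: renC_cong_id mapchB_id)

lemma renS_id: "(\<And>c. c \<in> fcS W \<Longrightarrow> \<pi> c = c) \<Longrightarrow> renS \<pi> W = W"
  by (induct W) (auto intro: renC_cong_id mapchP_id)

lemma mapchB_comp: "mapchB f (mapchB g b) = mapchB (\<lambda>r. f (g r)) b"
  by (cases b) auto

lemma mapchP_comp: "mapchP f (mapchP g P) = mapchP (\<lambda>r. f (g r)) P"
  by (induct P) (auto simp: mapchB_comp)

lemma mapchS_comp: "mapchS f k (mapchS g k W) = mapchS (\<lambda>k r. f k (g k r)) k W"
  by (induct W arbitrary: k) (auto simp: mapchP_comp)

lemma renS_invol: "\<pi> \<circ> \<pi> = id \<Longrightarrow> renS \<pi> (renS \<pi> W) = W"
proof -
  assume "\<pi> \<circ> \<pi> = id"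
  then have "renS (\<pi> \<circ> \<pi>) W = W" by (intro renS_id) auto
  then show ?thesis by (simp add: renS_def mapchS_comp o_def chref.map_comp)
qed

lemma renS_mapchS:
  assumes "\<And>k r. renC \<pi> (f k r) = g k (renC \<pi> r)"
  shows "renS \<pi> (mapchS f k W) = mapchS g k (renS \<pi> W)"
proof -
  have B: "mapchB (renC \<pi>) (mapchB (f k) b) = mapchB (g k) (mapchB (renC \<pi>) b)" for k and b :: "('a,'b,'c) bexp"
    by (cases b) (auto simp: assms)
  have P: "mapchP (renC \<pi>) (mapchP (f k) P) = mapchP (g k) (mapchP (renC \<pi>) P)" for k and P :: "('a,'b,'c) proc"
    by (induct P) (auto simp: assms B)
  show ?thesis by (induct W arbitrary: k) (auto simp: assms P)
qed

lemma renC_opnC: "renC \<pi> (opnC k c r) = opnC k (\<pi> c) (renC \<pi> r)"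
  by (cases r) auto

lemma renC_clsC: "inj \<pi> \<Longrightarrow> renC \<pi> (clsC k c r) = clsC k (\<pi> c) (renC \<pi> r)"
  by (cases r) (auto dest: injD)

lemma renS_opnS: "renS \<pi> (opnS c W) = opnS (\<pi> c) (renS \<pi> W)"
  unfolding opnS_def by (intro renS_mapchS renC_opnC)

lemma renS_clsS: "inj \<pi> \<Longrightarrow> renS \<pi> (clsS c W) = clsS (\<pi> c) (renS \<pi> W)"
  unfolding clsS_def by (intro renS_mapchS renC_clsC)

lemma mapchB_substB: "mapchB f (substB x w b) = substB x w (mapchB f b)"
  by (cases b) auto

lemma mapchP_substP: "mapchP f (substP x w P) = substP x w (mapchP f P)"
  by (induct P) (auto simp: mapchB_substB)

lemma mapchP_psubst: "mapchP f (psubst X R P) = psubst X (mapchP f R) (mapchP f P)"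
  by (induct P) auto

lemma mapchP_PSig_pow [simp]: "mapchP f ((PSig ^^ n) P) = (PSig ^^ n) (mapchP f P)"
  by (induct n) auto

lemma rcvP_renC: "inj \<pi> \<Longrightarrow> rcvP (mapchP (renC \<pi>) P) (\<pi> c) = rcvP P c"
proof (induct P)
  case (PRcv r x P Q)
  then show ?case by (cases r) (auto dest: injD)
qed auto

lemma rcvS_renS: "inj \<pi> \<Longrightarrow> rcvS (renS \<pi> W) (\<pi> c) = rcvS W c"
  by (induct W) (auto simp: rcvP_renC)

fun renA :: "('c \<Rightarrow> 'c) \<Rightarrow> ('c,'v) act \<Rightarrow> ('c,'v) act" where
  "renA \<pi> (AOut c v) = AOut (\<pi> c) v"
| "renA \<pi> (AIn c v) = AIn (\<pi> c) v"
| "renA \<pi> ASig = ASig"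
| "renA \<pi> ATau = ATau"

lemma involD: "\<pi> \<circ> \<pi> = id \<Longrightarrow> \<pi> (\<pi> x) = x"
  by (metis comp_apply id_apply)

lemma invol_inj: "\<pi> \<circ> \<pi> = id \<Longrightarrow> inj \<pi>"
  by (metis injI involD)

lemma upd_ren: "\<pi> \<circ> \<pi> = id \<Longrightarrow> upd \<delta> (renA \<pi> a) (\<Gamma> \<circ> \<pi>) = upd \<delta> a \<Gamma> \<circ> \<pi>"
  by (cases a) (auto simp: involD fun_eq_iff)

lemma env_upd_ren: "\<pi> \<circ> \<pi> = id \<Longrightarrow> (\<Gamma>(c := s)) \<circ> \<pi> = (\<Gamma> \<circ> \<pi>)(\<pi> c := s)"
  by (auto simp: fun_eq_iff involD)

lemma beval_ren: "\<pi> \<circ> \<pi> = id \<Longrightarrow> beval I (\<Gamma> \<circ> \<pi>) (mapchB (renC \<pi>) b) = beval I \<Gamma> b"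
proof (cases b)
  case (BExp r)
  then show "\<pi> \<circ> \<pi> = id \<Longrightarrow> ?thesis" by (cases r) (auto simp: exposed_def involD)
qed auto

text \<open>Later only swaps are applied. For an involution \<open>\<Gamma> \<circ> \<pi>\<close> is
  the renamed environment, as \<pi> is its own inverse; in the restriction rules the opening name
  \<open>c\<close> becomes \<open>\<pi> c\<close>, still fresh by injectivity.\<close>

lemma trans_ren:
  assumes "trans \<delta> I \<Gamma> W a W'" and inv: "\<pi> \<circ> \<pi> = id"
  shows "trans \<delta> I (\<Gamma> \<circ> \<pi>) (renS \<pi> W) (renA \<pi> a) (renS \<pi> W')"
  using assms(1)
proof (induct rule: trans.induct)
  case (RcvIgn \<Gamma> W c v)
  then show ?case by (auto intro!: trans.RcvIgn simp: rcvC_def idle_def rcvS_renS[OF invol_inj[OF inv]] involD[OF inv])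
next
  case (Rec \<Gamma> X P a W)
  then show ?case by (auto intro!: trans.Rec simp: mapchP_psubst)
next
  case (SumRcvL \<Gamma> P c v W Q)
  then show ?case
    by (auto intro!: trans.SumRcvL simp: rcvC_def idle_def rcvP_renC[OF invol_inj[OF inv]] involD[OF inv])
next
  case (SumRcvR \<Gamma> P c v W Q)
  then show ?case
    by (auto intro!: trans.SumRcvR simp: rcvC_def idle_def rcvP_renC[OF invol_inj[OF inv]] involD[OF inv])
next
  case (SumL a \<Gamma> P W Q)
  then show ?case by (auto intro!: trans.SumL)
next
  case (SumR a \<Gamma> P W Q)
  then show ?case by (auto intro!: trans.SumR)
next
  case (ResI c W \<Gamma> s w W')
  have "\<pi> c \<notin> fcS (renS \<pi> W)" using ResI(1) invol_inj[OF inv] by (auto dest: injD)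
  moreover have "trans \<delta> I ((\<Gamma> \<circ> \<pi>)(\<pi> c := s)) (opnS (\<pi> c) (renS \<pi> W)) (AOut (\<pi> c) w) (renS \<pi> W')"
    using ResI(3) by (simp only: env_upd_ren[OF inv] renS_opnS renA.simps)
  ultimately have "trans \<delta> I (\<Gamma> \<circ> \<pi>) (SNu s (renS \<pi> W)) ATau
    (SNu (upd \<delta> (AOut (\<pi> c) w) ((\<Gamma> \<circ> \<pi>)(\<pi> c := s)) (\<pi> c)) (clsS (\<pi> c) (renS \<pi> W')))" by (rule trans.ResI)
  moreover have "upd \<delta> (AOut (\<pi> c) w) ((\<Gamma> \<circ> \<pi>)(\<pi> c := s)) (\<pi> c) = upd \<delta> (AOut c w) (\<Gamma>(c := s)) c"
    by simp
  ultimately show ?case by (simp only: renS_simps renS_clsS[OF invol_inj[OF inv]] renA.simps)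
next
  case (ResV c W a \<Gamma> s W')
  have "\<pi> c \<notin> fcS (renS \<pi> W)" using ResV(1) invol_inj[OF inv] by (auto dest: injD)
  moreover have "\<pi> c \<notin> actch (renA \<pi> a)" using ResV(2) invol_inj[OF inv] by (cases a) (auto dest: injD)
  moreover have "trans \<delta> I ((\<Gamma> \<circ> \<pi>)(\<pi> c := s)) (opnS (\<pi> c) (renS \<pi> W)) (renA \<pi> a) (renS \<pi> W')"
    using ResV(4) by (simp only: env_upd_ren[OF inv] renS_opnS)
  ultimately have "trans \<delta> I (\<Gamma> \<circ> \<pi>) (SNu s (renS \<pi> W)) (renA \<pi> a)
    (SNu (upd \<delta> (renA \<pi> a) ((\<Gamma> \<circ> \<pi>)(\<pi> c := s)) (\<pi> c)) (clsS (\<pi> c) (renS \<pi> W')))" by (rule trans.ResV)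
  moreover have "upd \<delta> (renA \<pi> a) ((\<Gamma> \<circ> \<pi>)(\<pi> c := s)) (\<pi> c) = upd \<delta> a (\<Gamma>(c := s)) c"
    using upd_ren[OF inv, of \<delta> a "\<Gamma>(c:=s)"] by (simp only: env_upd_ren[OF inv] o_apply involD[OF inv])
  ultimately show ?case by (simp only: renS_simps renS_clsS[OF invol_inj[OF inv]] renA.simps)
next
  case (Then \<Gamma> b P Q)
  then have "beval I (\<Gamma> \<circ> \<pi>) (mapchB (renC \<pi>) b)" by (simp only: beval_ren[OF inv])
  then show ?case unfolding renS_simps mapchP.simps renA.simps by (rule trans.Then)
next
  case (Else \<Gamma> b P Q)
  then have "\<not> beval I (\<Gamma> \<circ> \<pi>) (mapchB (renC \<pi>) b)" by (simp only: beval_ren[OF inv] not_False_eq_True)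
  then show ?case unfolding renS_simps mapchP.simps renA.simps by (rule trans.Else)
qed (auto intro: trans.intros(1,2,4-12) trans.TimePar trans.TauParL trans.TauParR trans.Tau trans.SumTime
      simp: mapchP_substP idle_def exposed_def involD[OF inv])

section \<open>Well-formedness, input-enabledness and progress\<close>

fun push :: "bool \<Rightarrow> ('c chref \<Rightarrow> bool) \<Rightarrow> 'c chref \<Rightarrow> bool" where
  "push b E (CF c) = E (CF c)"
| "push b E (CB 0) = b"
| "push b E (CB (Suc k)) = E (CB k)"

text \<open>A syntax-directed form of well-formedness, which avoids choosing names for restricted channels.\<close>
fun wfd :: "('c chref \<Rightarrow> bool) \<Rightarrow> ('c,'v,'f) sys \<Rightarrow> bool" where
  "wfd E (SProc P) = True"
| "wfd E (SARcv r x P) = E r"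
| "wfd E (SPar A B) = (wfd E A \<and> wfd E B)"
| "wfd E (SNu s W) = wfd (push (fst s > 0) E) W"

text \<open>Bound indices count as not exposed, in agreement with \<open>wf0\<close>, which admits
  active receivers on free names only.\<close>

fun active :: "('c,'v) env \<Rightarrow> 'c chref \<Rightarrow> bool" where
  "active \<Gamma> (CF c) = exposed \<Gamma> c"
| "active \<Gamma> (CB k) = False"

lemma push_cases:
  "push b E r = (case r of CF c \<Rightarrow> E (CF c) | CB k \<Rightarrow> (case k of 0 \<Rightarrow> b | Suc j \<Rightarrow> E (CB j)))"
  by (cases r) (auto split: nat.split)

lemma wfd_opn:
  assumes "c \<notin> fcS W" "\<And>d. d \<noteq> c \<Longrightarrow> E (CF d) = E' (CF d)" "\<And>j. j \<noteq> k \<Longrightarrow> E (CB j) = E' (CB j)"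
    "E (CB k) = E' (CF c)"
  shows "wfd E' (mapchS (\<lambda>k. opnC k c) k W) = wfd E W"
  using assms
proof (induct W arbitrary: E E' k)
  case (SARcv r x P)
  then show ?case by (cases r) auto
next
  case (SNu s W)
  show ?case unfolding wfd.simps mapchS.simps
    by (rule SNu(1)) (use SNu(2-) in \<open>auto simp: push_cases split: nat.split\<close>)
next
  case (SPar A B)
  from SPar(1)[of E E' k] SPar(2)[of E E' k] SPar(3-) show ?case by auto
qed auto

lemma wfd_cls:
  assumes "wfd E W" "\<And>d. d \<noteq> c \<Longrightarrow> E (CF d) \<Longrightarrow> E' (CF d)" "\<And>j. E (CB j) \<Longrightarrow> E' (CB j)"
    "E (CF c) \<Longrightarrow> E' (CB k)"
  shows "wfd E' (mapchS (\<lambda>k. clsC k c) k W)"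
  using assms
proof (induct W arbitrary: E E' k)
  case (SARcv r x P)
  then show ?case by (cases r) auto
next
  case (SNu s W)
  show ?case unfolding mapchS.simps wfd.simps
    by (rule SNu(1)[OF SNu(2)[unfolded wfd.simps]]) (use SNu(3-) in \<open>auto simp: push_cases split: nat.splits\<close>)
next
  case (SPar A B)
  from SPar(1)[of E E' k] SPar(2)[of E E' k] SPar(3-) show ?case by auto
qed auto

text \<open>The right-hand side does not mention \<open>c\<close>: well-formedness under a
  restriction is independent of the name used to open it, so one derivation of \<open>wf0\<close>
  serves for every name that a transition may pick.\<close>

lemma wfd_opnS:
  assumes "c \<notin> fcS W"
  shows "wfd (active (\<Gamma>(c := s))) (opnS c W) = wfd (active \<Gamma>) (SNu s W)"
proof -
  have "wfd (active (\<Gamma>(c := s))) (opnS c W) =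
      wfd (push (fst s > 0) (active \<Gamma>)) W"
    unfolding opnS_def
    by (rule wfd_opn[OF assms]) (auto simp: exposed_def push_cases split: nat.splits)
  then show ?thesis by simp
qed

lemma wf0_wfd: "wf0 \<Gamma> W \<Longrightarrow> wfd (active \<Gamma>) W"
proof (induct rule: wf0.induct)
  case (4 c W \<Gamma> s)
  from 4(3) show ?case unfolding wfd_opnS[OF 4(1)] .
qed auto

fun szS :: "('c,'v,'f) sys \<Rightarrow> nat" where
  "szS (SPar A B) = Suc (szS A + szS B)"
| "szS (SNu s W) = Suc (szS W)"
| "szS _ = 0"

lemma szS_mapchS [simp]: "szS (mapchS f k W) = szS W"
  by (induct W arbitrary: k) auto

lemma szS_opnS [simp]: "szS (opnS c W) = szS W"
  by (simp add: opnS_def)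

lemma fresh_channel:
  assumes "infinite (UNIV :: 'c set)" "finite A"
  obtains c :: 'c where "c \<notin> A"
  using ex_new_if_finite[OF assms] by blast

text \<open>Infinitely many channels supply the fresh name that the restriction clause of
  \<open>wf0\<close> asks for. The induction is on \<open>szS\<close>, which opening leaves
  unchanged.\<close>

lemma wfd_wf0:
  fixes W :: "('c,'v,'f) sys"
  assumes "infinite (UNIV :: 'c set)"
  shows "wfd (active \<Gamma>) W \<Longrightarrow> wf0 \<Gamma> W"
proof (induct W arbitrary: \<Gamma> rule: measure_induct_rule[of szS])
  case (less W)
  show ?case
  proof (cases W)
    case (SNu s V)
    obtain c where c: "c \<notin> fcS V" using fresh_channel[OF assms finite_fcS] .
    with less(2) SNu have "wfd (active (\<Gamma>(c := s))) (opnS c V)" by (simp only: wfd_opnS[OF c])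
    then have "wf0 (\<Gamma>(c := s)) (opnS c V)" by (rule less(1)[rotated]) (simp add: SNu)
    with SNu c show ?thesis by (simp only: wf0.intros(4))
  next
    case (SARcv r x P)
    with less(2) show ?thesis by (cases r) (auto intro: wf0.intros)
  qed (use less in \<open>auto intro: wf0.intros\<close>)
qed

lemma exposed_upd:
  "exposed \<Gamma> c \<Longrightarrow> a \<noteq> ASig \<Longrightarrow> exposed (upd \<delta> a \<Gamma>) c"
  by (cases a) (auto simp: exposed_def)

lemma wfd_mono: "wfd E W \<Longrightarrow> (\<And>r. E r \<Longrightarrow> E' r) \<Longrightarrow> wfd E' W"
proof (induct W arbitrary: E E')
  case (SNu s W)
  show ?case unfolding wfd.simps
    by (rule SNu(1)[OF SNu(2)[unfolded wfd.simps]]) (use SNu(3) in \<open>auto simp: push_cases split: nat.splits chref.splits\<close>)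
next
  case (SPar A B)
  from SPar(1)[of E E'] SPar(2)[of E E'] SPar(3-) show ?case by auto
qed auto

lemma active_upd: "a \<noteq> ASig \<Longrightarrow> active \<Gamma> r \<Longrightarrow> active (upd \<delta> a \<Gamma>) r"
  by (cases r) (auto simp: exposed_upd)

lemma upd_fun_upd_other: "c \<notin> actch a \<Longrightarrow> d \<noteq> c \<Longrightarrow> upd \<delta> a (\<Gamma>(c := s)) d = upd \<delta> a \<Gamma> d"
  by (cases a) auto

lemma wfd_clsS:
  assumes "wfd (active \<Gamma>') W" "\<And>d. d \<noteq> c \<Longrightarrow> \<Gamma>' d = \<Gamma> d"
  shows "wfd (active \<Gamma>) (SNu (\<Gamma>' c) (clsS c W))"
proof -
  have "wfd (push (fst (\<Gamma>' c) > 0) (active \<Gamma>)) (clsS c W)"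
    unfolding clsS_def using assms(2)
    by (intro wfd_cls[OF assms(1)]) (auto simp: exposed_def push_cases)
  then show ?thesis by simp
qed

text \<open>An active receiver that survives a time step had count above 1, so its channel is still
  exposed; the other actions never end an exposure. A newly started receiver sits on an exposed
  channel because \<open>\<delta> v \<ge> 1\<close>.\<close>

lemma trans_wfd: "trans \<delta> I \<Gamma> W a W' \<Longrightarrow> \<forall>v. \<delta> v \<ge> 1 \<Longrightarrow> wfd (active \<Gamma>) W \<Longrightarrow> wfd (active (upd \<delta> a \<Gamma>)) W'"
proof (induct rule: trans.induct)
  case (Rcv \<Gamma> c x P Q v)
  from Rcv(2)[rule_format, of v] show ?case by (auto simp: exposed_def max_def)
next
  case (RcvIgn \<Gamma> W c v)
  then show ?case by (blast intro: wfd_mono active_upd)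
next
  case (ResI c W \<Gamma> s w W')
  have "wfd (active (upd \<delta> (AOut c w) (\<Gamma>(c := s)))) W'"
    by (rule ResI(3)[OF ResI(4)]) (simp only: wfd_opnS[OF ResI(1)] ResI(5))
  then have "wfd (active \<Gamma>) (SNu (upd \<delta> (AOut c w) (\<Gamma>(c := s)) c) (clsS c W'))"
    by (rule wfd_clsS) auto
  then show ?case by (simp only: upd.simps(4))
next
  case (ResV c W a \<Gamma> s W')
  have "wfd (active (upd \<delta> a (\<Gamma>(c := s)))) W'"
    by (rule ResV(4)[OF ResV(5)]) (simp only: wfd_opnS[OF ResV(1)] ResV(6))
  then show ?case
    by (rule wfd_clsS) (rule upd_fun_upd_other[OF ResV(2)])
qed (auto simp: exposed_def)


lemma wf0_iff_wfd:
  fixes W :: "('c,'v,'f) sys"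
  assumes "infinite (UNIV :: 'c set)"
  shows "wf0 \<Gamma> W \<longleftrightarrow> wfd (active \<Gamma>) W"
  using wf0_wfd wfd_wf0[OF assms] by blast

section \<open>Guardedness, input-enabledness and progress\<close>

text \<open>Induction measure across unfolding: substituting for a guarded variable leaves it
  unchanged, so the unfolded body is smaller than the recursion itself.\<close>

fun ugsz :: "('c,'v,'f) proc \<Rightarrow> nat" where
  "ugsz (PSum P Q) = Suc (ugsz P + ugsz Q)"
| "ugsz (PFix X P) = Suc (ugsz P)"
| "ugsz _ = 0"

text \<open>A broadcast, receiver or conditional has weight 1 because one instantaneous step takes
  it to a delay or an active receiver, both of weight 0; for broadcasts this uses that transmission
  times are positive.\<close>

fun instP :: "('c,'v,'f) proc \<Rightarrow> nat" where
  "instP (PSnd c e P) = 1"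
| "instP (PRcv c x P Q) = 1"
| "instP (PSig P) = 0"
| "instP (PTau P) = Suc (instP P)"
| "instP (PSum P Q) = instP P + instP Q"
| "instP (PCond b P Q) = 1"
| "instP (PVar X) = 0"
| "instP PNil = 0"
| "instP (PFix X P) = instP P"

text \<open>Bounds the number of instantaneous steps before time must pass; guardedness makes it invariant
  under unfolding of recursion.\<close>
fun instS :: "('c,'v,'f) sys \<Rightarrow> nat" where
  "instS (SProc P) = instP P"
| "instS (SARcv r x P) = 0"
| "instS (SPar A B) = instS A + instS B"
| "instS (SNu s W) = instS W"

lemma guarded_psubst:
  "\<not> ugP X P \<Longrightarrow> ugsz (psubst X R P) = ugsz P"
  "\<not> ugP X P \<Longrightarrow> instP (psubst X R P) = instP P"
  "\<not> ugP X P \<Longrightarrow> rcvP (psubst X R P) c = rcvP P c"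
  by (induct P) auto

lemma instP_mapchP [simp]: "instP (mapchP f P) = instP P"
  by (induct P) auto

lemma instS_mapchS [simp]: "instS (mapchS f k W) = instS W"
  by (induct W arbitrary: k) auto

lemma instP_PSig_pow: "n > 0 \<Longrightarrow> instP ((PSig ^^ n) P) = 0"
  by (cases n) auto

lemma closedS_guarded: "closedS (SProc (PFix X P)) \<Longrightarrow> \<not> ugP X P"
  by (simp add: closedS_def)

lemma closedS_PSum [simp]: "closedS (SProc (PSum P Q)) \<longleftrightarrow> closedS (SProc P) \<and> closedS (SProc Q)"
  by (auto simp: closedS_def)

text \<open>Inputs are included, without strict decrease, for the sake of synchronisation: the
  receiving components of a broadcast may change but must not gain weight.\<close>

lemma trans_instS:
  assumes "trans \<delta> I \<Gamma> W a W'" "\<forall>v. \<delta> v \<ge> 1" "closedS W" "a \<noteq> ASig"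
  shows "instS W' \<le> instS W \<and> ((\<forall>c v. a \<noteq> AIn c v) \<longrightarrow> instS W' < instS W)"
  using assms
proof (induct rule: trans.induct)
  case (Snd v e \<Gamma> c P)
  have "\<delta> v > 0" using Snd(2)[rule_format, of v] by simp
  then show ?case by (simp add: instP_PSig_pow)
next
  case (Rec \<Gamma> X P a W)
  have "closedS (SProc (psubst X (PFix X P) P))" using Rec(4) by (rule closedS_unfold)
  with Rec(2,3,5) show ?case using guarded_psubst(2)[OF closedS_guarded[OF Rec(4)]] by simp
next
  case (ResI c W \<Gamma> s w W')
  have "closedS (opnS c W)" using ResI(5) by (rule closedS_opnS)
  with ResI(3,4) show ?case by (simp add: opnS_def clsS_def)
next
  case (ResV c W a \<Gamma> s W')
  have "closedS (opnS c W)" using ResV(6) by (rule closedS_opnS)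
  with ResV(4,5,7) show ?case by (simp add: opnS_def clsS_def)
qed auto

lemma input_enabled_proc:
  assumes "rcvP P c" "idle \<Gamma> c" "closedS (SProc P)"
  shows "\<exists>W'. trans \<delta> I \<Gamma> (SProc P) (AIn c v) W'"
  using assms
proof (induct P rule: measure_induct_rule[of ugsz])
  case (less P)
  show ?case
  proof (cases P)
    case (PRcv r x P Q)
    with less(2,3) show ?thesis by (auto intro: trans.Rcv)
  next
    case (PSum P1 P2)
    with less(2) consider "rcvP P1 c" | "rcvP P2 c" by auto
    then show ?thesis
    proof cases
      case 1
      have "\<exists>W'. trans \<delta> I \<Gamma> (SProc P1) (AIn c v) W'"
        using PSum less(3,4) 1 by (intro less(1)) auto
      moreover have "rcvC \<Gamma> (SProc P1) c" using less(3) 1 by (simp add: rcvC_def)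
      ultimately show ?thesis unfolding PSum using trans.SumRcvL by metis
    next
      case 2
      have "\<exists>W'. trans \<delta> I \<Gamma> (SProc P2) (AIn c v) W'"
        using PSum less(3,4) 2 by (intro less(1)) auto
      moreover have "rcvC \<Gamma> (SProc P2) c" using less(3) 2 by (simp add: rcvC_def)
      ultimately show ?thesis unfolding PSum using trans.SumRcvR by metis
    qed
  next
    case (PFix X Q)
    note g = guarded_psubst[OF closedS_guarded[OF less(4)[unfolded PFix]]]
    have "\<exists>W'. trans \<delta> I \<Gamma> (SProc (psubst X (PFix X Q) Q)) (AIn c v) W'"
      using PFix less(2-4) by (intro less(1)) (auto simp: g intro: closedS_unfold)
    then show ?thesis unfolding PFix by (auto intro: trans.Rec)
  qed (use less in auto)
qed

text \<open>Hence a broadcast is never blocked by a parallel component.\<close>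

lemma input_enabled:
  fixes W :: "('c,'v,'f) sys"
  assumes "infinite (UNIV :: 'c set)" "closedS W"
  shows "\<exists>W'. trans \<delta> I \<Gamma> W (AIn c v) W'"
  using assms(2)
proof (induct W arbitrary: \<Gamma> rule: measure_induct_rule[of szS])
  case (less W)
  show ?case
  proof (cases "rcvC \<Gamma> W c")
    case False
    show ?thesis by (rule exI) (rule trans.RcvIgn[OF False])
  next
    case rcv: True
    show ?thesis
    proof (cases W)
      case (SProc P)
      have "\<exists>W'. trans \<delta> I \<Gamma> (SProc P) (AIn c v) W'"
        by (rule input_enabled_proc) (use rcv less(2) SProc in \<open>simp_all add: rcvC_def\<close>)
      then show ?thesis by (simp only: SProc)
    next
      case (SARcv r x P)
      with rcv show ?thesis by (simp add: rcvC_def)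
    next
      case (SPar A B)
      have "\<exists>A'. trans \<delta> I \<Gamma> A (AIn c v) A'"
        by (rule less(1)) (use less(2) SPar in simp_all)
      then obtain A' where A': "trans \<delta> I \<Gamma> A (AIn c v) A'" ..
      have "\<exists>B'. trans \<delta> I \<Gamma> B (AIn c v) B'"
        by (rule less(1)) (use less(2) SPar in simp_all)
      then obtain B' where "trans \<delta> I \<Gamma> B (AIn c v) B'" ..
      from trans.RcvPar[OF A' this] show ?thesis unfolding SPar ..
    next
      case (SNu s V)
      \<comment> \<open>The opening name must also differ from \<open>c\<close>, so that
        \<open>ResV\<close> applies to the input.\<close>
      have "finite (insert c (fcS V))" by (simp add: finite_fcS)
      from fresh_channel[OF assms(1) this] obtain d where d: "d \<notin> insert c (fcS V)" .
      have "\<exists>V'. trans \<delta> I (\<Gamma>(d := s)) (opnS d V) (AIn c v) V'"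
        by (rule less(1)) (use less(2) SNu closedS_opnS[of s V d] in simp_all)
      then obtain V' where "trans \<delta> I (\<Gamma>(d := s)) (opnS d V) (AIn c v) V'" ..
      moreover have "d \<notin> fcS V" "d \<notin> actch (AIn c v)" using d by simp_all
      ultimately have "trans \<delta> I \<Gamma> (SNu s V) (AIn c v) (SNu (upd \<delta> (AIn c v) (\<Gamma>(d := s)) d) (clsS d V'))"
        by (intro trans.ResV)
      then show ?thesis unfolding SNu ..
    qed
  qed
qed

lemma trans_proc_ASig: "trans \<delta> I \<Gamma> W a W' \<Longrightarrow> a = ASig \<Longrightarrow> W = SProc P \<Longrightarrow> \<exists>P'. W' = SProc P'"
  by (induct arbitrary: P rule: trans.induct) simp_all

abbreviation instantaneous :: "('c,'v) act \<Rightarrow> bool" where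
  "instantaneous a \<equiv> a = ATau \<or> (\<exists>c v. a = AOut c v)"

lemma progress_proc:
  assumes "closedS (SProc P)"
  shows "\<exists>a W'. (instantaneous a \<or> a = ASig) \<and> trans \<delta> I \<Gamma> (SProc P) a W'"
  using assms
proof (induct P rule: measure_induct_rule[of ugsz])
  case (less P)
  show ?case
  proof (cases P)
    case (PSnd r e Q)
    with less(2) obtain c where "r = CF c" by (cases r) (auto simp: closedS_def)
    then show ?thesis unfolding PSnd by (blast intro: trans.Snd)
  next
    case (PRcv r x Q R)
    with less(2) obtain c where "r = CF c" by (cases r) (auto simp: closedS_def)
    moreover have "idle \<Gamma> c \<or> exposed \<Gamma> c" by (auto simp: idle_def exposed_def)
    ultimately show ?thesis unfolding PRcv by (blast intro: trans.Timeout trans.RcvLate)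
  next
    case (PSum P1 P2)
    obtain a1 W1 where 1: "instantaneous a1 \<or> a1 = ASig" "trans \<delta> I \<Gamma> (SProc P1) a1 W1"
      using less(1)[of P1] less(2) unfolding PSum by auto
    obtain a2 W2 where 2: "instantaneous a2 \<or> a2 = ASig" "trans \<delta> I \<Gamma> (SProc P2) a2 W2"
      using less(1)[of P2] less(2) unfolding PSum by auto
    consider "instantaneous a1" | "instantaneous a2" | "a1 = ASig" "a2 = ASig" using 1 2 by blast
    then show ?thesis
    proof cases
      case 3
      \<comment> \<open>\<open>SumTime\<close> requires both targets to be processes again.\<close>
      with 1 2 obtain P1' P2' where "W1 = SProc P1'" "W2 = SProc P2'" using trans_proc_ASig by metis
      with 1 2 3 show ?thesis unfolding PSum by (blast intro: trans.SumTime)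
    qed (use 1 2 in \<open>unfold PSum; blast intro: trans.SumL trans.SumR\<close>)+
  next
    case (PFix X Q)
    note g = guarded_psubst[OF closedS_guarded[OF less(2)[unfolded PFix]]]
    have "\<exists>a W'. (instantaneous a \<or> a = ASig) \<and> trans \<delta> I \<Gamma> (SProc (psubst X (PFix X Q) Q)) a W'"
      using PFix less(2) by (intro less(1)) (auto simp: g intro: closedS_unfold)
    then show ?thesis unfolding PFix by (blast intro: trans.Rec)
  next
    case (PVar X)
    with less(2) show ?thesis by (simp add: closedS_def)
  next
    case (PCond b Q R)
    then show ?thesis by (cases "beval I \<Gamma> b") (blast intro: trans.Then trans.Else)+
  qed (blast intro: trans.Sleep trans.Tau trans.TimeNil)+
qed

text \<open>Well-formedness excludes the stuck case: an active receiver on an idle channel can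
  neither wait nor finish. In a parallel composition a broadcast of one side proceeds because the
  other side is input-enabled.\<close>

lemma progress:
  fixes W :: "('c,'v,'f) sys"
  assumes "infinite (UNIV :: 'c set)" "closedS W" "wf0 \<Gamma> W"
  shows "\<exists>a W'. (instantaneous a \<or> a = ASig) \<and> trans \<delta> I \<Gamma> W a W'"
  using assms(3,2)
proof (induct rule: wf0.induct)
  case (1 \<Gamma> P)
  then show ?case by (rule progress_proc)
next
  case (2 \<Gamma> c x P)
  consider "fst (\<Gamma> c) > 1" | "\<Gamma> c = (1, snd (\<Gamma> c))"
    using 2(1) by (cases "\<Gamma> c") (auto simp: exposed_def, linarith)
  then show ?case by cases (blast intro: trans.ActRcv trans.EndRcv)+
next
  case (3 \<Gamma> A B)
  obtain a1 A' where 1: "instantaneous a1 \<or> a1 = ASig" "trans \<delta> I \<Gamma> A a1 A'" using 3 by auto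
  obtain a2 B' where 2: "instantaneous a2 \<or> a2 = ASig" "trans \<delta> I \<Gamma> B a2 B'" using 3 by auto
  note ie = input_enabled[OF assms(1)]
  consider "a1 = ATau" | "a2 = ATau" | "a1 = ASig" "a2 = ASig" | c v where "a1 = AOut c v" | c v where "a2 = AOut c v"
    using 1 2 by blast
  then show ?case
  proof cases
    case (4 c v)
    obtain B'' where "trans \<delta> I \<Gamma> B (AIn c v) B''" using 3(5) ie[of B \<delta> I \<Gamma> c v] by auto
    with 1(2)[unfolded 4] have "trans \<delta> I \<Gamma> (SPar A B) (AOut c v) (SPar A' B'')" by (rule trans.SyncL)
    then show ?thesis by blast
  next
    case (5 c v)
    obtain A'' where "trans \<delta> I \<Gamma> A (AIn c v) A''" using 3(5) ie[of A \<delta> I \<Gamma> c v] by auto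
    from this 2(2)[unfolded 5] have "trans \<delta> I \<Gamma> (SPar A B) (AOut c v) (SPar A'' B')" by (rule trans.SyncR)
    then show ?thesis by blast
  qed (use 1 2 in \<open>blast intro: trans.TauParL trans.TauParR trans.TimePar\<close>)+
next
  case (4 c W \<Gamma> s)
  obtain a W' where a: "instantaneous a \<or> a = ASig" and t: "trans \<delta> I (\<Gamma>(c := s)) (opnS c W) a W'"
    using 4(3)[OF closedS_opnS[OF 4(4)]] by blast
  show ?case
  proof (cases "c \<in> actch a")
    case True
    with a obtain w where "a = AOut c w" by auto
    with trans.ResI[OF 4(1) t[unfolded this]] show ?thesis by blast
  next
    case False
    with trans.ResV[OF 4(1) _ t] a show ?thesis by blast
  qed
qed

section \<open>Reductions and reduction barbed congruence\<close>

lemma trans_SPar_ASig: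
  "trans \<delta> I \<Gamma> (SPar A B) ASig W \<longleftrightarrow>
    (\<exists>A' B'. W = SPar A' B' \<and> trans \<delta> I \<Gamma> A ASig A' \<and> trans \<delta> I \<Gamma> B ASig B')"
  by (auto elim: trans.cases intro: trans.TimePar)

lemma trans_SPar_ATau:
  "trans \<delta> I \<Gamma> (SPar A B) ATau W \<longleftrightarrow>
    (\<exists>A'. W = SPar A' B \<and> trans \<delta> I \<Gamma> A ATau A') \<or> (\<exists>B'. W = SPar A B' \<and> trans \<delta> I \<Gamma> B ATau B')"
  by (auto elim: trans.cases intro: trans.TauParL trans.TauParR)

lemma trans_SPar_AOut:
  "trans \<delta> I \<Gamma> (SPar A B) (AOut c v) W \<longleftrightarrow>
    (\<exists>A' B'. W = SPar A' B' \<and> (trans \<delta> I \<Gamma> A (AOut c v) A' \<and> trans \<delta> I \<Gamma> B (AIn c v) B'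
      \<or> trans \<delta> I \<Gamma> A (AIn c v) A' \<and> trans \<delta> I \<Gamma> B (AOut c v) B'))"
  (is "?L \<longleftrightarrow> ?R")
proof
  show "?L \<Longrightarrow> ?R" by (erule trans.cases) simp_all
  show "?R \<Longrightarrow> ?L" by (auto intro: trans.SyncL trans.SyncR)
qed

text \<open>If the composition ignores an input then so does each component, so
  \<open>RcvIgn\<close> at the top is an instance of \<open>RcvPar\<close>.\<close>

lemma trans_SPar_AIn:
  "trans \<delta> I \<Gamma> (SPar A B) (AIn c v) W \<longleftrightarrow>
    (\<exists>A' B'. W = SPar A' B' \<and> trans \<delta> I \<Gamma> A (AIn c v) A' \<and> trans \<delta> I \<Gamma> B (AIn c v) B')"
  (is "?L \<longleftrightarrow> ?R")
proof
  show "?L \<Longrightarrow> ?R"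
    by (erule trans.cases) (simp_all, metis rcvC_def rcvS.simps(3) trans.RcvIgn)
  show "?R \<Longrightarrow> ?L" by (auto intro: trans.RcvPar)
qed

lemmas trans_SPar = trans_SPar_ASig trans_SPar_ATau trans_SPar_AOut trans_SPar_AIn

text \<open>Closed under components added on the right, since this is the only form of context in
  \<open>contextual\<close>.\<close>

inductive exch :: "('c,'v,'f) sys \<Rightarrow> ('c,'v,'f) sys \<Rightarrow> bool" where
  exch_base: "exch (SPar (SPar A B) C) (SPar (SPar A C) B)"
| exch_ctx: "exch A B \<Longrightarrow> exch (SPar A K) (SPar B K)"

lemma exch_closedS: "exch A B \<Longrightarrow> closedS A = closedS B"
  by (induct rule: exch.induct) auto

lemma exch_trans: "exch A B \<Longrightarrow> trans \<delta> I \<Gamma> A a A' \<Longrightarrow> \<exists>B'. trans \<delta> I \<Gamma> B a B' \<and> exch A' B'"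
proof (induct arbitrary: a A' rule: exch.induct)
  case (exch_base A B C)
  then show ?case
    by (cases a) (simp_all add: trans_SPar, (metis exch.exch_base)+)
next
  case (exch_ctx A B K)
  note IH = exch_ctx(2)
  show ?case
  proof (cases a)
    case (AOut c v)
    with exch_ctx(3) obtain A'' K' where A': "A' = SPar A'' K'" and
      "trans \<delta> I \<Gamma> A (AOut c v) A'' \<and> trans \<delta> I \<Gamma> K (AIn c v) K' \<or>
       trans \<delta> I \<Gamma> A (AIn c v) A'' \<and> trans \<delta> I \<Gamma> K (AOut c v) K'"
      by (auto simp: trans_SPar)
    then show ?thesis using IH[of "AOut c v" A''] IH[of "AIn c v" A''] AOut
      by (auto simp: trans_SPar intro: exch.exch_ctx) 
  next
    case (AIn c v)
    with exch_ctx(3) obtain A'' K' where A': "A' = SPar A'' K'" and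
      "trans \<delta> I \<Gamma> A (AIn c v) A'' \<and> trans \<delta> I \<Gamma> K (AIn c v) K'"
      by (auto simp: trans_SPar)
    then show ?thesis using IH[of "AIn c v" A''] AIn
      by (auto simp: trans_SPar intro: exch.exch_ctx)
  next
    case ASig
    with exch_ctx(3) obtain A'' K' where A': "A' = SPar A'' K'" and
      "trans \<delta> I \<Gamma> A ASig A'' \<and> trans \<delta> I \<Gamma> K ASig K'"
      by (auto simp: trans_SPar)
    then show ?thesis using IH[of ASig A''] ASig
      by (auto simp: trans_SPar intro: exch.exch_ctx)
  next
    case ATau
    with exch_ctx(3) consider A'' where "A' = SPar A'' K" "trans \<delta> I \<Gamma> A ATau A''" |
       K' where "A' = SPar A K'" "trans \<delta> I \<Gamma> K ATau K'"
      by (auto simp: trans_SPar)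
    then show ?thesis
    proof cases
      case 1
      then show ?thesis using IH[of ATau A''] ATau
        by (auto simp: trans_SPar intro: exch.exch_ctx)
    next
      case 2
      then show ?thesis using exch_ctx(1) ATau by (auto simp: trans_SPar intro: exch.exch_ctx)
    qed
  qed
qed

locale cccp =
  fixes \<delta> :: "'v val \<Rightarrow> nat" and I :: "'f \<Rightarrow> 'v val list \<Rightarrow> 'v val"
  assumes infinite_channels: "infinite (UNIV :: 'c set)"
    and \<delta>_pos: "\<forall>v. \<delta> v \<ge> 1"
begin

abbreviation tr :: "('c,'v) env \<Rightarrow> ('c,'v,'f) sys \<Rightarrow> ('c,'v) act \<Rightarrow> ('c,'v,'f) sys \<Rightarrow> bool" where
  "tr \<equiv> trans \<delta> I"

abbreviation xt :: "('c,'v,'f) config \<Rightarrow> ('c,'v) eact \<Rightarrow> ('c,'v,'f) config \<Rightarrow> bool" where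
  "xt \<equiv> ext \<delta> I"

abbreviation rb :: "('c,'v,'f) config \<Rightarrow> ('c,'v,'f) config \<Rightarrow> bool" where
  "rb \<equiv> rbc \<delta> I"

abbreviation rd :: "('c,'v,'f) config \<Rightarrow> ('c,'v,'f) config \<Rightarrow> bool" where
  "rd \<equiv> red \<delta> I"

lemma fresh: "finite A \<Longrightarrow> \<exists>c :: 'c. c \<notin> A"
  by (rule ex_new_if_finite[OF infinite_channels])

lemma xt_XTau_iff: "xt (\<Gamma>, W) XTau (\<Gamma>', W') \<longleftrightarrow>
    (\<Gamma>' = \<Gamma> \<and> tr \<Gamma> W ATau W') \<or> (\<exists>c v. \<Gamma>' = upd \<delta> (AOut c v) \<Gamma> \<and> tr \<Gamma> W (AOut c v) W')"
  by (auto elim: ext.cases intro: ext.TauExt ext.Shh simp del: upd.simps)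

lemma xt_XSig_iff: "xt (\<Gamma>, W) XSig (\<Gamma>', W') \<longleftrightarrow> \<Gamma>' = upd \<delta> ASig \<Gamma> \<and> tr \<Gamma> W ASig W'"
  by (auto elim: ext.cases intro: ext.Time simp del: upd.simps)

lemma rd_iff: "rd C C' \<longleftrightarrow> xt C XTau C' \<or> xt C XSig C'"
proof (cases C; cases C')
  fix \<Gamma> W \<Gamma>' W' assume eq: "C = (\<Gamma>, W)" "C' = (\<Gamma>', W')"
  show ?thesis unfolding eq red_def xt_XTau_iff xt_XSig_iff fst_conv snd_conv
    unfolding conj_disj_distribR ex_disj_distrib by (simp del: upd.simps(1,2,3)) blast
qed

lemma rd_closedS: "rd (\<Gamma>, W) (\<Gamma>', W') \<Longrightarrow> closedS W \<Longrightarrow> closedS W'"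
  by (auto simp: red_def intro: trans_closedS)

lemma rd_fcS: "rd (\<Gamma>, W) (\<Gamma>', W') \<Longrightarrow> fcS W' \<subseteq> fcS W"
  unfolding red_def using trans_fcS by fastforce

lemma rd_wf0: "rd (\<Gamma>, W) (\<Gamma>', W') \<Longrightarrow> wf0 \<Gamma> W \<Longrightarrow> wf0 \<Gamma>' W'"
  unfolding red_def wf0_iff_wfd[OF infinite_channels] using trans_wfd[OF _ \<delta>_pos] by fastforce

lemma rd_wfc: "rd C C' \<Longrightarrow> wfc C \<Longrightarrow> wfc C'"
  by (cases C; cases C') (auto simp: wfc_def conf_def intro: rd_wf0 rd_closedS)

lemma rds_wfc: "rd\<^sup>*\<^sup>* C C' \<Longrightarrow> wfc C \<Longrightarrow> wfc C'"
  by (induct rule: rtranclp_induct) (auto intro: rd_wfc)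

lemma xt_fresh:
  assumes "xt (\<Gamma>, W) XTau (\<Gamma>', W')"
  shows "(\<forall>d. d \<notin> fcS W \<longrightarrow> \<Gamma>' d = \<Gamma> d) \<and> (\<forall>d. exposed \<Gamma> d \<longrightarrow> exposed \<Gamma>' d)"
  using assms unfolding xt_XTau_iff
  by (auto dest: trans_AOut_fcS simp: exposed_def)

lemma wfc_SPar: "wfc (\<Gamma> :: ('c,'v) env, SPar A B) \<longleftrightarrow> wfc (\<Gamma>, A) \<and> wfc (\<Gamma>, B)"
  by (auto simp: wfc_def conf_def wf0_iff_wfd[OF infinite_channels])

lemma wfc_SProc: "wfc (\<Gamma>, SProc P) \<longleftrightarrow> closedS (SProc P)"
  by (auto simp: wfc_def conf_def intro: wf0.intros)

section \<open>Reduction sequences graded by elapsed time\<close>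

inductive run :: "nat \<Rightarrow> ('c,'v,'f) config \<Rightarrow> ('c,'v,'f) config \<Rightarrow> bool" where
  run_refl: "run 0 C C"
| run_tau: "run n C C' \<Longrightarrow> xt C' XTau C'' \<Longrightarrow> run n C C''"
| run_sig: "run n C C' \<Longrightarrow> xt C' XSig C'' \<Longrightarrow> run (Suc n) C C''"

lemma run_rds: "run n C C' \<Longrightarrow> rd\<^sup>*\<^sup>* C C'"
  by (induct rule: run.induct) (auto simp: rd_iff intro: rtranclp.rtrancl_into_rtrancl)

lemma rds_run: "rd\<^sup>*\<^sup>* C C' \<Longrightarrow> \<exists>n. run n C C'"
  by (induct rule: rtranclp_induct) (auto simp: rd_iff intro: run.intros)

lemma run_0_wtau: "run n C C' \<Longrightarrow> n = 0 \<Longrightarrow> wtau \<delta> I C C'"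
  unfolding wtau_def by (induct rule: run.induct) (auto intro: rtranclp.rtrancl_into_rtrancl)

lemma wtau_run: "wtau \<delta> I C C' \<Longrightarrow> run 0 C C'"
  unfolding wtau_def by (induct rule: rtranclp_induct) (auto intro: run.intros)

lemma wtau_trans: "wtau \<delta> I A B \<Longrightarrow> wtau \<delta> I B C \<Longrightarrow> wtau \<delta> I A C"
  unfolding wtau_def by (rule rtranclp_trans)

lemma wtau_step: "wtau \<delta> I A B \<Longrightarrow> xt B XTau C \<Longrightarrow> wtau \<delta> I A C"
  unfolding wtau_def by (rule rtranclp.rtrancl_into_rtrancl)

lemma wtau_refl: "wtau \<delta> I A A"
  unfolding wtau_def by simp

lemma wtau_rds: "wtau \<delta> I C C' \<Longrightarrow> rd\<^sup>*\<^sup>* C C'"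
  using run_rds wtau_run by blast

lemma run_1_wext: "run n C C' \<Longrightarrow> n = 1 \<Longrightarrow> wext \<delta> I C XSig C'"
proof (induct rule: run.induct)
  case (run_tau n C C' C'')
  then obtain D D' where "wtau \<delta> I C D" "xt D XSig D'" "wtau \<delta> I D' C'" unfolding wext_def by blast
  with wtau_step[OF this(3) run_tau(3)] show ?case unfolding wext_def by blast
next
  case (run_sig n C C' C'')
  then have "wtau \<delta> I C C'" by (simp add: run_0_wtau)
  with run_sig(3) wtau_refl[of C''] show ?case unfolding wext_def by (intro exI conjI)
qed simp

text \<open>No transmission can touch \<open>f\<close>, so its counter is a clock losing one per
  time unit. The subtraction truncates: the clock is exact only while it stays positive.\<close>

lemma run_fresh:
  "run n C C' \<Longrightarrow> f \<notin> fcS (snd C) \<Longrightarrow> f \<notin> fcS (snd C') \<and> fst (fst C' f) = fst (fst C f) - n"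
proof (induct rule: run.induct)
  case (run_tau n C C' C'')
  obtain \<Gamma> W \<Gamma>' W' where eq: "C' = (\<Gamma>, W)" "C'' = (\<Gamma>', W')" by (cases C'; cases C'')
  from run_tau eq show ?case using xt_fresh[of \<Gamma> W \<Gamma>' W'] rd_fcS[of \<Gamma> W \<Gamma>' W'] by (auto simp: rd_iff)
next
  case (run_sig n C C' C'')
  obtain \<Gamma> W \<Gamma>' W' where eq: "C' = (\<Gamma>, W)" "C'' = (\<Gamma>', W')" by (cases C'; cases C'')
  from run_sig eq show ?case using rd_fcS[of \<Gamma> W \<Gamma>' W'] by (auto simp: rd_iff xt_XSig_iff)
qed simp

lemma wbarb_fresh:
  fixes f :: 'c
  assumes "wbarb \<delta> I (\<Gamma>, W) f" "f \<notin> fcS W" shows "exposed \<Gamma> f"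
proof -
  obtain C' n where "run n (\<Gamma>, W) C'" "barb C' f"
    using assms(1) unfolding wbarb_def by (blast dest: rds_run)
  then show ?thesis using run_fresh[of n "(\<Gamma>, W)" C' f] assms(2) by (simp add: barb_def exposed_def)
qed

section \<open>Coinduction and closure properties of the congruence\<close>

lemma rb_I:
  assumes "\<And>C D. R C D \<Longrightarrow> conf C \<and> conf D" "\<And>C D. R C D \<Longrightarrow> R D C"
    "\<And>C D c. R C D \<Longrightarrow> wbarb \<delta> I C c \<Longrightarrow> wbarb \<delta> I D c"
    "\<And>C D C'. R C D \<Longrightarrow> rd C C' \<Longrightarrow> \<exists>D'. rd\<^sup>*\<^sup>* D D' \<and> R C' D'"
    "\<And>\<Gamma>1 W1 \<Gamma>2 W2 W. R (\<Gamma>1, W1) (\<Gamma>2, W2) \<Longrightarrow> closedS W \<Longrightarrow> R (\<Gamma>1, SPar W1 W) (\<Gamma>2, SPar W2 W)"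
    "R C D"
  shows "rb C D"
  unfolding rbc_def
  by (rule exI[of _ R])
    (use assms in \<open>simp add: symp_def barb_preserving_def reduction_closed_def contextual_def\<close>; blast)

lemma rb_conf: "rb C D \<Longrightarrow> conf C \<and> conf D"
  unfolding rbc_def by blast

lemma rb_sym: "rb C D \<Longrightarrow> rb D C"
  unfolding rbc_def by (metis sympD)

lemma rb_wbarb: "rb C D \<Longrightarrow> wbarb \<delta> I C c \<Longrightarrow> wbarb \<delta> I D c"
  unfolding rbc_def barb_preserving_def by blast

lemma rb_rd: "rb C D \<Longrightarrow> rd C C' \<Longrightarrow> \<exists>D'. rd\<^sup>*\<^sup>* D D' \<and> rb C' D'"
  unfolding rbc_def reduction_closed_def by blast

lemma rb_ctx: "rb (\<Gamma>1, W1) (\<Gamma>2, W2) \<Longrightarrow> closedS W \<Longrightarrow> rb (\<Gamma>1, SPar W1 W) (\<Gamma>2, SPar W2 W)"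
  unfolding rbc_def contextual_def by blast

lemma rb_rds: "rd\<^sup>*\<^sup>* C C' \<Longrightarrow> rb C D \<Longrightarrow> \<exists>D'. rd\<^sup>*\<^sup>* D D' \<and> rb C' D'"
proof (induct rule: rtranclp_induct)
  case (step C' C'')
  then obtain D' where "rd\<^sup>*\<^sup>* D D'" "rb C' D'" by blast
  with rb_rd[OF this(2) step(2)] show ?case by (meson rtranclp_trans)
qed blast

lemma rd_sim_rds:
  assumes "\<And>C D C'. Q C D \<Longrightarrow> rd C C' \<Longrightarrow> \<exists>D'. rd D D' \<and> Q C' D'"
  shows "rd\<^sup>*\<^sup>* C C' \<Longrightarrow> Q C D \<Longrightarrow> \<exists>D'. rd\<^sup>*\<^sup>* D D' \<and> Q C' D'"
proof (induct rule: rtranclp_induct)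
  case (step C' C'')
  then obtain D' where "rd\<^sup>*\<^sup>* D D'" "Q C' D'" by blast
  with assms[OF this(2) step(2)] show ?case by (meson rtranclp.rtrancl_into_rtrancl)
qed blast

text \<open>If Q is a strong bisimulation for reductions that respects barbs, closedness and
  contexts, then composing \<open>rb\<close> with Q on one side and its converse on the other gives
  a relation that \<open>rb_I\<close> accepts. It is used to permute components, delete sleeping
  ones and change stale values.\<close>

lemma rb_absorb:
  assumes sim: "\<And>C D C'. Q C D \<Longrightarrow> rd C C' \<Longrightarrow> \<exists>D'. rd D D' \<and> Q C' D'"
    and sim': "\<And>C D D'. Q C D \<Longrightarrow> rd D D' \<Longrightarrow> \<exists>C'. rd C C' \<and> Q C' D'"
    and barb: "\<And>C D c. Q C D \<Longrightarrow> barb C c \<longleftrightarrow> barb D c"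
    and cnf: "\<And>C D. Q C D \<Longrightarrow> conf C \<longleftrightarrow> conf D"
    and ctx: "\<And>\<Gamma> W \<Gamma>' W' K. Q (\<Gamma>, W) (\<Gamma>', W') \<Longrightarrow> Q (\<Gamma>, SPar W K) (\<Gamma>', SPar W' K)"
    and "Q C1 D1" "Q C2 D2" "rb D1 D2"
  shows "rb C1 C2"
proof (rule rb_I[where R = "\<lambda>C1 C2. \<exists>D1 D2. Q C1 D1 \<and> Q C2 D2 \<and> rb D1 D2"])
  have rds: "\<exists>D'. rd\<^sup>*\<^sup>* D D' \<and> Q C' D'" if "rd\<^sup>*\<^sup>* C C'" "Q C D" for C C' D
    using rd_sim_rds[of Q] sim that by blast
  have rds': "\<exists>C'. rd\<^sup>*\<^sup>* C C' \<and> Q C' D'" if "rd\<^sup>*\<^sup>* D D'" "Q C D" for C D D'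
    using rd_sim_rds[of "\<lambda>a b. Q b a"] sim' that by blast
  show "wbarb \<delta> I D c" if "\<exists>D1 D2. Q C D1 \<and> Q D D2 \<and> rb D1 D2" "wbarb \<delta> I C c" for C D c
  proof -
    from that(1) obtain D1 D2 where *: "Q C D1" "Q D D2" "rb D1 D2" by blast
    from that(2) obtain C' where "rd\<^sup>*\<^sup>* C C'" "barb C' c" unfolding wbarb_def by blast
    with rds[OF this(1) *(1)] barb have "wbarb \<delta> I D1 c" unfolding wbarb_def by blast
    then have "wbarb \<delta> I D2 c" using rb_wbarb[OF *(3)] by blast
    then obtain D' where "rd\<^sup>*\<^sup>* D2 D'" "barb D' c" unfolding wbarb_def by blast
    with rds'[OF this(1) *(2)] barb show ?thesis unfolding wbarb_def by blast
  qed
  show "\<exists>D'. rd\<^sup>*\<^sup>* D D' \<and> (\<exists>D1 D2. Q C' D1 \<and> Q D' D2 \<and> rb D1 D2)"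
    if "\<exists>D1 D2. Q C D1 \<and> Q D D2 \<and> rb D1 D2" "rd C C'" for C D C'
  proof -
    from that(1) obtain D1 D2 where *: "Q C D1" "Q D D2" "rb D1 D2" by blast
    from sim[OF *(1) that(2)] obtain D1' where 1: "rd D1 D1'" "Q C' D1'" by blast
    from rb_rd[OF *(3) 1(1)] obtain D2' where 2: "rd\<^sup>*\<^sup>* D2 D2'" "rb D1' D2'" by blast
    from rds'[OF 2(1) *(2)] 1 2 show ?thesis by blast
  qed
  show "\<exists>D1 D2. Q C1 D1 \<and> Q C2 D2 \<and> rb D1 D2" using assms by blast
  show "\<exists>D1 D2. Q D D1 \<and> Q C D2 \<and> rb D1 D2" if "\<exists>D1 D2. Q C D1 \<and> Q D D2 \<and> rb D1 D2" for C D
    using that rb_sym by blast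
  show "conf C \<and> conf D" if "\<exists>D1 D2. Q C D1 \<and> Q D D2 \<and> rb D1 D2" for C D
    using that rb_conf cnf by blast
  show "\<exists>D1 D2. Q (\<Gamma>1, SPar W1 W) D1 \<and> Q (\<Gamma>2, SPar W2 W) D2 \<and> rb D1 D2"
    if "\<exists>D1 D2. Q (\<Gamma>1, W1) D1 \<and> Q (\<Gamma>2, W2) D2 \<and> rb D1 D2" "closedS W" for \<Gamma>1 W1 \<Gamma>2 W2 W
  proof -
    from that(1) obtain \<Gamma>1' V1 \<Gamma>2' V2 where "Q (\<Gamma>1, W1) (\<Gamma>1', V1)" "Q (\<Gamma>2, W2) (\<Gamma>2', V2)" "rb (\<Gamma>1', V1) (\<Gamma>2', V2)"
      by (metis surj_pair)
    then show ?thesis using ctx rb_ctx[OF _ that(2)] by blast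
  qed
qed

end

section \<open>Cancelling inert components\<close>

lemma trans_PNil:
  "trans \<delta> I \<Gamma> (SProc PNil) a W \<longleftrightarrow> (a = ASig \<or> (\<exists>c v. a = AIn c v)) \<and> W = SProc PNil" (is "?L \<longleftrightarrow> ?R")
proof
  show "?L \<Longrightarrow> ?R" by (erule trans.cases) simp_all
  show "?R \<Longrightarrow> ?L" by (auto intro: trans.TimeNil trans.RcvIgn simp: rcvC_def)
qed

lemma trans_PSig:
  "trans \<delta> I \<Gamma> (SProc (PSig P)) a W \<longleftrightarrow>
    a = ASig \<and> W = SProc P \<or> (\<exists>c v. a = AIn c v) \<and> W = SProc (PSig P)" (is "?L \<longleftrightarrow> ?R")
proof
  show "?L \<Longrightarrow> ?R" by (erule trans.cases) simp_all
  show "?R \<Longrightarrow> ?L" by (auto intro: trans.Sleep trans.RcvIgn simp: rcvC_def)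
qed

lemma trans_PTau:
  "trans \<delta> I \<Gamma> (SProc (PTau P)) a W \<longleftrightarrow>
    a = ATau \<and> W = SProc P \<or> (\<exists>c v. a = AIn c v) \<and> W = SProc (PTau P)" (is "?L \<longleftrightarrow> ?R")
proof
  show "?L \<Longrightarrow> ?R" by (erule trans.cases) simp_all
  show "?R \<Longrightarrow> ?L" by (auto intro: trans.Tau trans.RcvIgn simp: rcvC_def)
qed

lemma trans_PSnd:
  "trans \<delta> I \<Gamma> (SProc (PSnd (CF c) e P)) a W \<longleftrightarrow>
    a = AOut c (eval I e) \<and> W = SProc ((PSig ^^ \<delta> (eval I e)) P) \<or>
    (\<exists>c v. a = AIn c v) \<and> W = SProc (PSnd (CF c) e P)" (is "?L \<longleftrightarrow> ?R")
proof
  show "?L \<Longrightarrow> ?R" by (erule trans.cases) simp_all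
  show "?R \<Longrightarrow> ?L" by (auto intro: trans.Snd trans.RcvIgn simp: rcvC_def)
qed

lemma trans_PCond:
  "trans \<delta> I \<Gamma> (SProc (PCond b P Q)) a W \<longleftrightarrow>
    a = ATau \<and> W = SProc (PSig (if beval I \<Gamma> b then P else Q)) \<or>
    (\<exists>c v. a = AIn c v) \<and> W = SProc (PCond b P Q)" (is "?L \<longleftrightarrow> ?R")
proof
  show "?L \<Longrightarrow> ?R" by (erule trans.cases) simp_all
  show "?R \<Longrightarrow> ?L" by (auto intro: trans.Then trans.Else trans.RcvIgn simp: rcvC_def)
qed

text \<open>An ignored input can leave the term folded or unfolded, since \<open>RcvIgn\<close>
  applies both before and after \<open>Rec\<close>.\<close>

lemma trans_PFix:
  "trans \<delta> I \<Gamma> (SProc (PFix X P)) a W \<longleftrightarrow>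
    trans \<delta> I \<Gamma> (SProc (psubst X (PFix X P) P)) a W \<or>
    (\<exists>c v. a = AIn c v \<and> \<not> rcvC \<Gamma> (SProc (PFix X P)) c) \<and> W = SProc (PFix X P)" (is "?L \<longleftrightarrow> ?R")
proof
  show "?L \<Longrightarrow> ?R" by (erule trans.cases) simp_all
  show "?R \<Longrightarrow> ?L" by (auto intro: trans.Rec trans.RcvIgn)
qed

text \<open>One summand that refuses time makes the whole sum refuse it; the test processes block
  time in this way.\<close>

lemma trans_PSum:
  assumes "\<And>c. \<not> rcvP P c" "\<And>c. \<not> rcvP Q c" "\<And>W. \<not> trans \<delta> I \<Gamma> (SProc Q) ASig W"
  shows "trans \<delta> I \<Gamma> (SProc (PSum P Q)) a W \<longleftrightarrow>
    (a = ATau \<or> (\<exists>c v. a = AOut c v)) \<and> (trans \<delta> I \<Gamma> (SProc P) a W \<or> trans \<delta> I \<Gamma> (SProc Q) a W) \<or>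
    (\<exists>c v. a = AIn c v) \<and> W = SProc (PSum P Q)" (is "?L \<longleftrightarrow> ?R")
proof
  show "?L \<Longrightarrow> ?R" by (erule trans.cases) (use assms in \<open>simp_all add: rcvC_def\<close>)
  show "?R \<Longrightarrow> ?L" using assms by (auto intro: trans.SumL trans.SumR trans.RcvIgn simp: rcvC_def)
qed

lemma trans_SARcv_AIn: "trans \<delta> I \<Gamma> (SARcv r x P) (AIn c v) W \<longleftrightarrow> W = SARcv r x P" (is "?L \<longleftrightarrow> ?R")
proof
  show "?L \<Longrightarrow> ?R" by (erule trans.cases) simp_all
  show "?R \<Longrightarrow> ?L" by (auto intro: trans.RcvIgn simp: rcvC_def)
qed

lemma trans_SARcv_instantaneous:
  "\<not> trans \<delta> I \<Gamma> (SARcv r x P) ATau W" "\<not> trans \<delta> I \<Gamma> (SARcv r x P) (AOut c v) W"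
  by (auto elim: trans.cases)

lemma trans_SARcv_ASig: "trans \<delta> I \<Gamma> (SARcv (CF c) x P) ASig W \<longleftrightarrow>
    fst (\<Gamma> c) > 1 \<and> W = SARcv (CF c) x P \<or> (\<exists>w. \<Gamma> c = (1, w) \<and> W = SProc (substP x w P))" (is "?L \<longleftrightarrow> ?R")
proof
  show "?L \<Longrightarrow> ?R" by (erule trans.cases) simp_all
  show "?R \<Longrightarrow> ?L" using trans.ActRcv[of \<Gamma> c] trans.EndRcv[of \<Gamma> c] by blast
qed

lemma trans_PSig_pow:
  "trans \<delta> I \<Gamma> (SProc ((PSig ^^ Suc k) P)) a W \<longleftrightarrow>
    a = ASig \<and> W = SProc ((PSig ^^ k) P) \<or> (\<exists>c v. a = AIn c v) \<and> W = SProc ((PSig ^^ Suc k) P)"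
  by (simp add: trans_PSig)

text \<open>The remains of a test that ended silently: after a broadcast or a conditional some units
  of sleep are left.\<close>

definition zero :: "nat \<Rightarrow> ('c,'v,'f) sys" where
  "zero k = SProc ((PSig ^^ k) PNil)"

lemma zero_simps [simp]: "closedS (zero k)" "fcS (zero k) = {}"
  by (auto simp: zero_def closedS_def)

lemma trans_zero:
  "trans \<delta> I \<Gamma> (zero k) a W \<longleftrightarrow> a = ASig \<and> W = zero (k - 1) \<or> (\<exists>c v. a = AIn c v) \<and> W = zero k"
  by (cases k) (auto simp: zero_def trans_PSig trans_PNil)

text \<open>The sleep \<open>k\<close> is arbitrary in the base rule because it shrinks with time
  and may differ between the two configurations being compared.\<close>

inductive ins :: "('c,'v,'f) sys \<Rightarrow> ('c,'v,'f) sys \<Rightarrow> bool" where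
  ins_base: "ins A (SPar A (zero k))"
| ins_ctx: "ins A B \<Longrightarrow> ins (SPar A K) (SPar B K)"

lemma ins_closedS: "ins A B \<Longrightarrow> closedS A = closedS B"
  by (induct rule: ins.induct) auto

lemma ins_trans: "ins A B \<Longrightarrow> trans \<delta> I \<Gamma> A a A' \<Longrightarrow> \<exists>B'. trans \<delta> I \<Gamma> B a B' \<and> ins A' B'"
proof (induct arbitrary: a A' rule: ins.induct)
  case (ins_base A k)
  then show ?case
    by (cases a) (auto simp: trans_SPar trans_zero intro: ins.ins_base)
next
  case (ins_ctx A B K)
  note IH = ins_ctx(2)
  show ?case
  proof (cases a)
    case (AOut c v)
    with ins_ctx(3) show ?thesis
      by (auto simp: trans_SPar dest!: IH intro: ins.ins_ctx)
  next
    case (AIn c v)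
    with ins_ctx(3) show ?thesis
      by (auto simp: trans_SPar dest!: IH intro: ins.ins_ctx)
  next
    case ASig
    with ins_ctx(3) show ?thesis
      by (auto simp: trans_SPar dest!: IH intro: ins.ins_ctx)
  next
    case ATau
    with ins_ctx(1,3) show ?thesis
      by (auto simp: trans_SPar dest!: IH intro: ins.ins_ctx)
  qed
qed

lemma ins_trans': "ins A B \<Longrightarrow> trans \<delta> I \<Gamma> B a B' \<Longrightarrow> \<exists>A'. trans \<delta> I \<Gamma> A a A' \<and> ins A' B'"
proof (induct arbitrary: a B' rule: ins.induct)
  case (ins_base A k)
  then show ?case
    by (cases a) (auto simp: trans_SPar trans_zero intro: ins.ins_base)
next
  case (ins_ctx A B K)
  note IH = ins_ctx(2)
  show ?case
  proof (cases a)
    case (AOut c v)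
    with ins_ctx(3) show ?thesis
      by (auto simp: trans_SPar dest!: IH intro: ins.ins_ctx)
  next
    case (AIn c v)
    with ins_ctx(3) show ?thesis
      by (auto simp: trans_SPar dest!: IH intro: ins.ins_ctx)
  next
    case ASig
    with ins_ctx(3) show ?thesis
      by (auto simp: trans_SPar dest!: IH intro: ins.ins_ctx)
  next
    case ATau
    with ins_ctx(1,3) show ?thesis
      by (auto simp: trans_SPar dest!: IH intro: ins.ins_ctx)
  qed
qed

context cccp
begin

lemma rb_absorb_sys:
  assumes "\<And>A B \<Gamma> a A'. S A B \<Longrightarrow> tr \<Gamma> A a A' \<Longrightarrow> \<exists>B'. tr \<Gamma> B a B' \<and> S A' B'"
    and "\<And>A B \<Gamma> a B'. S A B \<Longrightarrow> tr \<Gamma> B a B' \<Longrightarrow> \<exists>A'. tr \<Gamma> A a A' \<and> S A' B'"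
    and "\<And>A B. S A B \<Longrightarrow> closedS A \<longleftrightarrow> closedS B"
    and "\<And>A B K. S A B \<Longrightarrow> S (SPar A K) (SPar B K)"
    and "S A1 B1" "S A2 B2" "rb (\<Gamma>1, B1) (\<Gamma>2, B2)"
  shows "rb (\<Gamma>1, A1) (\<Gamma>2, A2)"
proof (rule rb_absorb[where Q = "\<lambda>C D. fst C = fst D \<and> S (snd C) (snd D)"])
  fix C D C' assume Q: "fst C = fst D \<and> S (snd C) (snd D)" and "rd C C'"
  then obtain a where a: "a = ATau \<or> a = ASig \<or> (\<exists>c v. a = AOut c v)" and
    t: "tr (fst D) (snd C) a (snd C')" and C': "fst C' = upd \<delta> a (fst D)"
    unfolding red_def by auto
  from assms(1)[OF conjunct2[OF Q] t] obtain B' where "tr (fst D) (snd D) a B'" "S (snd C') B'" by blast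
  with a C' have "rd D (fst C', B')" unfolding red_def by auto
  with \<open>S (snd C') B'\<close> show "\<exists>D'. rd D D' \<and> fst C' = fst D' \<and> S (snd C') (snd D')"
    by (intro exI[of _ "(fst C', B')"]) simp
next
  fix C D D' assume Q: "fst C = fst D \<and> S (snd C) (snd D)" and "rd D D'"
  then obtain a where a: "a = ATau \<or> a = ASig \<or> (\<exists>c v. a = AOut c v)" and
    t: "tr (fst C) (snd D) a (snd D')" and D': "fst D' = upd \<delta> a (fst C)"
    unfolding red_def by auto
  from assms(2)[OF conjunct2[OF Q] t] obtain A' where "tr (fst C) (snd C) a A'" "S A' (snd D')" by blast
  with a D' have "rd C (fst D', A')" unfolding red_def by auto
  with \<open>S A' (snd D')\<close> show "\<exists>C'. rd C C' \<and> fst C' = fst D' \<and> S (snd C') (snd D')"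
    by (intro exI[of _ "(fst D', A')"]) simp
qed (use assms in \<open>auto simp: barb_def conf_def\<close>)

lemma exch_sym: "exch A B \<Longrightarrow> exch B A"
  by (induct rule: exch.induct) (auto intro: exch.intros)

lemma exch_trans':
  assumes "exch A B" "trans \<delta> I \<Gamma> B a B'"
  shows "\<exists>A'. trans \<delta> I \<Gamma> A a A' \<and> exch A' B'"
  using exch_trans[OF exch_sym[OF assms(1)] assms(2)] exch_sym by blast

lemma rb_exch:
  assumes "rb (\<Gamma>1, SPar (SPar A1 B1) C1) (\<Gamma>2, SPar (SPar A2 B2) C2)"
  shows "rb (\<Gamma>1, SPar (SPar A1 C1) B1) (\<Gamma>2, SPar (SPar A2 C2) B2)"
  by (rule rb_absorb_sys[where S = exch, OF exch_trans exch_trans' exch_closedS exch.exch_ctx exch.exch_base exch.exch_base assms])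

lemma rb_cancel:
  assumes "rb (\<Gamma>1, SPar A1 (zero k)) (\<Gamma>2, SPar A2 (zero m))"
  shows "rb (\<Gamma>1, A1) (\<Gamma>2, A2)"
  by (rule rb_absorb_sys[where S = ins, OF ins_trans ins_trans' ins_closedS ins.ins_ctx ins.ins_base ins.ins_base assms])

lemma rb_env_sim:
  assumes "rb (\<Gamma>1, W1) (\<Gamma>2, W2)" "env_sim UNIV \<Gamma>1 \<Gamma>1'" "env_sim UNIV \<Gamma>2 \<Gamma>2'"
  shows "rb (\<Gamma>1', W1) (\<Gamma>2', W2)"
proof (rule rb_absorb[where Q = "\<lambda>C D. env_sim UNIV (fst C) (fst D) \<and> snd C = snd D"])
  have *: "\<exists>D'. rd D D' \<and> env_sim UNIV (fst C') (fst D') \<and> snd C' = snd D'"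
    if Q: "env_sim UNIV (fst C) (fst D)" "snd C = snd D" and "rd C C'" for C D C'
  proof -
    from \<open>rd C C'\<close> obtain a where a: "a = ATau \<or> a = ASig \<or> (\<exists>c v. a = AOut c v)" and
      t: "tr (fst C) (snd C) a (snd C')" and C': "fst C' = upd \<delta> a (fst C)"
      unfolding red_def by auto
    have "tr (fst D) (snd D) a (snd C')"
      using trans_env_sim[OF t env_sim_mono[OF Q(1)]] Q(2) by simp
    then have "rd D (upd \<delta> a (fst D), snd C')" using a unfolding red_def by auto
    with env_sim_upd[OF Q(1)] C' show ?thesis by (intro exI[of _ "(upd \<delta> a (fst D), snd C')"]) simp
  qed
  fix C D
  {
    fix C' assume "env_sim UNIV (fst C) (fst D) \<and> snd C = snd D" "rd C C'"
    with * show "\<exists>D'. rd D D' \<and> env_sim UNIV (fst C') (fst D') \<and> snd C' = snd D'" by blast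
  }
  {
    fix D' assume "env_sim UNIV (fst C) (fst D) \<and> snd C = snd D" "rd D D'"
    with *[of D C D'] env_sim_sym show "\<exists>C'. rd C C' \<and> env_sim UNIV (fst C') (fst D') \<and> snd C' = snd D'" by metis
  }
  show "env_sim UNIV (fst C) (fst D) \<and> snd C = snd D \<Longrightarrow> barb C c = barb D c" for c
    using env_sim_fst[of UNIV "fst C" "fst D" c] by (simp add: barb_def exposed_def)
qed (use assms env_sim_sym in \<open>auto simp: conf_def\<close>)

section \<open>Congruence under channel renaming\<close>

abbreviation ren :: "('c \<Rightarrow> 'c) \<Rightarrow> ('c,'v,'f) config \<Rightarrow> ('c,'v,'f) config" where
  "ren \<pi> C \<equiv> (fst C \<circ> \<pi>, renS \<pi> (snd C))"

lemma rd_ren: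
  assumes "\<pi> \<circ> \<pi> = id" "rd C C'"
  shows "rd (ren \<pi> C) (ren \<pi> C')"
proof -
  from assms(2) obtain a where a: "a = ATau \<or> a = ASig \<or> (\<exists>c v. a = AOut c v)" and
    t: "tr (fst C) (snd C) a (snd C')" and C': "fst C' = upd \<delta> a (fst C)"
    unfolding red_def by auto
  have "renA \<pi> a = ATau \<or> renA \<pi> a = ASig \<or> (\<exists>c v. renA \<pi> a = AOut c v)" using a by auto
  then show ?thesis unfolding red_def fst_conv snd_conv
    using trans_ren[OF t assms(1)] upd_ren[OF assms(1), of \<delta> a "fst C"] C' by metis
qed

lemma rds_ren: "rd\<^sup>*\<^sup>* C C' \<Longrightarrow> \<pi> \<circ> \<pi> = id \<Longrightarrow> rd\<^sup>*\<^sup>* (ren \<pi> C) (ren \<pi> C')"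
  by (induct rule: rtranclp_induct) (auto dest: rd_ren intro: rtranclp.rtrancl_into_rtrancl)

lemma ren_invol: "\<pi> \<circ> \<pi> = id \<Longrightarrow> ren \<pi> (ren \<pi> C) = C"
  by (cases C) (simp add: renS_invol comp_assoc)

lemma wbarb_ren:
  assumes "\<pi> \<circ> \<pi> = id" "wbarb \<delta> I C c"
  shows "wbarb \<delta> I (ren \<pi> C) (\<pi> c)"
proof -
  from assms(2) obtain C' where "rd\<^sup>*\<^sup>* C C'" "barb C' c" unfolding wbarb_def by blast
  then have "rd\<^sup>*\<^sup>* (ren \<pi> C) (ren \<pi> C')" "barb (ren \<pi> C') (\<pi> c)"
    by (auto simp: barb_def exposed_def involD[OF assms(1)] rds_ren[OF _ assms(1)])
  then show ?thesis unfolding wbarb_def by blast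
qed

lemma rb_ren:
  assumes inv: "\<pi> \<circ> \<pi> = id" and "rb C D"
  shows "rb (ren \<pi> C) (ren \<pi> D)"
proof (rule rb_I[where R = "\<lambda>C D. rb (ren \<pi> C) (ren \<pi> D)"])
  fix C D assume R: "rb (ren \<pi> C) (ren \<pi> D)"
  show "conf C \<and> conf D" using rb_conf[OF R] by (simp add: conf_def)
  show "rb (ren \<pi> D) (ren \<pi> C)" using R by (rule rb_sym)
  show "wbarb \<delta> I D c" if "wbarb \<delta> I C c" for c
    using wbarb_ren[OF inv rb_wbarb[OF R wbarb_ren[OF inv that]]] by (simp only: ren_invol[OF inv] involD[OF inv])
  show "\<exists>D'. rd\<^sup>*\<^sup>* D D' \<and> rb (ren \<pi> C') (ren \<pi> D')" if "rd C C'" for C'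
  proof -
    from rb_rd[OF R rd_ren[OF inv that]] obtain D' where "rd\<^sup>*\<^sup>* (ren \<pi> D) D'" "rb (ren \<pi> C') D'" by blast
    with rds_ren[OF this(1) inv] show ?thesis
      by (intro exI[of _ "ren \<pi> D'"]) (simp only: ren_invol[OF inv])
  qed
next
  show "rb (ren \<pi> (\<Gamma>1, SPar W1 W)) (ren \<pi> (\<Gamma>2, SPar W2 W))"
    if "rb (ren \<pi> (\<Gamma>1, W1)) (ren \<pi> (\<Gamma>2, W2))" "closedS W" for \<Gamma>1 W1 \<Gamma>2 W2 W
    \<comment> \<open>A context \<open>W\<close> of the original pair acts as
      \<open>renS \<pi> W\<close> on the renamed pair.\<close>
    using rb_ctx[OF that(1), of "renS \<pi> W"] that(2) by simp
  show "rb (ren \<pi> (ren \<pi> C)) (ren \<pi> (ren \<pi> D))" using assms(2) by (simp only: ren_invol[OF inv])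
qed

text \<open>Swapping two idle channels changes the environments only in stale values, so
  \<open>rb_env_sim\<close> restores the original ones and just the systems are renamed.\<close>

lemma rb_swap:
  assumes "rb (\<Gamma>1, W1) (\<Gamma>2, W2)"
    and idle: "idle \<Gamma>1 g" "idle \<Gamma>1 h" "idle \<Gamma>2 g" "idle \<Gamma>2 h"
  shows "rb (\<Gamma>1, renS (id(g := h, h := g)) W1) (\<Gamma>2, renS (id(g := h, h := g)) W2)"
proof -
  let ?\<pi> = "id(g := h, h := g)"
  have "?\<pi> \<circ> ?\<pi> = id" by (auto simp: fun_eq_iff)
  from rb_ren[OF this assms(1)] have "rb (\<Gamma>1 \<circ> ?\<pi>, renS ?\<pi> W1) (\<Gamma>2 \<circ> ?\<pi>, renS ?\<pi> W2)"
    by (simp only: fst_conv snd_conv)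
  then show ?thesis by (rule rb_env_sim) (use idle in \<open>auto simp: env_sim_def idle_def\<close>)
qed

end

section \<open>Distinguishing contexts\<close>

definition loud :: "'c \<Rightarrow> ('c,'v,'f) proc" where
  "loud g = PFix 0 (PSnd (CF g) (EVal Err) (PVar 0))"

definition choice :: "'c \<Rightarrow> ('c,'v,'f) proc" where
  "choice g = PSum (PTau PNil) (PTau (loud g))"

definition delayed :: "nat \<Rightarrow> ('c,'v,'f) proc \<Rightarrow> ('c,'v,'f) sys" where
  "delayed k P = SProc ((PSig ^^ k) P)"

lemma trans_loud:
  "trans \<delta> I \<Gamma> (SProc (loud g)) a W \<longleftrightarrow>
    a = AOut g Err \<and> W = delayed (\<delta> Err) (loud g) \<or>
    (\<exists>c v. a = AIn c v) \<and> (W = SProc (loud g) \<or> W = SProc (PSnd (CF g) (EVal Err) (loud g)))"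
proof -
  have "psubst 0 (loud g) (PSnd (CF g) (EVal Err) (PVar 0)) = PSnd (CF g) (EVal Err) (loud g)" by simp
  then show ?thesis unfolding loud_def trans_PFix by (auto simp: trans_PSnd rcvC_def delayed_def)
qed

lemma trans_choice:
  "trans \<delta> I \<Gamma> (SProc (choice g)) a W \<longleftrightarrow>
    a = ATau \<and> (W = zero 0 \<or> W = SProc (loud g)) \<or> (\<exists>c v. a = AIn c v) \<and> W = SProc (choice g)"
proof -
  have "trans \<delta> I \<Gamma> (SProc (PSum (PTau PNil) (PTau (loud g)))) a W \<longleftrightarrow>
    (a = ATau \<or> (\<exists>c v. a = AOut c v)) \<and> (trans \<delta> I \<Gamma> (SProc (PTau PNil)) a W \<or> trans \<delta> I \<Gamma> (SProc (PTau (loud g))) a W) \<or>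
    (\<exists>c v. a = AIn c v) \<and> W = SProc (PSum (PTau PNil) (PTau (loud g)))"
    by (rule trans_PSum) (auto simp: trans_PTau)
  then show ?thesis unfolding choice_def by (auto simp: trans_PTau zero_def)
qed

lemma delayed_0: "delayed 0 P = SProc P"
  by (simp add: delayed_def)

lemma trans_delayed:
  "trans \<delta> I \<Gamma> (delayed (Suc k) P) a W \<longleftrightarrow>
    a = ASig \<and> W = delayed k P \<or> (\<exists>c v. a = AIn c v) \<and> W = delayed (Suc k) P"
  unfolding delayed_def by (rule trans_PSig_pow)

lemma loud_simps [simp]: "fcP (loud g) = {g}" "closedS (SProc (loud g))" "\<not> rcvP (loud g) c"
  by (auto simp: loud_def closedS_def)

lemma loud_parts [simp]: "fvP (loud g) = {}" "fpvP (loud g) = {}" "lcP k (loud g)" "wgP (loud g)" "substP x w (loud g) = loud g"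
  by (auto simp: loud_def)

lemma choice_simps [simp]: "fcP (choice g) = {g}" "closedS (SProc (choice g))" "\<not> rcvP (choice g) c"
  by (auto simp: choice_def closedS_def)

lemma delayed_simps [simp]: "fcS (delayed k P) = fcP P" "closedS (delayed k P) = closedS (SProc P)"
  by (auto simp: delayed_def closedS_def)

text \<open>The invariant of a loud component. It sleeps no longer than g stays exposed, so g either
  is exposed or can be exposed at once, even next to components that stop time. The first disjunct
  is the unfolded form that an ignored input may leave.\<close>

definition noisy :: "'c \<Rightarrow> ('c,'v) env \<Rightarrow> ('c,'v,'f) sys \<Rightarrow> bool" where
  "noisy g \<Gamma> T \<longleftrightarrow> T = SProc (PSnd (CF g) (EVal Err) (loud g)) \<or> (\<exists>k\<le>fst (\<Gamma> g). T = delayed k (loud g))"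

lemma noisy_loud: "noisy g \<Gamma> (SProc (loud g))"
  unfolding noisy_def by (metis delayed_0 le0)

lemma fst_upd_mono: "a \<noteq> ASig \<Longrightarrow> fst (\<Gamma> g) \<le> fst (upd \<delta> a \<Gamma> g)"
  by (cases a) auto

lemma trans_noisy:
  assumes "noisy g \<Gamma> T" "trans \<delta> I \<Gamma> T a T'"
  shows "a \<noteq> ATau \<and> noisy g (upd \<delta> a \<Gamma>) T'"
  using assms(1) unfolding noisy_def
proof (elim disjE exE conjE)
  assume T: "T = SProc (PSnd (CF g) (EVal Err) (loud g))"
  with assms(2) have "a = AOut g Err \<and> T' = delayed (\<delta> Err) (loud g) \<or> (\<exists>c v. a = AIn c v) \<and> T' = T"
    by (simp add: trans_PSnd delayed_def)
  \<comment> \<open>After broadcasting the sender sleeps \<open>\<delta> Err\<close> units, and the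
    counter of g is at least that, also after a collision, where the maximum is taken.\<close>
  moreover have "\<delta> Err \<le> fst (upd \<delta> (AOut g Err) \<Gamma> g)" by simp
  ultimately show "a \<noteq> ATau \<and> (T' = SProc (PSnd (CF g) (EVal Err) (loud g)) \<or> (\<exists>k\<le>fst (upd \<delta> a \<Gamma> g). T' = delayed k (loud g)))"
    using T by (auto simp del: upd.simps)
next
  fix k assume k: "k \<le> fst (\<Gamma> g)" "T = delayed k (loud g)"
  show "a \<noteq> ATau \<and> (T' = SProc (PSnd (CF g) (EVal Err) (loud g)) \<or> (\<exists>k\<le>fst (upd \<delta> a \<Gamma> g). T' = delayed k (loud g)))"
  proof (cases k)
    case 0
    with assms(2) k have "a = AOut g Err \<and> T' = delayed (\<delta> Err) (loud g) \<or>
      (\<exists>c v. a = AIn c v) \<and> (T' = delayed 0 (loud g) \<or> T' = SProc (PSnd (CF g) (EVal Err) (loud g)))"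
      by (simp add: delayed_0 trans_loud)
    moreover have "\<delta> Err \<le> fst (upd \<delta> (AOut g Err) \<Gamma> g)" by simp
    ultimately show ?thesis by (auto simp del: upd.simps)
  next
    case (Suc j)
    with assms(2) k have "a = ASig \<and> T' = delayed j (loud g) \<or> (\<exists>c v. a = AIn c v) \<and> T' = delayed (Suc j) (loud g)"
      by (simp only: trans_delayed)
    then show ?thesis
    proof (elim disjE conjE exE)
      assume "a = ASig" "T' = delayed j (loud g)"
      with Suc k show ?thesis by (auto intro!: exI[of _ j])
    next
      fix c v assume "a = AIn c v" "T' = delayed (Suc j) (loud g)"
      moreover have "Suc j \<le> fst (upd \<delta> a \<Gamma> g)" using fst_upd_mono[of a \<Gamma> g \<delta>] Suc k \<open>a = AIn c v\<close> by auto
      ultimately show ?thesis by blast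
    qed
  qed
qed

context cccp
begin

lemma xt_par_tau:
  assumes "xt (\<Gamma>, SPar W T) XTau C'"
  obtains
    (tauL) W' where "C' = (\<Gamma>, SPar W' T)" "tr \<Gamma> W ATau W'"
  | (tauR) T' where "C' = (\<Gamma>, SPar W T')" "tr \<Gamma> T ATau T'"
  | (outL) c v W' T' where "C' = (upd \<delta> (AOut c v) \<Gamma>, SPar W' T')" "tr \<Gamma> W (AOut c v) W'" "tr \<Gamma> T (AIn c v) T'"
  | (outR) c v W' T' where "C' = (upd \<delta> (AOut c v) \<Gamma>, SPar W' T')" "tr \<Gamma> W (AIn c v) W'" "tr \<Gamma> T (AOut c v) T'"
proof -
  obtain \<Gamma>' V where C': "C' = (\<Gamma>', V)" by (cases C')
  from assms consider "\<Gamma>' = \<Gamma>" "tr \<Gamma> (SPar W T) ATau V" | c v where "\<Gamma>' = upd \<delta> (AOut c v) \<Gamma>" "tr \<Gamma> (SPar W T) (AOut c v) V"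
    unfolding C' xt_XTau_iff by blast
  then show thesis
  proof cases
    case 1
    then show thesis unfolding trans_SPar using tauL tauR C' by blast
  next
    case 2
    then show thesis unfolding trans_SPar using outL outR C' by blast
  qed
qed

lemma xt_par_sig:
  assumes "xt (\<Gamma>, SPar W T) XSig C'"
  obtains W' T' where "C' = (upd \<delta> ASig \<Gamma>, SPar W' T')" "tr \<Gamma> W ASig W'" "tr \<Gamma> T ASig T'"
proof -
  obtain \<Gamma>' V where C': "C' = (\<Gamma>', V)" by (cases C')
  from assms show thesis using that unfolding C' xt_XSig_iff trans_SPar by blast
qed

lemma xt_tau_intros:
  "tr \<Gamma> W ATau W' \<Longrightarrow> xt (\<Gamma>, W) XTau (\<Gamma>, W')"
  "tr \<Gamma> W (AOut c v) W' \<Longrightarrow> xt (\<Gamma>, W) XTau (upd \<delta> (AOut c v) \<Gamma>, W')"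
  "tr \<Gamma> W ASig W' \<Longrightarrow> xt (\<Gamma>, W) XSig (upd \<delta> ASig \<Gamma>, W')"
  by (auto intro: ext.TauExt ext.Shh ext.Time simp del: upd.simps)

definition inert :: "('c,'v,'f) sys \<Rightarrow> bool" where
  "inert T \<longleftrightarrow> (\<forall>\<Gamma> a T'. tr \<Gamma> T a T' \<longrightarrow> a = ASig \<or> (\<exists>c v. a = AIn c v) \<and> T' = T)"

lemma inert_zero: "inert (zero k)"
  by (auto simp: inert_def trans_zero)

lemma inert_delayed: "inert (delayed (Suc k) P)"
  by (auto simp: inert_def trans_delayed)

lemma xt_inert_tau:
  assumes "inert T" "xt (\<Gamma>, SPar W T) XTau C'"
  obtains \<Gamma>' W' where "C' = (\<Gamma>', SPar W' T)" "xt (\<Gamma>, W) XTau (\<Gamma>', W')"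
  using assms(2)
proof (cases rule: xt_par_tau)
  case (tauL W')
  then show thesis using that xt_tau_intros by blast
next
  case (outL c v W' T')
  then have "T' = T" using assms(1) unfolding inert_def by blast
  with outL that xt_tau_intros(2)[OF outL(2)] show thesis by blast
qed (use assms(1) in \<open>auto simp: inert_def\<close>)

lemma xt_par_left:
  assumes "xt (\<Gamma>, W) XTau (\<Gamma>', W')" "\<And>c. \<not> rcvS T c"
  shows "xt (\<Gamma>, SPar W T) XTau (\<Gamma>', SPar W' T)"
proof -
  have "tr \<Gamma> T (AIn c v) T" for c v using assms(2) by (intro trans.RcvIgn) (simp add: rcvC_def)
  then show ?thesis using assms(1) unfolding xt_XTau_iff trans_SPar by blast
qed

lemma xt_par_right_tau: "tr \<Gamma> T ATau T' \<Longrightarrow> xt (\<Gamma>, SPar W T) XTau (\<Gamma>, SPar W T')"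
  by (intro xt_tau_intros trans.TauParR)

lemma xt_par_sig_intro: "xt (\<Gamma>, W) XSig (\<Gamma>', W') \<Longrightarrow> tr \<Gamma> T ASig T' \<Longrightarrow> xt (\<Gamma>, SPar W T) XSig (\<Gamma>', SPar W' T')"
  unfolding xt_XSig_iff by (auto intro: trans.TimePar simp del: upd.simps)

lemma run_wtau: "wtau \<delta> I C' C'' \<Longrightarrow> run n C C' \<Longrightarrow> run n C C''"
  unfolding wtau_def by (induct rule: rtranclp_induct) (auto intro: run.intros)

section \<open>Passage of time, and losing or keeping a barb for good\<close>

text \<open>Progress always supplies a step, and instantaneous steps strictly decrease
  \<open>instS\<close>, so a timed step is reached.\<close>

lemma tick:
  assumes "wfc C"
  shows "\<exists>C' C''. wtau \<delta> I C C' \<and> xt C' XSig C''"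
  using assms
proof (induct C rule: measure_induct_rule[of "\<lambda>C. instS (snd C)"])
  case (less C)
  obtain \<Gamma> W where C: "C = (\<Gamma>, W)" by (cases C)
  with less(2) have W: "closedS W" "wf0 \<Gamma> W" by (simp_all add: wfc_def conf_def)
  from progress[OF infinite_channels W] obtain a W' where
    a: "instantaneous a \<or> a = ASig" and t: "tr \<Gamma> W a W'" by blast
  show ?case
  proof (cases "a = ASig")
    case True
    with t xt_tau_intros(3) wtau_refl C show ?thesis by blast
  next
    case False
    with a have "(\<forall>c v. a \<noteq> AIn c v)" by auto
    with trans_instS[OF t \<delta>_pos W(1) False] have "instS W' < instS W" by blast
    moreover have s: "xt C XTau (upd \<delta> a \<Gamma>, W')"
      using a False t xt_tau_intros(1,2) unfolding C by fastforce
    moreover have "wfc (upd \<delta> a \<Gamma>, W')" using s rd_wfc less(2) unfolding rd_iff by blast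
    ultimately obtain C' C'' where "wtau \<delta> I (upd \<delta> a \<Gamma>, W') C'" "xt C' XSig C''"
      using less(1)[of "(upd \<delta> a \<Gamma>, W')"] unfolding C by auto
    with wtau_trans[OF wtau_step[OF wtau_refl s]] show ?thesis by blast
  qed
qed

lemma run_exists: "wfc C \<Longrightarrow> \<exists>C'. run n C C'"
proof (induct n)
  case 0
  show ?case using run_refl by blast
next
  case (Suc n)
  then obtain C' where "run n C C'" by blast
  moreover from rds_wfc[OF run_rds[OF this] Suc(2)] tick obtain D E where "wtau \<delta> I C' D" "xt D XSig E" by blast
  ultimately have "run (Suc n) C E" by (intro run_sig[OF run_wtau])
  then show ?case ..
qed

definition silenceable :: "'c \<Rightarrow> ('c,'v,'f) config \<Rightarrow> bool" where
  "silenceable g C \<longleftrightarrow> (\<exists>C'. rd\<^sup>*\<^sup>* C C' \<and> \<not> wbarb \<delta> I C' g)"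

definition alarmable :: "'c \<Rightarrow> ('c,'v,'f) config \<Rightarrow> bool" where
  "alarmable g C \<longleftrightarrow> (\<exists>C'. rd\<^sup>*\<^sup>* C C' \<and> \<not> silenceable g C')"

lemma rb_silenceable: "rb C D \<Longrightarrow> silenceable g C \<Longrightarrow> silenceable g D"
  unfolding silenceable_def using rb_rds rb_wbarb rb_sym by metis

text \<open>The definition negates \<open>silenceable\<close>, which itself negates a weak barb;
  each negation is transported through the symmetry of \<open>rb\<close>.\<close>

lemma rb_alarmable: "rb C D \<Longrightarrow> alarmable g C \<Longrightarrow> alarmable g D"
  unfolding alarmable_def using rb_rds rb_silenceable rb_sym by metis

lemma silenceable_rds: "rd\<^sup>*\<^sup>* C C' \<Longrightarrow> silenceable g C' \<Longrightarrow> silenceable g C"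
  unfolding silenceable_def by (meson rtranclp_trans)

lemma alarmable_rds: "rd\<^sup>*\<^sup>* C C' \<Longrightarrow> alarmable g C' \<Longrightarrow> alarmable g C"
  unfolding alarmable_def by (meson rtranclp_trans)

lemma xt_rds: "xt C XTau C' \<Longrightarrow> rd\<^sup>*\<^sup>* C C'" "xt C XSig C' \<Longrightarrow> rd\<^sup>*\<^sup>* C C'"
  by (auto simp: rd_iff)

lemma noisy_rd:
  assumes "rd (\<Gamma>, SPar W T) C'" "noisy g \<Gamma> T"
  shows "\<exists>\<Gamma>' W' T'. C' = (\<Gamma>', SPar W' T') \<and> noisy g \<Gamma>' T'"
  using assms(1) unfolding rd_iff
proof
  assume "xt (\<Gamma>, SPar W T) XTau C'"
  then show ?thesis
  proof (cases rule: xt_par_tau)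
    case (tauR T')
    with trans_noisy[OF assms(2)] show ?thesis by blast
  next
    case (outL c v W' T')
    with trans_noisy[OF assms(2) outL(3)] show ?thesis by auto
  next
    case (outR c v W' T')
    with trans_noisy[OF assms(2) outR(3)] show ?thesis by blast
  qed (use assms(2) in blast)
next
  assume "xt (\<Gamma>, SPar W T) XSig C'"
  then show ?thesis
    by (cases rule: xt_par_sig) (use trans_noisy[OF assms(2)] in blast)
qed

lemma noisy_wbarb:
  fixes g :: 'c
  assumes "noisy g \<Gamma> T" "closedS W"
  shows "wbarb \<delta> I (\<Gamma>, SPar W T) g"
proof (cases "exposed \<Gamma> g")
  case True
  then show ?thesis unfolding wbarb_def barb_def by (metis fst_conv rtranclp.rtrancl_refl)
next
  case False
  \<comment> \<open>While g is idle the invariant forces a sleep of length 0, so the component can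
    broadcast immediately.\<close>
  then have "T = SProc (PSnd (CF g) (EVal Err) (loud g)) \<or> T = SProc (loud g)"
    using assms(1) by (auto simp: noisy_def exposed_def delayed_0)
  then have "\<exists>T'. tr \<Gamma> T (AOut g Err) T'"
    by (auto simp: trans_loud trans_PSnd)
  then obtain T' where "tr \<Gamma> T (AOut g Err) T'" ..
  moreover obtain W' where "tr \<Gamma> W (AIn g Err) W'" using input_enabled[OF infinite_channels assms(2)] by blast
  ultimately have "tr \<Gamma> (SPar W T) (AOut g Err) (SPar W' T')" by (intro trans.SyncR)
  from xt_tau_intros(2)[OF this] have "rd\<^sup>*\<^sup>* (\<Gamma>, SPar W T) (upd \<delta> (AOut g Err) \<Gamma>, SPar W' T')" by (rule xt_rds)
  moreover have "exposed (upd \<delta> (AOut g Err) \<Gamma>) g" using \<delta>_pos[rule_format, of Err] by (simp add: exposed_def max_def)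
  ultimately show ?thesis unfolding wbarb_def barb_def by (metis fst_conv)
qed

lemma noisy_rds:
  "rd\<^sup>*\<^sup>* C C' \<Longrightarrow> C = (\<Gamma>, SPar W T) \<Longrightarrow> noisy g \<Gamma> T \<Longrightarrow> conf C \<Longrightarrow>
    (\<exists>\<Gamma>' W' T'. C' = (\<Gamma>', SPar W' T') \<and> noisy g \<Gamma>' T') \<and> conf C'"
proof (induct rule: rtranclp_induct)
  case (step C' C'')
  then obtain \<Gamma>' W' T' where *: "C' = (\<Gamma>', SPar W' T')" "noisy g \<Gamma>' T'" "conf C'" by blast
  with noisy_rd step(2) have "\<exists>\<Gamma>' W' T'. C'' = (\<Gamma>', SPar W' T') \<and> noisy g \<Gamma>' T'" by blast
  moreover have "conf C''" using * step(2) rd_closedS by (cases C'') (auto simp: conf_def)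
  ultimately show ?case by blast
qed blast

lemma noisy_not_silenceable:
  assumes "noisy g \<Gamma> T" "conf (\<Gamma>, SPar W T)"
  shows "\<not> silenceable g (\<Gamma>, SPar W T)"
proof
  assume "silenceable g (\<Gamma>, SPar W T)"
  then obtain C' where C': "rd\<^sup>*\<^sup>* (\<Gamma>, SPar W T) C'" "\<not> wbarb \<delta> I C' g" unfolding silenceable_def by blast
  from noisy_rds[OF C'(1) refl assms] obtain \<Gamma>' W' T' where
    "C' = (\<Gamma>', SPar W' T')" "noisy g \<Gamma>' T'" "conf C'" by blast
  with noisy_wbarb C'(2) show False by (simp add: conf_def)
qed

lemma noisy_alarmable:
  assumes "noisy g \<Gamma> T" "conf (\<Gamma>, SPar W T)"
  shows "alarmable g (\<Gamma>, SPar W T)"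
  using noisy_not_silenceable[OF assms] unfolding alarmable_def by blast

text \<open>Either disjunct lets g become idle for good: at once, or because time can always pass in a
  well-formed configuration.\<close>
definition muffled :: "'c \<Rightarrow> ('c,'v,'f) config \<Rightarrow> bool" where
  "muffled g C \<longleftrightarrow> conf C \<and> g \<notin> fcS (snd C) \<and> (idle (fst C) g \<or> wfc C)"

lemma muffled_rds:
  assumes "rd\<^sup>*\<^sup>* C C'" "muffled g C" shows "muffled g C'"
proof -
  obtain n where r: "run n C C'" using rds_run[OF assms(1)] ..
  have "conf C'" using assms(1)
  proof (induct rule: rtranclp_induct)
    case base then show ?case using assms(2) by (simp add: muffled_def)
  next
    case (step D E)
    then show ?case by (cases D; cases E) (auto simp: conf_def intro: rd_closedS)
  qed
  with run_fresh[OF r] assms(2) rds_wfc[OF assms(1)] show ?thesis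
    by (auto simp: muffled_def idle_def)
qed

lemma muffled_silenceable:
  assumes "muffled g C" shows "silenceable g C"
proof (cases "idle (fst C) g")
  case True
  then have "\<not> wbarb \<delta> I C g"
    using wbarb_fresh[of "fst C" "snd C" g] assms by (auto simp: muffled_def idle_def exposed_def)
  then show ?thesis unfolding silenceable_def by blast
next
  case False
  with assms have "wfc C" by (simp add: muffled_def)
  \<comment> \<open>Wait exactly as long as g stays exposed; being fresh, it cannot be exposed
    again.\<close>
  from run_exists[OF this, of "fst (fst C g)"] obtain C' where r: "run (fst (fst C g)) C C'" ..
  have "g \<notin> fcS (snd C')" "fst (fst C' g) = 0"
    using run_fresh[OF r] assms by (auto simp: muffled_def)
  then have "\<not> wbarb \<delta> I C' g"
    using wbarb_fresh[of "fst C'" "snd C'" g] by (auto simp: exposed_def)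
  with run_rds[OF r] show ?thesis unfolding silenceable_def by blast
qed

lemma muffled_not_alarmable: "muffled g C \<Longrightarrow> \<not> alarmable g C"
  unfolding alarmable_def using muffled_rds muffled_silenceable by blast

lemma muffled_zero: "muffled g (\<Gamma>, W) \<Longrightarrow> muffled g (\<Gamma>, SPar W (zero k))"
  by (auto simp: muffled_def conf_def wfc_SPar zero_def wfc_SProc closedS_def)

lemma choice_alarmable:
  assumes "closedS W" shows "alarmable g (\<Gamma>, SPar W (SProc (choice g)))"
proof -
  have "xt (\<Gamma>, SPar W (SProc (choice g))) XTau (\<Gamma>, SPar W (SProc (loud g)))"
    by (intro xt_par_right_tau) (simp add: trans_choice)
  moreover have "alarmable g (\<Gamma>, SPar W (SProc (loud g)))"
    using assms by (intro noisy_alarmable noisy_loud) (simp add: conf_def)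
  ultimately show ?thesis using alarmable_rds xt_rds by blast
qed

lemma xt_choice_zero: "xt (\<Gamma>, SPar W (SProc (choice g))) XTau (\<Gamma>, SPar W (zero 0))"
  by (intro xt_par_right_tau) (simp add: trans_choice)

lemma choice_silenceable:
  assumes "muffled g (\<Gamma>, W)" shows "silenceable g (\<Gamma>, SPar W (SProc (choice g)))"
  using xt_choice_zero muffled_silenceable[OF muffled_zero[OF assms]] silenceable_rds xt_rds by blast

text \<open>While the test waits or is silent it sends nothing and ignores every input, so the left
  component performs a run of its own of the same length. Here \<open>n \<le> k\<close> holds while
  waiting, because the undelayed \<open>choice\<close> refuses time. Once the test is loud the left
  run is no longer tracked; this outcome is excluded wherever the lemma is applied.\<close>

lemma track_choice:
  assumes "run n C C'" "C = (\<Gamma>, SPar W (delayed k (choice g)))"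
  shows "\<exists>\<Gamma>' W' T'. C' = (\<Gamma>', SPar W' T') \<and>
    (n \<le> k \<and> T' = delayed (k - n) (choice g) \<and> run n (\<Gamma>, W) (\<Gamma>', W') \<or>
     (\<exists>j. T' = zero j) \<and> run n (\<Gamma>, W) (\<Gamma>', W') \<or> noisy g \<Gamma>' T')"
    (is "?P n C'")
proof -
  have waiting: "?P n (\<Gamma>', SPar W' (delayed (k - n) (choice g)))"
    if "n \<le> k" "run n (\<Gamma>, W) (\<Gamma>', W')" for n \<Gamma>' W'
    using that by simp
  have silent: "?P n (\<Gamma>', SPar W' (zero j))" if "run n (\<Gamma>, W) (\<Gamma>', W')" for n \<Gamma>' W' j
    using that by auto
  have noise: "?P n (\<Gamma>', SPar W' T')" if "noisy g \<Gamma>' T'" for n \<Gamma>' W' T'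
    using that by simp
  from assms show ?thesis
  proof (induct rule: run.induct)
    case (run_refl C)
    then show ?case using waiting[of 0 \<Gamma> W] run.run_refl by simp
  next
    case (run_tau n C C' C'')
    then obtain \<Gamma>' W' T' where C': "C' = (\<Gamma>', SPar W' T')" and
      st: "n \<le> k \<and> T' = delayed (k - n) (choice g) \<and> run n (\<Gamma>, W) (\<Gamma>', W') \<or>
       (\<exists>j. T' = zero j) \<and> run n (\<Gamma>, W) (\<Gamma>', W') \<or> noisy g \<Gamma>' T'" by blast
    note step = run_tau(3)[unfolded C']
    from st show ?case
    proof (elim disjE conjE exE)
      assume T': "n \<le> k" "T' = delayed (k - n) (choice g)" and r: "run n (\<Gamma>, W) (\<Gamma>', W')"
      show ?thesis
      proof (cases "k - n")
        case 0
        with T' have T'': "T' = SProc (choice g)" by (simp add: delayed_0)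
        from step[unfolded T''] show ?thesis
        proof (cases rule: xt_par_tau)
          case (tauL V)
          from waiting[OF T'(1) run.run_tau[OF r xt_tau_intros(1)[OF tauL(2)]]] show ?thesis
            by (simp only: tauL T'(2)[symmetric] T''[symmetric])
        next
          case (tauR V)
          then have "V = zero 0 \<or> V = SProc (loud g)" by (simp add: trans_choice)
          then show ?thesis 
          proof
            assume "V = zero 0"
            with silent[OF r, of 0] show ?thesis by (simp only: tauR(1))
          next
            assume "V = SProc (loud g)"
            with noise[OF noisy_loud] show ?thesis by (simp only: tauR(1))
          qed
        next
          case (outL c v V V')
          then have "V' = SProc (choice g)" by (simp add: trans_choice)
          with waiting[OF T'(1) run.run_tau[OF r xt_tau_intros(2)[OF outL(2)]]] show ?thesis
            by (simp only: outL T'(2)[symmetric] T''[symmetric])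
        next
          case (outR c v V V')
          then show ?thesis by (simp add: trans_choice)
        qed
      next
        case (Suc i)
        with T' have "inert T'" using inert_delayed by simp
        from xt_inert_tau[OF this step] obtain \<Gamma>'' V where
          "C'' = (\<Gamma>'', SPar V T')" "xt (\<Gamma>', W') XTau (\<Gamma>'', V)" .
        with waiting[OF T'(1) run.run_tau[OF r this(2)]] show ?thesis by (simp only: T'(2))
      qed
    next
      fix j assume T': "T' = zero j" and r: "run n (\<Gamma>, W) (\<Gamma>', W')"
      then have "inert T'" using inert_zero by simp
      from xt_inert_tau[OF this step] obtain \<Gamma>'' V where
        "C'' = (\<Gamma>'', SPar V T')" "xt (\<Gamma>', W') XTau (\<Gamma>'', V)" .
      with silent[OF run.run_tau[OF r this(2)]] show ?thesis by (simp only: T')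
    next
      assume "noisy g \<Gamma>' T'"
      with noisy_rd[of \<Gamma>' W' T' C''] step obtain \<Gamma>'' W'' T'' where
        "C'' = (\<Gamma>'', SPar W'' T'')" "noisy g \<Gamma>'' T''" unfolding rd_iff by blast
      with noise[OF this(2)] show ?thesis by (simp only:)
    qed
  next
    case (run_sig n C C' C'')
    then obtain \<Gamma>' W' T' where C': "C' = (\<Gamma>', SPar W' T')" and
      st: "n \<le> k \<and> T' = delayed (k - n) (choice g) \<and> run n (\<Gamma>, W) (\<Gamma>', W') \<or>
       (\<exists>j. T' = zero j) \<and> run n (\<Gamma>, W) (\<Gamma>', W') \<or> noisy g \<Gamma>' T'" by blast
    note step = run_sig(3)[unfolded C']
    from step obtain V V' where C'': "C'' = (upd \<delta> ASig \<Gamma>', SPar V V')"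
      and V: "tr \<Gamma>' W' ASig V" and V': "tr \<Gamma>' T' ASig V'" by (rule xt_par_sig)
    from st show ?case
    proof (elim disjE conjE exE)
      assume T': "n \<le> k" "T' = delayed (k - n) (choice g)" and r: "run n (\<Gamma>, W) (\<Gamma>', W')"
      show ?thesis
      proof (cases "k - n")
        case 0
        with T' V' show ?thesis by (simp add: delayed_0 trans_choice)
      next
        case (Suc i)
        with T' V' have "V' = delayed i (choice g)" by (simp add: trans_delayed)
        moreover have "k - Suc n = i" "Suc n \<le> k" using Suc by auto
        ultimately show ?thesis using waiting[OF _ run.run_sig[OF r xt_tau_intros(3)[OF V]]] C'' by (simp only:)
      qed
    next
      fix j assume T': "T' = zero j" and r: "run n (\<Gamma>, W) (\<Gamma>', W')"
      with V' have "V' = zero (j - 1)" by (auto simp: trans_zero)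
      with silent[OF run.run_sig[OF r xt_tau_intros(3)[OF V]]] show ?thesis by (simp only: C'')
    next
      assume "noisy g \<Gamma>' T'"
      with noisy_rd[of \<Gamma>' W' T' C''] step obtain \<Gamma>'' W'' T'' where
        "C'' = (\<Gamma>'', SPar W'' T'')" "noisy g \<Gamma>'' T''" unfolding rd_iff by blast
      with noise[OF this(2)] show ?thesis by (simp only:)
    qed
  qed
qed

text \<open>An unresolved choice is both silenceable and alarmable, a silent remainder is not
  alarmable, and a loud one is not silenceable. So the choice is still unresolved in D, which bounds
  the elapsed time by \<open>k\<close>.\<close>

lemma match_choice:
  assumes rb: "rb (\<Gamma>1, SPar W1 (SProc (choice g))) D" and "muffled g (\<Gamma>1, W1)"
    and r: "run n (\<Gamma>2, SPar W2 (delayed k (choice g))) D" and m: "muffled g (\<Gamma>2, W2)"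
  obtains \<Gamma>' W' where "D = (\<Gamma>', SPar W' (delayed (k - n) (choice g)))" "n \<le> k" "run n (\<Gamma>2, W2) (\<Gamma>', W')"
proof -
  have D: "silenceable g D" "alarmable g D" "conf D"
    using rb_silenceable[OF rb choice_silenceable[OF assms(2)]] rb_alarmable[OF rb choice_alarmable]
      assms(2) rb_conf[OF rb] by (auto simp: muffled_def conf_def)
  from track_choice[OF r refl] obtain \<Gamma>' W' T' where D': "D = (\<Gamma>', SPar W' T')" and
    "n \<le> k \<and> T' = delayed (k - n) (choice g) \<and> run n (\<Gamma>2, W2) (\<Gamma>', W') \<or>
     (\<exists>j. T' = zero j) \<and> run n (\<Gamma>2, W2) (\<Gamma>', W') \<or> noisy g \<Gamma>' T'" by blast
  then show thesis
  proof (elim disjE conjE exE)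
    fix j assume "T' = zero j" "run n (\<Gamma>2, W2) (\<Gamma>', W')"
    then have "\<not> alarmable g D"
      unfolding D' using muffled_not_alarmable muffled_zero muffled_rds run_rds m by blast
    with D show thesis by blast
  next
    assume "noisy g \<Gamma>' T'"
    with noisy_not_silenceable D D' show thesis by blast
  qed (use that D' in blast)
qed

text \<open>Failing to be alarmable excludes both other outcomes: an unresolved choice can still
  become loud.\<close>

lemma match_zero:
  assumes rb: "rb (\<Gamma>1, SPar W1 (zero i)) D" and "muffled g (\<Gamma>1, W1)"
    and r: "run n (\<Gamma>2, SPar W2 (SProc (choice g))) D"
  obtains \<Gamma>' W' j where "D = (\<Gamma>', SPar W' (zero j))" "run n (\<Gamma>2, W2) (\<Gamma>', W')"
proof -
  have D: "\<not> alarmable g D" "conf D"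
    using rb_alarmable[OF rb_sym[OF rb]] muffled_not_alarmable[OF muffled_zero[OF assms(2)]] rb_conf[OF rb] by blast+
  from track_choice[OF r, of _ _ 0 g] obtain \<Gamma>' W' T' where D': "D = (\<Gamma>', SPar W' T')" and
    "T' = delayed 0 (choice g) \<or>
     (\<exists>j. T' = zero j) \<and> run n (\<Gamma>2, W2) (\<Gamma>', W') \<or> noisy g \<Gamma>' T'" by (auto simp: delayed_0)
  then show thesis
  proof (elim disjE conjE exE)
    assume "T' = delayed 0 (choice g)"
    with choice_alarmable[of W' g \<Gamma>'] D show thesis unfolding D' by (simp add: delayed_0 conf_def)
  next
    assume "noisy g \<Gamma>' T'"
    with noisy_alarmable D D' show thesis by blast
  qed (use that D' in blast)
qed

end

section \<open>Matching extensional actions\<close>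

context cccp
begin

lemma rcvS_delayed: "(\<And>c. \<not> rcvP Q c) \<Longrightarrow> \<not> rcvS (delayed j Q) c"
  by (cases j) (auto simp: delayed_def)

section \<open>Fresh exposed channels as clocks\<close>

lemma run_delayed:
  assumes "run n C C'" "\<And>c. \<not> rcvP Q c"
  shows "run n (fst C, SPar (snd C) (delayed (n + j) Q)) (fst C', SPar (snd C') (delayed j Q))"
  using assms(1)
proof (induct arbitrary: j rule: run.induct)
  case (run_refl C)
  show ?case by (simp add: run.run_refl)
next
  case (run_tau n C C' C'')
  have "xt (fst C', snd C') XTau (fst C'', snd C'')" using run_tau(3) by simp
  from xt_par_left[OF this rcvS_delayed[OF assms(2)]] run_tau(2)[of j] show ?case
    by (rule run.run_tau[rotated])
next
  case (run_sig n C C' C'')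
  have "xt (fst C', snd C') XSig (fst C'', snd C'')" using run_sig(3) by simp
  then have "xt (fst C', SPar (snd C') (delayed (Suc j) Q)) XSig (fst C'', SPar (snd C'') (delayed j Q))"
    by (rule xt_par_sig_intro) (simp add: trans_delayed)
  from run.run_sig[OF run_sig(2) this] show ?case by simp
qed

lemma muffled_wfc: "wfc (\<Gamma>, W) \<Longrightarrow> g \<notin> fcS W \<Longrightarrow> muffled g (\<Gamma>, W)"
  by (simp add: muffled_def wfc_def)

lemma exposed_iff: "exposed \<Gamma> c \<longleftrightarrow> \<not> idle \<Gamma> c"
  by (simp add: exposed_def idle_def)

text \<open>The context waits exactly as long as f is exposed on the left and then blocks time; were f exposed
  longer on the right, time could only pass there after the choice has been resolved.\<close>
lemma count_le:
  assumes rb: "rb (\<Gamma>1, W1) (\<Gamma>2, W2)" and wf: "wfc (\<Gamma>1, W1)" "wfc (\<Gamma>2, W2)"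
    and f: "f \<notin> fcS W1" "f \<notin> fcS W2"
  shows "fst (\<Gamma>2 f) \<le> fst (\<Gamma>1 f)"
proof -
  define k where "k = fst (\<Gamma>1 f)"
  have "finite (insert f (fcS W1 \<union> fcS W2))" by (simp add: finite_fcS)
  from fresh[OF this] obtain g where g: "g \<noteq> f" "g \<notin> fcS W1" "g \<notin> fcS W2" by auto
  let ?T = "delayed k (choice g)"
  from run_exists[OF wf(1)] obtain \<Gamma>1' W1' where r1: "run k (\<Gamma>1, W1) (\<Gamma>1', W1')" by (metis surj_pair)
  have "run k (\<Gamma>1, SPar W1 ?T) (\<Gamma>1', SPar W1' (SProc (choice g)))"
    using run_delayed[OF r1, of "choice g" 0] by (simp add: delayed_0)
  from rb_rds[OF run_rds[OF this] rb_ctx[OF rb]] obtain D where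
    D: "rd\<^sup>*\<^sup>* (\<Gamma>2, SPar W2 ?T) D" "rb (\<Gamma>1', SPar W1' (SProc (choice g))) D" by auto
  from rds_run[OF D(1)] obtain n where n: "run n (\<Gamma>2, SPar W2 ?T) D" ..
  have m1: "muffled g (\<Gamma>1', W1')" using muffled_rds[OF run_rds[OF r1]] muffled_wfc wf(1) g(2) by blast
  from match_choice[OF D(2) m1 n muffled_wfc[OF wf(2) g(3)]] obtain \<Gamma>' W' where
    D': "D = (\<Gamma>', SPar W' (delayed (k - n) (choice g)))" "n \<le> k" "run n (\<Gamma>2, W2) (\<Gamma>', W')" .
  have f1: "f \<notin> fcS W1'" "fst (\<Gamma>1' f) = 0" using run_fresh[OF r1] f(1) by (auto simp: k_def)
  have f2: "fst (\<Gamma>' f) = fst (\<Gamma>2 f) - n" using run_fresh[OF D'(3)] f(2) by simp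
  have "\<not> wbarb \<delta> I (\<Gamma>1', SPar W1' (SProc (choice g))) f"
    using wbarb_fresh[of \<Gamma>1' "SPar W1' (SProc (choice g))" f] f1 g by (auto simp: exposed_def)
  then have "\<not> wbarb \<delta> I D f" using rb_wbarb[OF rb_sym[OF D(2)]] by blast
  then have "\<not> barb D f" unfolding wbarb_def by blast
  \<comment> \<open>The initial count on the right, reduced by n with truncation, is 0; so it is at
    most n, hence at most \<open>k\<close>.\<close>
  then have "fst (\<Gamma>' f) = 0" by (simp add: D' barb_def exposed_def)
  with f2 D'(2) show ?thesis by (simp add: k_def)
qed

lemma count_eq:
  assumes "rb (\<Gamma>1, W1) (\<Gamma>2, W2)" "wfc (\<Gamma>1, W1)" "wfc (\<Gamma>2, W2)" "f \<notin> fcS W1" "f \<notin> fcS W2"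
  shows "fst (\<Gamma>1 f) = fst (\<Gamma>2 f)"
  using count_le[OF assms] count_le[OF rb_sym[OF assms(1)] assms(3,2,5,4)] by simp

text \<open>When all but finitely many channels are idle, congruence next to a choice process already implies
  congruence. This needs no well-formedness, since the contexts that reduction barbed congruence
  quantifies over may be ill-formed.\<close>
definition shield :: "'c \<Rightarrow> ('c,'v,'f) config \<Rightarrow> bool" where
  "shield g C \<longleftrightarrow> conf C \<and> g \<notin> fcS (snd C) \<and> idle (fst C) g \<and> finite {f. exposed (fst C) f}"

abbreviation with_choice :: "'c \<Rightarrow> ('c,'v,'f) config \<Rightarrow> ('c,'v,'f) config" where
  "with_choice g C \<equiv> (fst C, SPar (snd C) (SProc (choice g)))"

definition shielded :: "('c,'v,'f) config \<Rightarrow> ('c,'v,'f) config \<Rightarrow> bool" where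
  "shielded C D \<longleftrightarrow> (\<exists>g. shield g C \<and> shield g D \<and> rb (with_choice g C) (with_choice g D))"

lemma shield_muffled: "shield g C \<Longrightarrow> muffled g C"
  by (simp add: shield_def muffled_def)

lemma shield_rds:
  assumes "rd\<^sup>*\<^sup>* C C'" "shield g C" shows "shield g C'"
proof -
  obtain n where r: "run n C C'" using rds_run[OF assms(1)] ..
  have "conf C'" using muffled_rds[OF assms(1) shield_muffled[OF assms(2)]] by (simp add: muffled_def)
  \<comment> \<open>Only the finitely many channels that the system mentions can become newly
    exposed.\<close>
  moreover have "{f. exposed (fst C') f} \<subseteq> {f. exposed (fst C) f} \<union> fcS (snd C)"
    using run_fresh[OF r] by (auto simp: exposed_def)
  then have "finite {f. exposed (fst C') f}"
    by (rule finite_subset) (use assms(2) in \<open>simp add: shield_def finite_fcS\<close>)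
  ultimately show ?thesis using run_fresh[OF r, of g] assms(2) by (simp add: shield_def idle_def)
qed

text \<open>Resolving the choice silently on the left forces a silent remainder on the right, and
  the two are cancelled. This answer may take time, so C is related only to some derivative of
  D.\<close>

lemma shielded_drop:
  assumes "shielded C D" shows "\<exists>D'. rd\<^sup>*\<^sup>* D D' \<and> rb C D'"
proof -
  from assms obtain g where g: "shield g C" "shield g D" "rb (with_choice g C) (with_choice g D)"
    unfolding shielded_def by blast
  have "rd (with_choice g C) (fst C, SPar (snd C) (zero 0))" using xt_choice_zero rd_iff by blast
  from rb_rd[OF g(3) this] obtain E where E: "rd\<^sup>*\<^sup>* (with_choice g D) E" "rb (fst C, SPar (snd C) (zero 0)) E" by blast
  from rds_run[OF E(1)] obtain n where n: "run n (with_choice g D) E" ..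
  have "muffled g (fst C, snd C)" using shield_muffled[OF g(1)] by simp
  from match_zero[OF E(2) this n] obtain \<Gamma>' W' j where
    "E = (\<Gamma>', SPar W' (zero j))" "run n (fst D, snd D) (\<Gamma>', W')" .
  then have "rd\<^sup>*\<^sup>* D (\<Gamma>', W')" "rb C (\<Gamma>', W')"
    using rb_cancel[of "fst C" "snd C" 0 \<Gamma>' W' j] E(2) run_rds[of n D] by simp_all
  then show ?thesis by blast
qed

text \<open>The choice has no delay in front of it, so the time bound of \<open>match_choice\<close>
  is 0.\<close>

lemma shielded_tau:
  assumes "shielded C D" "xt C XTau C'" shows "\<exists>D'. wtau \<delta> I D D' \<and> shielded C' D'"
proof -
  from assms obtain g where g: "shield g C" "shield g D" "rb (with_choice g C) (with_choice g D)"
    unfolding shielded_def by blast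
  have "xt (fst C, snd C) XTau (fst C', snd C')" using assms(2) by simp
  from xt_par_left[OF this, of "SProc (choice g)"] have "rd (with_choice g C) (with_choice g C')"
    unfolding rd_iff by simp
  from rb_rd[OF g(3) this] obtain E where E: "rd\<^sup>*\<^sup>* (with_choice g D) E" "rb (with_choice g C') E" by blast
  from rds_run[OF E(1)] obtain n where n: "run n (fst D, SPar (snd D) (delayed 0 (choice g))) E" unfolding delayed_0 ..
  have C': "shield g C'" using shield_rds[OF xt_rds(1)[OF assms(2)] g(1)] .
  have m: "muffled g (fst C', snd C')" "muffled g (fst D, snd D)" using shield_muffled[OF C'] shield_muffled[OF g(2)] by simp_all
  from match_choice[OF E(2) m(1) n m(2)] obtain \<Gamma>' W' where
    E': "E = (\<Gamma>', SPar W' (delayed (0 - n) (choice g)))" "n \<le> 0" "run n (fst D, snd D) (\<Gamma>', W')" .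
  then have r: "wtau \<delta> I D (\<Gamma>', W')" using run_0_wtau by simp
  have "shielded C' (\<Gamma>', W')"
    unfolding shielded_def using C' shield_rds[OF wtau_rds[OF r] g(2)] E(2) E' by (auto simp: delayed_0)
  with r show ?thesis by blast
qed

text \<open>A context that mentions g is first renamed to use another idle channel h instead; swapping g and h
  afterwards restores the context and turns the shield g into h.\<close>
lemma shielded_ctx:
  assumes "shielded (\<Gamma>1, W1) (\<Gamma>2, W2)" "closedS W"
  shows "shielded (\<Gamma>1, SPar W1 W) (\<Gamma>2, SPar W2 W)"
proof -
  from assms obtain g where g: "shield g (\<Gamma>1, W1)" "shield g (\<Gamma>2, W2)"
    "rb (\<Gamma>1, SPar W1 (SProc (choice g))) (\<Gamma>2, SPar W2 (SProc (choice g)))"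
    unfolding shielded_def by auto
  have "finite (insert g (fcS W1 \<union> fcS W2 \<union> fcS W \<union> {f. exposed \<Gamma>1 f} \<union> {f. exposed \<Gamma>2 f}))"
    using g by (simp add: finite_fcS shield_def)
  from fresh[OF this] obtain h where h: "h \<noteq> g" "h \<notin> fcS W1" "h \<notin> fcS W2" "h \<notin> fcS W" "idle \<Gamma>1 h" "idle \<Gamma>2 h"
    by (auto simp: exposed_def idle_def)
  let ?\<pi> = "id(g := h, h := g)"
  have "renS ?\<pi> W1 = W1" "renS ?\<pi> W2 = W2" using g h by (auto intro!: renS_id simp: shield_def)
  moreover have "renS ?\<pi> (renS ?\<pi> W) = W" by (rule renS_invol) (auto simp: fun_eq_iff)
  moreover have "renS ?\<pi> (SProc (choice g) :: ('c,'v,'f) sys) = SProc (choice h)" using h by (simp add: choice_def loud_def)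
  moreover have "rb (\<Gamma>1, SPar (SPar W1 (SProc (choice g))) (renS ?\<pi> W)) (\<Gamma>2, SPar (SPar W2 (SProc (choice g))) (renS ?\<pi> W))"
    using rb_ctx[OF g(3)] assms(2) by simp
  from rb_swap[OF this, of g h] have "rb (\<Gamma>1, SPar (SPar (renS ?\<pi> W1) (renS ?\<pi> (SProc (choice g)))) (renS ?\<pi> (renS ?\<pi> W)))
    (\<Gamma>2, SPar (SPar (renS ?\<pi> W2) (renS ?\<pi> (SProc (choice g)))) (renS ?\<pi> (renS ?\<pi> W)))"
    using g h unfolding renS_simps(3) by (simp add: shield_def)
  ultimately have "rb (\<Gamma>1, SPar (SPar W1 (SProc (choice h))) W) (\<Gamma>2, SPar (SPar W2 (SProc (choice h))) W)"
    by (simp only:)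
  then have "rb (\<Gamma>1, SPar (SPar W1 W) (SProc (choice h))) (\<Gamma>2, SPar (SPar W2 W) (SProc (choice h)))"
    by (rule rb_exch)
  moreover have "shield h (\<Gamma>1, SPar W1 W)" "shield h (\<Gamma>2, SPar W2 W)"
    using g h assms(2) by (simp_all add: shield_def conf_def)
  ultimately show ?thesis unfolding shielded_def by auto
qed

lemma shielded_rb:
  assumes "shielded C D" shows "rb C D"
proof (rule rb_I[where R = shielded])
  fix C D assume R: "shielded C D"
  show "conf C \<and> conf D" using R by (auto simp: shielded_def shield_def)
  show "shielded D C" using R rb_sym unfolding shielded_def by blast
  from shielded_drop[OF R] obtain D' where D': "rd\<^sup>*\<^sup>* D D'" "rb C D'" by blast
  show "wbarb \<delta> I D c" if "wbarb \<delta> I C c" for c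
    using rb_wbarb[OF D'(2) that] D'(1) unfolding wbarb_def by (meson rtranclp_trans)
  show "\<exists>D'. rd\<^sup>*\<^sup>* D D' \<and> shielded C' D'" if "rd C C'" for C'
  proof (cases "xt C XTau C'")
    case True
    from shielded_tau[OF R True] show ?thesis using wtau_rds by blast
  next
    case False
    with that have "xt C XSig C'" by (simp add: rd_iff)
    \<comment> \<open>A timed step is impossible next to \<open>choice\<close>. It is answered from
      \<open>D'\<close>, where the choice has been dropped, and contextuality puts the choice back
      afterwards.\<close>
    from rb_rd[OF D'(2) that] obtain E where E: "rd\<^sup>*\<^sup>* D' E" "rb C' E" by blast
    from R obtain g where g: "shield g C" "shield g D" unfolding shielded_def by blast
    have DE: "rd\<^sup>*\<^sup>* D E" using D'(1) E(1) by (rule rtranclp_trans)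
    have "rb (with_choice g C') (with_choice g E)" using rb_ctx[of "fst C'" "snd C'" "fst E" "snd E"] E(2) by simp
    then have "shielded C' E" unfolding shielded_def
      using shield_rds[OF DE g(2)] shield_rds[OF xt_rds(2)[OF \<open>xt C XSig C'\<close>] g(1)] by blast
    with DE show ?thesis by blast
  qed
qed (use assms shielded_ctx in auto)

section \<open>Matching reductions together with their duration\<close>

lemma tau_match:
  assumes rb: "rb C D" and wf: "wfc C" "wfc D" and t: "xt C XTau C'"
  shows "\<exists>D'. wtau \<delta> I D D' \<and> rb C' D'"
proof (cases "\<exists>f. f \<notin> fcS (snd C) \<and> f \<notin> fcS (snd D) \<and> exposed (fst C) f")
  case True
  then obtain f where f: "f \<notin> fcS (snd C)" "f \<notin> fcS (snd D)" "fst (fst C f) > 0" by (auto simp: exposed_def)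
  from rb_rd[OF rb] t obtain D' where D': "rd\<^sup>*\<^sup>* D D'" "rb C' D'" unfolding rd_iff by blast
  from rds_run[OF D'(1)] obtain n where n: "run n D D'" ..
  note rC = run_fresh[OF run_tau[OF run_refl t] f(1)] and rD = run_fresh[OF n f(2)]
  have "fst (fst C f) = fst (fst D f)"
    by (rule count_eq[of _ "snd C" _ "snd D"]) (use rb wf f in simp_all)
  moreover have "fst (fst C' f) = fst (fst D' f)"
    by (rule count_eq[of _ "snd C'" _ "snd D'"])
      (use D' rC rD rds_wfc[OF xt_rds(1)[OF t] wf(1)] rds_wfc[OF D'(1) wf(2)] in simp_all)
  \<comment> \<open>Both clocks agree before and after, and the left one has not moved. Since it is
    positive, truncation cannot hide elapsed time on the right.\<close>
  ultimately have "n = 0" using rC rD f(3) by auto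
  with n D' run_0_wtau show ?thesis by blast
next
  case False
  then have idC: "idle (fst C) f" if "f \<notin> fcS (snd C)" "f \<notin> fcS (snd D)" for f
    using that by (auto simp: exposed_def idle_def)
  have idD: "idle (fst D) f" if "f \<notin> fcS (snd C)" "f \<notin> fcS (snd D)" for f
    using idC[OF that] count_eq[of "fst C" "snd C" "fst D" "snd D" f] rb wf that by (simp add: idle_def)
  have fin: "finite (fcS (snd C) \<union> fcS (snd D))" by (simp add: finite_fcS)
  from fresh[OF this] obtain g where g: "g \<notin> fcS (snd C)" "g \<notin> fcS (snd D)" by auto
  have "{f. exposed (fst C) f} \<subseteq> fcS (snd C) \<union> fcS (snd D)" "{f. exposed (fst D) f} \<subseteq> fcS (snd C) \<union> fcS (snd D)"
    using idC idD unfolding exposed_iff by blast+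
  then have "shield g C" "shield g D"
    using g idC[OF g] idD[OF g] rb_conf[OF rb] finite_subset[OF _ fin] by (simp_all add: shield_def)
  moreover have "rb (with_choice g C) (with_choice g D)"
    using rb_ctx[of "fst C" "snd C" "fst D" "snd D"] rb by simp
  ultimately have "shielded C D" unfolding shielded_def by blast
  from shielded_tau[OF this t] shielded_rb show ?thesis by blast
qed

lemma wtau_inert:
  assumes "wtau \<delta> I C C'" "C = (\<Gamma>, SPar W T)" "inert T"
  shows "\<exists>\<Gamma>' W'. C' = (\<Gamma>', SPar W' T) \<and> wtau \<delta> I (\<Gamma>, W) (\<Gamma>', W')"
  using assms(1) unfolding wtau_def
proof (induct rule: rtranclp_induct)
  case base
  then show ?case using assms(2) by blast
next
  case (step C' C'')
  then obtain \<Gamma>' W' where C': "C' = (\<Gamma>', SPar W' T)" "(\<lambda>C C'. xt C XTau C')\<^sup>*\<^sup>* (\<Gamma>, W) (\<Gamma>', W')" by blast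
  from xt_inert_tau[OF assms(3) step(2)[unfolded C'(1)]] obtain \<Gamma>'' W'' where
    "C'' = (\<Gamma>'', SPar W'' T)" "xt (\<Gamma>', W') XTau (\<Gamma>'', W'')" .
  with rtranclp.rtrancl_into_rtrancl[of "\<lambda>C C'. xt C XTau C'", OF C'(2)] show ?case by blast
qed

lemma delayed_alarmable:
  assumes "wfc (\<Gamma>, W)" "\<And>c. \<not> rcvP P c" "\<And>\<Gamma> W. closedS W \<Longrightarrow> alarmable g (\<Gamma>, SPar W (SProc P))"
  shows "alarmable g (\<Gamma>, SPar W (delayed k P))"
proof -
  from run_exists[OF assms(1)] obtain \<Gamma>' W' where r: "run k (\<Gamma>, W) (\<Gamma>', W')" by (metis surj_pair)
  have "closedS W'" using rds_wfc[OF run_rds[OF r] assms(1)] by (simp add: wfc_def conf_def)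
  from alarmable_rds[OF run_rds[OF run_delayed[OF r assms(2), of 0]]] assms(3)[OF this] show ?thesis
    by (simp add: delayed_0)
qed

lemma loud_alarmable: "closedS W \<Longrightarrow> alarmable g (\<Gamma>, SPar W (SProc (loud g)))"
  by (intro noisy_alarmable noisy_loud) (simp add: conf_def)

lemma wfc_delayed: "wfc (\<Gamma> :: ('c,'v) env, delayed k P) \<longleftrightarrow> closedS (SProc P)"
  by (metis delayed_def delayed_simps(2) wfc_SProc)

lemma sig_match:
  assumes rb: "rb C D" and wf: "wfc C" "wfc D" and t: "xt C XSig C'"
  shows "\<exists>D'. wext \<delta> I D XSig D' \<and> rb C' D'"
\<comment> \<open>The threshold is 2 so that the clock is still positive after one unit and
  truncation cannot hide more time. In the other case every unmentioned channel is idle one unit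
  later, as a shield requires.\<close>
proof (cases "\<exists>f. f \<notin> fcS (snd C) \<and> f \<notin> fcS (snd D) \<and> fst (fst C f) \<ge> 2")
  case True
  then obtain f where f: "f \<notin> fcS (snd C)" "f \<notin> fcS (snd D)" "fst (fst C f) \<ge> 2" by auto
  from rb_rd[OF rb] t obtain D' where D': "rd\<^sup>*\<^sup>* D D'" "rb C' D'" unfolding rd_iff by blast
  from rds_run[OF D'(1)] obtain n where n: "run n D D'" ..
  note rC = run_fresh[OF run_sig[OF run_refl t] f(1)] and rD = run_fresh[OF n f(2)]
  have "fst (fst C f) = fst (fst D f)"
    by (rule count_eq[of _ "snd C" _ "snd D"]) (use rb wf f in simp_all)
  moreover have "fst (fst C' f) = fst (fst D' f)"
    by (rule count_eq[of _ "snd C'" _ "snd D'"])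
      (use D' rC rD rds_wfc[OF xt_rds(2)[OF t] wf(1)] rds_wfc[OF D'(1) wf(2)] in simp_all)
  ultimately have "n = 1" using rC rD f(3) by auto
  with n D' run_1_wext show ?thesis by blast
next
  case False
  have cC: "fst (fst C f) \<le> 1" if "f \<notin> fcS (snd C)" "f \<notin> fcS (snd D)" for f
  proof -
    from False that have "\<not> 2 \<le> fst (fst C f)" by blast
    then show ?thesis by simp
  qed
  have cD: "fst (fst D f) \<le> 1" if "f \<notin> fcS (snd C)" "f \<notin> fcS (snd D)" for f
    using cC[OF that] count_eq[of "fst C" "snd C" "fst D" "snd D" f] rb wf that by simp
  have fin: "finite (fcS (snd C) \<union> fcS (snd D))" by (simp add: finite_fcS)
  from fresh[OF this] obtain g where g: "g \<notin> fcS (snd C)" "g \<notin> fcS (snd D)" by auto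
  \<comment> \<open>The delay of 1 lets the left perform its timed step and reach the choice, while
    the right can spend at most one unit without resolving it.\<close>
  let ?T = "delayed 1 (choice g)"
  have wfC': "wfc C'" using rds_wfc[OF xt_rds(2)[OF t] wf(1)] .
  have rC: "run (Suc 0) C C'" using run_sig[OF run_refl t] .
  have m1: "muffled g (fst C', snd C')" using muffled_wfc[of "fst C'" "snd C'"] wfC' run_fresh[OF rC g(1)] by simp
  have m2: "muffled g (fst D, snd D)" using muffled_wfc[of "fst D" "snd D"] wf(2) g(2) by simp
  have "xt (fst C, snd C) XSig (fst C', snd C')" using t by simp
  then have "xt (fst C, SPar (snd C) ?T) XSig (with_choice g C')"
    by (rule xt_par_sig_intro) (simp add: trans_delayed delayed_0)
  then have "rd (fst C, SPar (snd C) ?T) (with_choice g C')" by (simp add: rd_iff)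
  moreover have "rb (fst C, SPar (snd C) ?T) (fst D, SPar (snd D) ?T)"
    using rb_ctx[of "fst C" "snd C" "fst D" "snd D"] rb by simp
  ultimately obtain E where E: "rd\<^sup>*\<^sup>* (fst D, SPar (snd D) ?T) E" "rb (with_choice g C') E" using rb_rd by blast
  from rds_run[OF E(1)] obtain n where n: "run n (fst D, SPar (snd D) ?T) E" ..
  from match_choice[OF E(2) m1 n m2] obtain \<Gamma>' W' where
    E': "E = (\<Gamma>', SPar W' (delayed (1 - n) (choice g)))" "n \<le> 1" "run n (fst D, snd D) (\<Gamma>', W')" .
  have wfD': "wfc (\<Gamma>', W')" using rds_wfc[OF run_rds[OF E'(3)]] wf(2) by simp
  show ?thesis
  proof (cases "n = 0")
    case False
    with E'(2) have n1: "n = 1" by simp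
    then have "wext \<delta> I D XSig (\<Gamma>', W')" using run_1_wext E'(3) by simp
    have iC: "idle (fst C') f" "idle \<Gamma>' f" if "f \<notin> fcS (snd C)" "f \<notin> fcS (snd D)" for f
      using cC[OF that] cD[OF that] run_fresh[OF rC that(1)] run_fresh[OF E'(3), of f] that(2) n1
      by (simp_all add: idle_def)
    have "{f. exposed (fst C') f} \<subseteq> fcS (snd C) \<union> fcS (snd D)" "{f. exposed \<Gamma>' f} \<subseteq> fcS (snd C) \<union> fcS (snd D)"
      using iC unfolding exposed_iff by blast+
    then have "shield g C'" "shield g (\<Gamma>', W')"
      using g iC[OF g] wfC' wfD' finite_subset[OF _ fin] run_fresh[OF rC g(1)] run_fresh[OF E'(3), of g]
      by (simp_all add: shield_def wfc_def)
    then have "shielded C' (\<Gamma>', W')" unfolding shielded_def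
      using E(2) E'(1) n1 by (auto simp: delayed_0)
    with \<open>wext \<delta> I D XSig (\<Gamma>', W')\<close> shielded_rb show ?thesis by blast
  next
    \<comment> \<open>If no time passed, the right still has a delay before its choice. Silencing
      the left choice is answered in no time, so the delay and the choice behind it remain and the
      right stays alarmable, unlike the left.\<close>
    case True
    have wfT: "wfc (with_choice g C')" "wfc E"
      using wfC' wfD' E'(1) by (simp_all add: wfc_SPar wfc_SProc wfc_delayed)
    from tau_match[OF E(2) wfT xt_choice_zero] obtain F where
      F: "wtau \<delta> I E F" "rb (fst C', SPar (snd C') (zero 0)) F" by blast
    from wtau_inert[OF F(1) E'(1)] True inert_delayed[of 0 "choice g"] obtain \<Gamma>'' W'' where
      F': "F = (\<Gamma>'', SPar W'' ?T)" "wtau \<delta> I (\<Gamma>', W') (\<Gamma>'', W'')" by auto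
    have "wfc (\<Gamma>'', W'')" using rds_wfc[OF wtau_rds[OF F'(2)] wfD'] .
    then have "alarmable g F" unfolding F'(1)
      by (rule delayed_alarmable) (auto intro: choice_alarmable)
    with muffled_not_alarmable[OF muffled_zero[OF m1]] rb_alarmable[OF rb_sym[OF F(2)]] show ?thesis by blast
  qed
qed

section \<open>Matching idleness, inputs and deliveries\<close>

text \<open>The conditional on \<open>BExp\<close> refuses time until it is evaluated, and
  instantaneous steps never end an exposure. Where c is exposed the test can therefore only turn
  loud, while on the left it can end silently.\<close>

lemma idle_match:
  assumes rb: "rb (\<Gamma>1, W1) (\<Gamma>2, W2)" and wf: "wfc (\<Gamma>1, W1)" "wfc (\<Gamma>2, W2)" and c: "idle \<Gamma>1 c"
  shows "idle \<Gamma>2 c"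
proof (rule ccontr)
  assume "\<not> idle \<Gamma>2 c"
  then have exp: "exposed \<Gamma>2 c" by (simp add: idle_def exposed_def)
  have "finite (insert c (fcS W1))" by (simp add: finite_fcS)
  from fresh[OF this] obtain g where g: "g \<noteq> c" "g \<notin> fcS W1" by auto
  define T :: "('c,'v,'f) sys" where "T = SProc (PCond (BExp (CF c)) (loud g) PNil)"
  have clT: "closedS T" by (simp add: T_def closedS_def)
  have trT: "tr \<Gamma> T a V \<longleftrightarrow> a = ATau \<and> V = (if exposed \<Gamma> c then delayed 1 (loud g) else zero 1) \<or> (\<exists>c v. a = AIn c v) \<and> V = T" for \<Gamma> a V
    by (simp add: T_def trans_PCond delayed_def zero_def)
  have "xt (\<Gamma>1, SPar W1 T) XTau (\<Gamma>1, SPar W1 (zero 1))"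
    by (rule xt_par_right_tau) (use c in \<open>simp add: trT idle_def exposed_def\<close>)
  then have "rd (\<Gamma>1, SPar W1 T) (\<Gamma>1, SPar W1 (zero 1))" by (simp add: rd_iff)
  from rb_rd[OF rb_ctx[OF rb clT] this] obtain D where
    D: "rd\<^sup>*\<^sup>* (\<Gamma>2, SPar W2 T) D" "rb (\<Gamma>1, SPar W1 (zero 1)) D" by blast
  have wfT: "wfc (\<Gamma>2, SPar W2 T)" using wf(2) clT by (simp add: wfc_SPar) (simp add: T_def wfc_SProc)
  define ok where "ok E \<longleftrightarrow> (\<exists>\<Gamma>' W' T'. E = (\<Gamma>', SPar W' T') \<and>
    (T' = T \<and> exposed \<Gamma>' c \<or> T' = delayed 1 (loud g) \<or> noisy g \<Gamma>' T'))" for E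
  have okI: "exposed \<Gamma>' c \<Longrightarrow> ok (\<Gamma>', SPar W' T)" "ok (\<Gamma>', SPar W' (delayed 1 (loud g)))"
    "noisy g \<Gamma>' T' \<Longrightarrow> ok (\<Gamma>', SPar W' T')" for \<Gamma>' W' T'
    unfolding ok_def by auto
  from D(1) have "wfc D \<and> ok D"
  proof (induct rule: rtranclp_induct)
    case base
    show ?case using okI(1)[OF exp] wfT by (rule conjI[rotated])
  next
    case (step D D')
    from step(3) obtain \<Gamma>' W' T' where D: "D = (\<Gamma>', SPar W' T')" and
      st: "T' = T \<and> exposed \<Gamma>' c \<or> T' = delayed 1 (loud g) \<or> noisy g \<Gamma>' T'" unfolding ok_def by blast
    note s = step(2)[unfolded D]
    from st have "ok D'"
    proof (elim disjE conjE)
      assume T': "T' = T" "exposed \<Gamma>' c"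
      from s[unfolded rd_iff T'(1)] show ?thesis
      proof
        assume "xt (\<Gamma>', SPar W' T) XTau D'"
        then show ?thesis
        proof (cases rule: xt_par_tau)
          case (outL d v V V')
          then have "V' = T" by (simp add: trT)
          with okI(1)[OF exposed_upd[OF T'(2), of "AOut d v" \<delta>]] show ?thesis by (simp add: outL(1))
        next
          case (tauR V)
          then have "V = delayed 1 (loud g)" using T'(2) by (simp add: trT)
          with okI(2) show ?thesis by (simp add: tauR(1))
        next
          case (tauL V)
          from okI(1)[OF T'(2)] show ?thesis by (simp add: tauL(1))
        next
          case (outR d v V V')
          then show ?thesis by (simp add: trT)
        qed
      next
        assume "xt (\<Gamma>', SPar W' T) XSig D'"
        \<comment> \<open>Vacuous: the unevaluated test refuses time, so the exposure of c cannot
          run out first.\<close>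
        then show ?thesis by (rule xt_par_sig) (simp add: trT)
      qed
    next
      assume T': "T' = delayed 1 (loud g)"
      then have inT: "inert T'" using inert_delayed[of 0] by simp
      from s[unfolded rd_iff] show ?thesis
      proof
        assume "xt (\<Gamma>', SPar W' T') XTau D'"
        from xt_inert_tau[OF inT this] obtain \<Gamma>'' V where "D' = (\<Gamma>'', SPar V T')" .
        with okI(2) show ?thesis by (simp add: T')
      next
        assume "xt (\<Gamma>', SPar W' T') XSig D'"
        then obtain V V' where V: "D' = (upd \<delta> ASig \<Gamma>', SPar V V')" "tr \<Gamma>' T' ASig V'" by (rule xt_par_sig)
        then have "V' = SProc (loud g)" by (simp add: T' trans_delayed delayed_0)
        with okI(3)[OF noisy_loud] show ?thesis by (simp add: V(1) del: upd.simps)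
      qed
    next
      assume "noisy g \<Gamma>' T'"
      from noisy_rd[OF s this] show ?thesis using okI(3) by blast
    qed
    moreover have "wfc D'" using rd_wfc[OF step(2)] step(3) by blast
    ultimately show ?case by (rule conjI[rotated])
  qed
  then obtain \<Gamma>' W' T' where wfD: "wfc D" and D': "D = (\<Gamma>', SPar W' T')" and
    st: "T' = T \<and> exposed \<Gamma>' c \<or> T' = delayed 1 (loud g) \<or> noisy g \<Gamma>' T'" unfolding ok_def by blast
  have wfW: "wfc (\<Gamma>', W')" using wfD unfolding D' wfc_SPar by simp
  have al: "alarmable g (\<Gamma>', SPar W' (delayed 1 (loud g)))"
    by (rule delayed_alarmable[OF wfW]) (auto intro: loud_alarmable)
  from st have "alarmable g D"
  proof (elim disjE conjE)
    assume "T' = T" "exposed \<Gamma>' c"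
    then have "xt D XTau (\<Gamma>', SPar W' (delayed 1 (loud g)))"
      unfolding D' by (intro xt_par_right_tau) (simp add: trT)
    from alarmable_rds[OF xt_rds(1)[OF this] al] show ?thesis .
  next
    assume "noisy g \<Gamma>' T'"
    then show ?thesis unfolding D' using wfD D' by (intro noisy_alarmable) (simp_all add: wfc_def)
  next
    assume "T' = delayed 1 (loud g)"
    then show ?thesis using al by (simp add: D')
  qed
  moreover have "\<not> alarmable g (\<Gamma>1, SPar W1 (zero 1))"
    by (rule muffled_not_alarmable[OF muffled_zero[OF muffled_wfc[OF wf(1) g(2)]]])
  ultimately show False using rb_alarmable[OF rb_sym[OF D(2)]] by blast
qed

text \<open>A broadcast of the context makes the system perform the input, and \<open>AIn\<close>
  and \<open>AOut\<close> update the environment alike. The summand \<open>PTau (loud g)\<close>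
  keeps the test alarmable until it has sent, so a silent remainder certifies that the right side
  performed the input too.\<close>

lemma input_match:
  assumes rb: "rb (\<Gamma>1, W1) (\<Gamma>2, W2)" and wf: "wfc (\<Gamma>1, W1)" "wfc (\<Gamma>2, W2)"
    and t: "tr \<Gamma>1 W1 (AIn c v) W1'"
  shows "\<exists>D'. wext \<delta> I (\<Gamma>2, W2) (XIn c v) D' \<and> rb (upd \<delta> (AIn c v) \<Gamma>1, W1') D'"
proof -
  have "finite (insert c (fcS W1))" by (simp add: finite_fcS)
  from fresh[OF this] obtain g where g: "g \<noteq> c" "g \<notin> fcS W1" by auto
  define T :: "('c,'v,'f) sys" where "T = SProc (PSum (PSnd (CF c) (EVal v) PNil) (PTau (loud g)))"
  have clT: "closedS T" by (simp add: T_def closedS_def)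
  have trT: "tr \<Gamma> T a V \<longleftrightarrow> a = AOut c v \<and> V = zero (\<delta> v) \<or> a = ATau \<and> V = SProc (loud g) \<or>
    (\<exists>c v. a = AIn c v) \<and> V = T" for \<Gamma> a V
    unfolding T_def by (subst trans_PSum) (auto simp: trans_PSnd trans_PTau zero_def)
  let ?\<Gamma>1' = "upd \<delta> (AOut c v) \<Gamma>1"
  have step1: "xt (\<Gamma>1, SPar W1 T) XTau (?\<Gamma>1', SPar W1' (zero (\<delta> v)))"
    by (intro xt_tau_intros trans.SyncR[OF t]) (simp add: trT)
  have wfT: "wfc (\<Gamma>1, SPar W1 T)" "wfc (\<Gamma>2, SPar W2 T)"
    using wf clT by (simp_all add: wfc_SPar) (simp_all add: T_def wfc_SProc)
  from tau_match[OF rb_ctx[OF rb clT] wfT step1] obtain E where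
    E: "wtau \<delta> I (\<Gamma>2, SPar W2 T) E" "rb (?\<Gamma>1', SPar W1' (zero (\<delta> v))) E" by blast
  have "wfc (?\<Gamma>1', SPar W1' (zero (\<delta> v)))" using rds_wfc[OF xt_rds(1)[OF step1] wfT(1)] .
  moreover have "g \<notin> fcS W1'" using trans_fcS[OF t] g(2) by blast
  ultimately have "\<not> alarmable g (?\<Gamma>1', SPar W1' (zero (\<delta> v)))"
    using muffled_not_alarmable muffled_wfc[of _ "SPar W1' (zero (\<delta> v))" g] by simp
  then have na: "\<not> alarmable g E" using rb_alarmable[OF rb_sym[OF E(2)]] by blast
  have cE: "conf E" using rb_conf[OF E(2)] by blast
  define ok where "ok D \<longleftrightarrow> (\<exists>\<Gamma>' W' T'. D = (\<Gamma>', SPar W' T') \<and> (T' = T \<and> wtau \<delta> I (\<Gamma>2, W2) (\<Gamma>', W') \<or>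
     T' = zero (\<delta> v) \<and> wext \<delta> I (\<Gamma>2, W2) (XIn c v) (\<Gamma>', W') \<or> noisy g \<Gamma>' T'))" for D
  have okI: "wtau \<delta> I (\<Gamma>2, W2) (\<Gamma>', W') \<Longrightarrow> ok (\<Gamma>', SPar W' T)"
    "wext \<delta> I (\<Gamma>2, W2) (XIn c v) (\<Gamma>', W') \<Longrightarrow> ok (\<Gamma>', SPar W' (zero (\<delta> v)))"
    "noisy g \<Gamma>' T' \<Longrightarrow> ok (\<Gamma>', SPar W' T')" for \<Gamma>' W' T'
    unfolding ok_def by auto
  from E(1) have "ok E"
    unfolding wtau_def
  proof (induct rule: rtranclp_induct)
    case base
    show ?case by (rule okI(1)[OF wtau_refl])
  next
    case (step D D')
    from step(3) obtain \<Gamma>' W' T' where D: "D = (\<Gamma>', SPar W' T')" and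
      st: "T' = T \<and> wtau \<delta> I (\<Gamma>2, W2) (\<Gamma>', W') \<or>
       T' = zero (\<delta> v) \<and> wext \<delta> I (\<Gamma>2, W2) (XIn c v) (\<Gamma>', W') \<or> noisy g \<Gamma>' T'"
      unfolding ok_def by blast
    note s = step(2)[unfolded D]
    from st show ?case
    proof (elim disjE conjE)
      assume T': "T' = T" and w: "wtau \<delta> I (\<Gamma>2, W2) (\<Gamma>', W')"
      from s[unfolded T'] show ?thesis
      proof (cases rule: xt_par_tau)
        case (tauL V)
        from okI(1)[OF wtau_step[OF w xt_tau_intros(1)[OF tauL(2)]]] show ?thesis by (simp add: tauL(1))
      next
        case (tauR V)
        then have "V = SProc (loud g)" by (simp add: trT)
        with okI(3)[OF noisy_loud] show ?thesis by (simp add: tauR(1))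
      next
        case (outL d u V V')
        then have "V' = T" by (simp add: trT)
        with okI(1)[OF wtau_step[OF w xt_tau_intros(2)[OF outL(2)]]] show ?thesis by (simp only: outL(1))
      next
        case (outR d u V V')
        then have V': "V' = zero (\<delta> v)" "d = c" "u = v" by (auto simp: trT)
        have "xt (\<Gamma>', W') (XIn c v) (upd \<delta> (AIn c v) \<Gamma>', V)" using outR(2) V' by (intro ext.Input) simp
        with w wtau_refl have "wext \<delta> I (\<Gamma>2, W2) (XIn c v) (upd \<delta> (AIn c v) \<Gamma>', V)"
          unfolding wext_def by blast
        from okI(2)[OF this] show ?thesis by (simp add: outR(1) V')
      qed
    next
      assume T': "T' = zero (\<delta> v)" and w: "wext \<delta> I (\<Gamma>2, W2) (XIn c v) (\<Gamma>', W')"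
      then have "inert T'" using inert_zero by simp
      from xt_inert_tau[OF this s] obtain \<Gamma>'' V where
        V: "D' = (\<Gamma>'', SPar V T')" "xt (\<Gamma>', W') XTau (\<Gamma>'', V)" .
      have "wext \<delta> I (\<Gamma>2, W2) (XIn c v) (\<Gamma>'', V)" using w wtau_step[OF _ V(2)] unfolding wext_def by blast
      from okI(2)[OF this] show ?thesis by (simp only: V(1) T')
    next
      assume "noisy g \<Gamma>' T'"
      from noisy_rd[OF iffD2[OF rd_iff disjI1[OF s]] this] show ?thesis using okI(3) by blast
    qed
  qed
  then obtain \<Gamma>' W' T' where E': "E = (\<Gamma>', SPar W' T')" and st: "T' = T \<and> wtau \<delta> I (\<Gamma>2, W2) (\<Gamma>', W') \<or>
     T' = zero (\<delta> v) \<and> wext \<delta> I (\<Gamma>2, W2) (XIn c v) (\<Gamma>', W') \<or> noisy g \<Gamma>' T'" unfolding ok_def by blast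
  have "T' \<noteq> T"
  proof
    assume "T' = T"
    then have "xt E XTau (\<Gamma>', SPar W' (SProc (loud g)))" unfolding E' by (intro xt_par_right_tau) (simp add: trT)
    moreover have "closedS W'" using cE by (simp add: E' conf_def)
    ultimately show False using na alarmable_rds xt_rds(1) loud_alarmable by blast
  qed
  moreover have "\<not> noisy g \<Gamma>' T'" using na noisy_alarmable cE unfolding E' by blast
  ultimately have z: "T' = zero (\<delta> v)" and w: "wext \<delta> I (\<Gamma>2, W2) (XIn c v) (\<Gamma>', W')" using st by blast+
  have "rb (?\<Gamma>1', W1') (\<Gamma>', W')" by (rule rb_cancel[OF E(2)[unfolded E' z]])
  then have "rb (upd \<delta> (AIn c v) \<Gamma>1, W1') (\<Gamma>', W')" by simp
  with w show ?thesis by blast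
qed

lemma inert_SARcv: "inert (SARcv r x P)"
proof -
  have "a = ASig \<or> (\<exists>c v. a = AIn c v) \<and> T' = SARcv r x P" if "tr \<Gamma> (SARcv r x P) a T'" for \<Gamma> a T'
    using that by (cases a) (auto simp: trans_SARcv_AIn trans_SARcv_instantaneous)
  then show ?thesis unfolding inert_def by blast
qed

lemma wtau_exposed:
  fixes C C' :: "('c,'v,'f) config"
  assumes "wtau \<delta> I C C'" "exposed (fst C) c" shows "exposed (fst C') c"
  using assms unfolding wtau_def
proof (induct rule: rtranclp_induct)
  case (step C' C'')
  then show ?case using xt_fresh[of "fst C'" "snd C'" "fst C''" "snd C''"] by simp
qed simp

text \<open>A receiver reveals the transmitted value only when it finishes. That it finishes on the
  right in the same time unit follows because c must be idle afterwards; that the value is v follows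
  because any other value makes the test loud.\<close>

lemma deliver_match:
  assumes rb: "rb (\<Gamma>1, W1) (\<Gamma>2, W2)" and wf: "wfc (\<Gamma>1, W1)" "wfc (\<Gamma>2, W2)"
    and c: "\<Gamma>1 c = (1, v)" and t: "tr \<Gamma>1 W1 ASig W1'"
  shows "\<exists>D'. wext \<delta> I (\<Gamma>2, W2) (XGam c v) D' \<and> rb (upd \<delta> ASig \<Gamma>1, W1') D'"
proof -
  have "finite (insert c (fcS W1))" by (simp add: finite_fcS)
  from fresh[OF this] obtain g where g: "g \<noteq> c" "g \<notin> fcS W1" by auto
  \<comment> \<open>The second summand keeps the test alarmable until the comparison has been made;
    the sum also refuses time until then.\<close>
  define Q :: "('v,'f) exp \<Rightarrow> ('c,'v,'f) proc" where
    "Q e = PSum (PCond (BEq e (EVal v)) PNil (loud g)) (PTau (loud g))" for e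
  define T :: "('c,'v,'f) sys" where "T = SARcv (CF c) 0 (Q (EVar 0))"
  have clT: "closedS T" by (simp add: T_def Q_def closedS_def)
  have sQ: "substP 0 w (Q (EVar 0)) = Q (EVal w)" for w by (simp add: Q_def)
  have trQ: "tr \<Gamma> (SProc (Q (EVal w))) a V \<longleftrightarrow>
      a = ATau \<and> (V = (if w = v then zero 1 else delayed 1 (loud g)) \<or> V = SProc (loud g)) \<or>
      (\<exists>c v. a = AIn c v) \<and> V = SProc (Q (EVal w))" for \<Gamma> w a V
    unfolding Q_def by (subst trans_PSum) (auto simp: trans_PCond trans_PTau zero_def delayed_def)
  have inT: "inert T" unfolding T_def by (rule inert_SARcv)
  \<comment> \<open>An active receiver on c is well-formed on the right only if c is exposed there
    as well.\<close>
  have exp2: "exposed \<Gamma>2 c"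
    using idle_match[OF rb_sym[OF rb] wf(2,1), of c] c unfolding exposed_iff by (auto simp: idle_def)
  have "exposed \<Gamma>1 c" using c by (simp add: exposed_def)
  with exp2 clT have "wfc (\<Gamma>1, T)" "wfc (\<Gamma>2, T)"
    by (simp_all add: wfc_def conf_def T_def wf0.intros(2))
  with wf have wfT: "wfc (\<Gamma>1, SPar W1 T)" "wfc (\<Gamma>2, SPar W2 T)"
    unfolding wfc_SPar by blast+
  let ?\<Gamma>1' = "upd \<delta> ASig \<Gamma>1"
  have s1: "xt (\<Gamma>1, SPar W1 T) XSig (?\<Gamma>1', SPar W1' (SProc (Q (EVal v))))"
    by (intro xt_tau_intros trans.TimePar[OF t]) (simp add: T_def trans_SARcv_ASig c sQ)
  have s2: "xt (?\<Gamma>1', SPar W1' (SProc (Q (EVal v)))) XTau (?\<Gamma>1', SPar W1' (zero 1))"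
    by (intro xt_par_right_tau) (simp add: trQ)
  from sig_match[OF rb_ctx[OF rb clT] wfT s1] obtain E where
    E: "wext \<delta> I (\<Gamma>2, SPar W2 T) XSig E" "rb (?\<Gamma>1', SPar W1' (SProc (Q (EVal v)))) E" by blast
  from E(1) obtain D D' where D: "wtau \<delta> I (\<Gamma>2, SPar W2 T) D" "xt D XSig D'" "wtau \<delta> I D' E"
    unfolding wext_def by blast
  have wfE: "wfc E" using rds_wfc[OF wtau_rds[OF D(3)]] rds_wfc[OF xt_rds(2)[OF D(2)]] rds_wfc[OF wtau_rds[OF D(1)] wfT(2)] by blast
  have wf1': "wfc (?\<Gamma>1', SPar W1' (SProc (Q (EVal v))))" using rds_wfc[OF xt_rds(2)[OF s1] wfT(1)] .
  from tau_match[OF E(2) wf1' wfE s2] obtain F where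
    F: "wtau \<delta> I E F" "rb (?\<Gamma>1', SPar W1' (zero 1)) F" by blast
  have DF: "wtau \<delta> I D' F" using D(3) F(1) by (rule wtau_trans)
  have wfF: "wfc F" using rds_wfc[OF wtau_rds[OF F(1)] wfE] .
  have wf1: "wfc (?\<Gamma>1', SPar W1' (zero 1))" using rds_wfc[OF xt_rds(1)[OF s2] wf1'] .
  have "g \<notin> fcS W1'" using trans_fcS[OF t] g(2) by blast
  with wf1 have "\<not> alarmable g (?\<Gamma>1', SPar W1' (zero 1))"
    using muffled_not_alarmable muffled_wfc[of _ "SPar W1' (zero 1)" g] by simp
  then have na: "\<not> alarmable g F" using rb_alarmable[OF rb_sym[OF F(2)]] by blast
  have "idle (fst F) c"
    using idle_match[of ?\<Gamma>1' "SPar W1' (zero 1)" "fst F" "snd F" c] F(2) wf1 wfF c by (simp add: idle_def)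
  \<comment> \<open>Had c still been exposed right after the time step, the instantaneous steps
    leading to F would have kept it so.\<close>
  then have nexp: "\<not> exposed (fst D') c" using wtau_exposed[OF DF] unfolding exposed_iff by blast
  from wtau_inert[OF D(1) refl inT] obtain \<Gamma>d Wd where
    D1: "D = (\<Gamma>d, SPar Wd T)" "wtau \<delta> I (\<Gamma>2, W2) (\<Gamma>d, Wd)" by blast
  from D(2)[unfolded D1(1)] obtain Wd' Td where
    D2: "D' = (upd \<delta> ASig \<Gamma>d, SPar Wd' Td)" "tr \<Gamma>d Wd ASig Wd'" "tr \<Gamma>d T ASig Td" by (rule xt_par_sig)
  \<comment> \<open>So the receiver did not keep waiting: it ended in this unit with count 1 and
    read some value w.\<close>
  have "\<not> fst (\<Gamma>d c) > 1" using nexp by (simp add: D2(1) exposed_def)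
  with D2(3) obtain w where w: "\<Gamma>d c = (1, w)" "Td = SProc (Q (EVal w))"
    by (auto simp: T_def trans_SARcv_ASig sQ)
  let ?\<Gamma>d' = "upd \<delta> ASig \<Gamma>d"
  define ok where "ok E \<longleftrightarrow> (\<exists>\<Gamma>' W' T'. E = (\<Gamma>', SPar W' T') \<and> (
     (T' = Td \<or> T' = zero 1 \<and> w = v) \<and> wtau \<delta> I (?\<Gamma>d', Wd') (\<Gamma>', W') \<or>
     T' = delayed 1 (loud g) \<or> noisy g \<Gamma>' T'))" for E
  have okI: "wtau \<delta> I (?\<Gamma>d', Wd') (\<Gamma>', W') \<Longrightarrow> ok (\<Gamma>', SPar W' Td)"
    "w = v \<Longrightarrow> wtau \<delta> I (?\<Gamma>d', Wd') (\<Gamma>', W') \<Longrightarrow> ok (\<Gamma>', SPar W' (zero 1))"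
    "ok (\<Gamma>', SPar W' (delayed 1 (loud g)))"
    "noisy g \<Gamma>' T' \<Longrightarrow> ok (\<Gamma>', SPar W' T')" for \<Gamma>' W' T'
    unfolding ok_def by (simp_all del: upd.simps)
  from DF have "ok F"
    unfolding wtau_def
  proof (induct rule: rtranclp_induct)
    case base
    show ?case unfolding D2(1) by (rule okI(1)[OF wtau_refl])
  next
    case (step C C')
    from step(3) obtain \<Gamma>' W' T' where C: "C = (\<Gamma>', SPar W' T')" and
      st: "(T' = Td \<or> T' = zero 1 \<and> w = v) \<and> wtau \<delta> I (?\<Gamma>d', Wd') (\<Gamma>', W') \<or>
       T' = delayed 1 (loud g) \<or> noisy g \<Gamma>' T'"
      unfolding ok_def by blast
    note s = step(2)[unfolded C]
    from st show ?case
    proof (elim disjE conjE)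
      assume T': "T' = Td" and r: "wtau \<delta> I (?\<Gamma>d', Wd') (\<Gamma>', W')"
      from s[unfolded T'] show ?thesis
      proof (cases rule: xt_par_tau)
        case (tauL V)
        from okI(1)[OF wtau_step[OF r xt_tau_intros(1)[OF tauL(2)]]] show ?thesis by (simp only: tauL(1))
      next
        case (tauR V)
        then have "V = zero 1 \<and> w = v \<or> V = delayed 1 (loud g) \<or> V = SProc (loud g)"
          by (auto simp: w(2) trQ split: if_splits)
        then show ?thesis unfolding tauR(1) using okI(2)[OF _ r] okI(3)[of \<Gamma>' W'] okI(4)[OF noisy_loud, of \<Gamma>' W']
          by (elim disjE conjE) simp_all
      next
        case (outL d u V V')
        then have "V' = Td" by (simp add: w(2) trQ)
        with okI(1)[OF wtau_step[OF r xt_tau_intros(2)[OF outL(2)]]] show ?thesis by (simp only: outL(1))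
      next
        case (outR d u V V')
        then show ?thesis by (simp add: w(2) trQ)
      qed
    next
      assume T': "T' = zero 1" "w = v" and r: "wtau \<delta> I (?\<Gamma>d', Wd') (\<Gamma>', W')"
      then have "inert T'" using inert_zero by simp
      from xt_inert_tau[OF this s] obtain \<Gamma>'' V where
        V: "C' = (\<Gamma>'', SPar V T')" "xt (\<Gamma>', W') XTau (\<Gamma>'', V)" .
      from okI(2)[OF T'(2) wtau_step[OF r V(2)]] show ?thesis by (simp only: V(1) T'(1))
    next
      assume T': "T' = delayed 1 (loud g)"
      then have "inert T'" using inert_delayed[of 0] by simp
      from xt_inert_tau[OF this s] obtain \<Gamma>'' V where V: "C' = (\<Gamma>'', SPar V T')" .
      from okI(3) show ?thesis by (simp only: V T')
    next
      assume "noisy g \<Gamma>' T'"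
      from noisy_rd[OF iffD2[OF rd_iff disjI1[OF s]] this] show ?thesis using okI(4) by blast
    qed
  qed
  then obtain \<Gamma>' W' T' where F': "F = (\<Gamma>', SPar W' T')" and
    st: "(T' = Td \<or> T' = zero 1 \<and> w = v) \<and> wtau \<delta> I (?\<Gamma>d', Wd') (\<Gamma>', W') \<or>
     T' = delayed 1 (loud g) \<or> noisy g \<Gamma>' T'" unfolding ok_def by blast
  have wfW: "wfc (\<Gamma>', W')" using wfF unfolding F' wfc_SPar by simp
  then have clW: "closedS W'" by (simp add: wfc_def conf_def)
  have "T' \<noteq> Td"
  proof
    assume "T' = Td"
    then have "xt F XTau (\<Gamma>', SPar W' (SProc (loud g)))" unfolding F' by (intro xt_par_right_tau) (simp add: w(2) trQ)
    then show False using na alarmable_rds xt_rds(1) loud_alarmable[OF clW] by blast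
  qed
  moreover have "\<not> noisy g \<Gamma>' T'" using na noisy_alarmable wfF unfolding F' wfc_def by blast
  moreover have "T' \<noteq> delayed 1 (loud g)"
    using na delayed_alarmable[OF wfW, of "loud g" g 1] loud_alarmable unfolding F' by auto
  ultimately have z: "T' = zero 1" "w = v" "wtau \<delta> I (?\<Gamma>d', Wd') (\<Gamma>', W')" using st by blast+
  have "xt (\<Gamma>d, Wd) (XGam c v) (?\<Gamma>d', Wd')" using w(1) z(2) D2(2) by (intro ext.Deliver) simp_all
  with D1(2) z(3) have "wext \<delta> I (\<Gamma>2, W2) (XGam c v) (\<Gamma>', W')" unfolding wext_def by blast
  moreover have "rb (?\<Gamma>1', W1') (\<Gamma>', W')" using rb_cancel F(2) F' z(1) by blast
  ultimately show ?thesis by blast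
qed

section \<open>Assembling the bisimulation\<close>

lemma ext_match:
  assumes rb: "rb C D" and wf: "wfc C" "wfc D" and x: "xt C \<alpha> C'"
  shows "\<exists>D'. wext_hat \<delta> I D \<alpha> D' \<and> rb C' D'"
proof -
  obtain \<Gamma>2 W2 where D: "D = (\<Gamma>2, W2)" by (cases D)
  have tau: ?thesis if "\<alpha> = XTau"
    using tau_match[OF rb wf x[unfolded that]] unfolding wext_hat_def that if_P[OF refl] .
  have weak: ?thesis if "\<alpha> \<noteq> XTau" "\<exists>D'. wext \<delta> I D \<alpha> D' \<and> rb C' D'"
    using that(2) unfolding wext_hat_def if_not_P[OF that(1)] .
  from x show ?thesis
  proof cases
    case (Input \<Gamma> W c v W')
    note C = Input(1)
    from input_match[OF rb[unfolded C D] wf(1)[unfolded C] wf(2)[unfolded D] Input(4)] show ?thesis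
      by (intro weak) (simp_all only: Input D, simp)
  next
    case (Time \<Gamma> W W')
    from sig_match[OF rb wf x[unfolded Time(2)]] show ?thesis
      by (intro weak) (simp_all only: Time(2), simp)
  next
    case (Deliver \<Gamma> c v W W')
    note C = Deliver(1)
    from deliver_match[OF rb[unfolded C D] wf(1)[unfolded C] wf(2)[unfolded D] Deliver(4,5)] show ?thesis
      by (intro weak) (simp_all only: Deliver D, simp)
  next
    case (Idle \<Gamma> c W)
    note C = Idle(1)
    from idle_match[OF rb[unfolded C D] wf(1)[unfolded C] wf(2)[unfolded D] Idle(4)]
    have "xt D (XIota c) D" unfolding D by (rule ext.Idle)
    then have "wext \<delta> I D (XIota c) D" unfolding wext_def using wtau_refl by blast
    moreover have "rb C' D" using rb by (simp only: C Idle(3))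
    ultimately have "\<exists>D'. wext \<delta> I D \<alpha> D' \<and> rb C' D'" unfolding Idle(2) by blast
    then show ?thesis by (rule weak[rotated]) (simp add: Idle(2))
  qed (rule tau, assumption)+
qed

lemma ext_wfc:
  assumes "xt C \<alpha> C'" "wfc C" shows "wfc C'"
  using assms(1)
proof cases
  case (Input \<Gamma> W c v W')
  with assms(2) have "wfd (active \<Gamma>) W" "closedS W"
    by (simp_all add: wfc_def conf_def wf0_iff_wfd[OF infinite_channels])
  with trans_wfd[OF Input(4) \<delta>_pos] trans_closedS[OF Input(4)] show ?thesis
    unfolding Input(3) by (simp add: wfc_def conf_def wf0_iff_wfd[OF infinite_channels] del: upd.simps)
next
  case (Time \<Gamma> W W')
  with assms(1) have "xt C XSig C'" by (simp only:)
  from rds_wfc[OF xt_rds(2)[OF this] assms(2)] show ?thesis .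
next
  case (Shh \<Gamma> W c v W')
  with assms(1) have "xt C XTau C'" by (simp only:)
  from rds_wfc[OF xt_rds(1)[OF this] assms(2)] show ?thesis .
next
  case (TauExt \<Gamma> W W')
  with assms(1) have "xt C XTau C'" by (simp only:)
  from rds_wfc[OF xt_rds(1)[OF this] assms(2)] show ?thesis .
next
  case (Deliver \<Gamma> c v W W')
  from ext.Time[OF Deliver(5)] have "xt C XSig C'" by (simp only: Deliver(1,3))
  from rds_wfc[OF xt_rds(2)[OF this] assms(2)] show ?thesis .
next
  case (Idle \<Gamma> c W)
  with assms(2) show ?thesis by (simp only:)
qed

lemma wext_hat_wfc:
  fixes C C' :: "('c,'v,'f) config"
  assumes "wext_hat \<delta> I C \<alpha> C'" "wfc C" shows "wfc C'"
proof -
  have w: "wtau \<delta> I A B \<Longrightarrow> wfc A \<Longrightarrow> wfc B" for A B :: "('c,'v,'f) config"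
    by (rule rds_wfc[OF wtau_rds])
  show ?thesis
  proof (cases "\<alpha> = XTau")
    case True
    with assms w show ?thesis unfolding wext_hat_def by simp
  next
    case False
    with assms(1) obtain D D' where "wtau \<delta> I C D" "xt D \<alpha> D'" "wtau \<delta> I D' C'"
      unfolding wext_hat_def wext_def if_not_P[OF False] by blast
    from w[OF this(3) ext_wfc[OF this(2) w[OF this(1) assms(2)]]] show ?thesis .
  qed
qed

lemma bisimulation_rbc: "bisimulation \<delta> I (\<lambda>C1 C2 :: ('c,'v,'f) config. wfc C1 \<and> wfc C2 \<and> rb C1 C2)"
proof -
  have *: "\<exists>D'. wext_hat \<delta> I D \<alpha> D' \<and> wfc C' \<and> wfc D' \<and> rb C' D'"
    if "wfc C" "wfc D" "rb C D" "xt C \<alpha> C'" for C D \<alpha> C'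
  proof -
    from ext_match[OF that(3,1,2,4)] obtain D' where "wext_hat \<delta> I D \<alpha> D'" "rb C' D'" by blast
    with ext_wfc[OF that(4,1)] wext_hat_wfc[OF this(1) that(2)] show ?thesis by blast
  qed
  show ?thesis unfolding bisimulation_def
  proof (intro conjI allI impI)
    fix C1 C2 \<alpha> C1'
    assume "(wfc C1 \<and> wfc C2 \<and> rb C1 C2) \<and> xt C1 \<alpha> C1'"
    then show "\<exists>C2'. wext_hat \<delta> I C2 \<alpha> C2' \<and> wfc C1' \<and> wfc C2' \<and> rb C1' C2'" using * by blast
  next
    fix C1 C2 \<alpha> C2'
    assume "(wfc C1 \<and> wfc C2 \<and> rb C1 C2) \<and> xt C2 \<alpha> C2'"
    then show "\<exists>C1'. wext_hat \<delta> I C1 \<alpha> C1' \<and> wfc C1' \<and> wfc C2' \<and> rb C1' C2'"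
      using *[of C2 C1 \<alpha> C2'] rb_sym by blast
  qed (auto simp: wfc_def)
qed

end

theorem mainTheorem20:
  fixes \<delta> :: "'v val \<Rightarrow> nat" and I :: "'f \<Rightarrow> 'v val list \<Rightarrow> 'v val"
  assumes "infinite (UNIV :: 'c set)"
    and "\<forall>v. \<delta> v \<ge> 1"
  shows "bisimulation \<delta> I
           (\<lambda>C1 C2 :: ('c,'v,'f) config. wfc C1 \<and> wfc C2 \<and> rbc \<delta> I C1 C2)
       \<and> (\<forall>C1 C2 :: ('c,'v,'f) config. wfc C1 \<and> wfc C2 \<and> rbc \<delta> I C1 C2 \<longrightarrow> bisim \<delta> I C1 C2)"
proof -
  have "cccp TYPE('c) \<delta>" using assms by (simp add: cccp_def)
  note bisimulation = cccp.bisimulation_rbc[OF this]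
  show ?thesis
  proof (intro conjI allI impI)
    fix C1 C2 :: "('c,'v,'f) config"
    assume "wfc C1 \<and> wfc C2 \<and> rbc \<delta> I C1 C2"
    then show "bisim \<delta> I C1 C2" unfolding bisim_def using bisimulation
      by (intro exI[of _ "\<lambda>C1 C2. wfc C1 \<and> wfc C2 \<and> rbc \<delta> I C1 C2"]) simp
  qed (rule bisimulation)
qed

end
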